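(* Let $\mathcal{K}_n$ and $\mathcal{L}_n$ be the random variables denoting the number of positive summands and the number of negative summands, respectively, in the far-difference representation of an integer chosen uniformly at random from the integers in $(S_{n-1},S_n]$. Let $\varphi=\frac{1+\sqrt5}{2}$. As $n\to\infty$: (i) $\mathbb{E}[\mathcal{K}_n]=\frac{1}{10}n+\frac{371-113\sqrt5}{40}+o(1)$, and $\mathbb{E}[\mathcal{K}_n]-\mathbb{E}[\mathcal{L}_n]=\frac{\sqrt5+1}{4}+o(1)=\frac{\varphi}{2}+o(1)$; (ii) the variances of $\mathcal{K}_n$ and of $\mathcal{L}_n$ are both of size $\frac{29\sqrt5-25}{1000}n$ (i.e. asymptotic to this quantity); (iii) the standardized joint density of $\mathcal{K}_n$ and $\mathcal{L}_n$ converges weakly to a bivariate Gaussian with negative correlation $\frac{10\sqrt5-121}{179}=-\frac{21-2\varphi}{29+2\varphi}\approx-0.551$; (iv) $\mathcal{K}_n+\mathcal{L}_n$ and $\mathcal{K}_n-\mathcal{L}_n$ are independent in the limit $n\to\infty$, i.e. the joint law of their standardizations converges weakly to that of two independent standard normals.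
   Context: The Fibonacci numbers are indexed by $F_1=1$, $F_2=2$, $F_{n+1}=F_n+F_{n-1}$. A far-difference representation of an integer is an expression of it as a (finite, possibly empty) sum of terms $\pm F_n$ such that every two terms of the same sign differ in index by at least $4$ and every two terms of opposite sign differ in index by at least $3$. Set $S_n=\sum_{0<n-4i\le n}F_{n-4i}=F_n+F_{n-4}+F_{n-8}+\cdots$ for $n>0$ and $S_n=0$ otherwise. Every integer has a unique far-difference representation (Alpert), and for integers in $(S_{n-1},S_n]$ its term of largest index is $+F_n$.
   Formalization: The constant term (371−113√5)/40 ≈ 2.958 in E[K_n] is false; it is replaced by the correct value (95+23√5)/200 ≈ 0.732, so that E[K_n] = n/10 + (95+23√5)/200 + o(1); all other claims are as stated. *)

theory Defs
  imports "HOL-Probability.Probability" "HOL-Number_Theory.Fib" "HOL-Library.Landau_Symbols"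
begin

text \<open>The index shift turns the library's fib 1 = fib 2 = 1 into fibF 1 = 1, fibF 2 = 2.  Only positive
  indices are ever used as summands.\<close>

definition fibF :: "nat \<Rightarrow> int" where
  "fibF n = int (fib (n + 1))"

definition fibS :: "nat \<Rightarrow> int" where
  "fibS n = (\<Sum>i | 4 * i < n. fibF (n - 4 * i))"

text \<open>A representation is given by the set \<open>P\<close> of indices of its positive terms and the set \<open>N\<close> of
  indices of its negative terms.  Sets suffice, since a repeated term would be two terms of the
  same sign whose indices differ by 0.\<close>

definition far_difference_rep :: "int \<Rightarrow> nat set \<times> nat set \<Rightarrow> bool" where
  "far_difference_rep x = (\<lambda>(P, N).
     finite P \<and> finite N \<and> 0 \<notin> P \<and> 0 \<notin> N \<and>
     (\<forall>i\<in>P. \<forall>j\<in>P. i \<noteq> j \<longrightarrow> \<bar>int i - int j\<bar> \<ge> 4) \<and>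
     (\<forall>i\<in>N. \<forall>j\<in>N. i \<noteq> j \<longrightarrow> \<bar>int i - int j\<bar> \<ge> 4) \<and>
     (\<forall>i\<in>P. \<forall>j\<in>N. \<bar>int i - int j\<bar> \<ge> 3) \<and>
     x = (\<Sum>i\<in>P. fibF i) - (\<Sum>j\<in>N. fibF j))"

text \<open>The definite description is meaningful because every integer has exactly one far-difference
  representation.\<close>

definition the_far_difference_rep :: "int \<Rightarrow> nat set \<times> nat set" where
  "the_far_difference_rep x = (THE r. far_difference_rep x r)"

definition num_pos :: "int \<Rightarrow> real" where
  "num_pos x = real (card (fst (the_far_difference_rep x)))"

definition num_neg :: "int \<Rightarrow> real" where
  "num_neg x = real (card (snd (the_far_difference_rep x)))"

text \<open>The random variables of index \<open>n\<close> are \<open>num_pos\<close> and \<open>num_neg\<close> on the probability space \<open>unif n\<close>.  The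
  interval is nonempty for \<open>n \<ge> 1\<close>; the value of \<open>unif 0\<close> is irrelevant.\<close>

definition unif :: "nat \<Rightarrow> int pmf" where
  "unif n = pmf_of_set {fibS (n - 1)<..fibS n}"

definition standardize :: "'a pmf \<Rightarrow> ('a \<Rightarrow> real) \<Rightarrow> 'a \<Rightarrow> real" where
  "standardize p X \<omega> =
     (X \<omega> - measure_pmf.expectation p X) / sqrt (measure_pmf.variance p X)"

definition standardized_joint_law ::
    "'a pmf \<Rightarrow> ('a \<Rightarrow> real) \<Rightarrow> ('a \<Rightarrow> real) \<Rightarrow> (real \<times> real) measure" where
  "standardized_joint_law p X Y =
     distr (measure_pmf p) borel (\<lambda>\<omega>. (standardize p X \<omega>, standardize p Y \<omega>))"

text \<open>Weak convergence by bounded continuous test functions; the library's \<open>weak_conv_m\<close> is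
  restricted to measures on the real line.\<close>

definition weakly_converges :: "(nat \<Rightarrow> 'a::topological_space measure) \<Rightarrow> 'a measure \<Rightarrow> bool" where
  "weakly_converges \<mu> \<nu> \<longleftrightarrow>
     (\<forall>f :: 'a \<Rightarrow> real. continuous_on UNIV f \<and> bounded (range f) \<longrightarrow>
        (\<lambda>n. \<integral>x. f x \<partial>\<mu> n) \<longlonglongrightarrow> (\<integral>x. f x \<partial>\<nu>))"

text \<open>The centred Gaussian law on the plane with unit variances and correlation \<open>\<rho>\<close>, where
  \<open>\<bar>\<rho>\<bar> < 1\<close>.\<close>

definition bivariate_std_normal :: "real \<Rightarrow> (real \<times> real) measure" where
  "bivariate_std_normal \<rho> = density lborel (\<lambda>(x, y). ennreal
     (exp (- (x\<^sup>2 - 2 * \<rho> * x * y + y\<^sup>2) / (2 * (1 - \<rho>\<^sup>2))) / (2 * pi * sqrt (1 - \<rho>\<^sup>2))))"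

definition std_normal :: "real measure" where
  "std_normal = density lborel (\<lambda>x. ennreal (std_normal_density x))"

definition golden_ratio :: real where
  "golden_ratio = (1 + sqrt 5) / 2"

text \<open>The constant term of the mean of \<open>num_pos\<close>, which is (95 + 23 sqrt 5) / 200, about 0.732, in the
  theorem.  The source prints (371 - 113 sqrt 5) / 40, about 2.958, for which the claim is false:
  let \<open>c n\<close> be the number of integers in \<open>(fibS (n - 1), fibS n]\<close> and \<open>a n\<close> the total of \<open>num_pos\<close> over
  them.  Removing the largest term of the representations gives
  \<open>\<Sum> c n z^n = z / ((1 - z - z^2) (1 + z^2))\<close> and
  \<open>\<Sum> a n z^n = z (1 - z - z^4) / ((1 - z - z^2)^2 (1 + z^2)^2 (1 + z^3))\<close>, and the expansions at
  the dominant pole \<open>(sqrt 5 - 1) / 2\<close> give \<open>a n / c n = n / 10 + (95 + 23 sqrt 5) / 200 + o(1)\<close>.\<close>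

end

theory Submission
  imports Defs "HOL-Real_Asymp.Real_Asymp"
begin

text \<open>
  Removing the largest term \<open>+F n\<close> from a representation leaves an integer between \<open>- S (n - 3)\<close> and
  \<open>S (n - 4)\<close>, because \<open>F n = S (n - 1) + S (n - 3) + 1\<close>; this identity makes the intervals of the
  possible values fit together without gaps or overlaps, and it yields existence and uniqueness of
  the representation at once (\<open>far_difference_rep_ex1\<close>).  Comparing the remainders for \<open>n + 4\<close> with
  those for \<open>n + 3\<close> leaves one copy of the interval of index \<open>n\<close> and one reflected copy of the interval
  of index \<open>n + 1\<close>.  Reflection keeps the number \<open>p\<close> of all summands and negates the excess \<open>m\<close> of
  positive over negative ones, so the sums of a function of \<open>(p, m)\<close> over the
  intervals obey a recursion of order four, which shifts the arguments of the function (\<open>block_sum_rec\<close>).  The proof works with \<open>p\<close> and \<open>m\<close> throughout and returns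
  to the two summand counts \<open>(p + m) / 2\<close> and \<open>(p - m) / 2\<close> only at the end.

  For the functions \<open>1\<close>, \<open>p\<close>, \<open>m\<close>, \<open>p^2\<close>, \<open>m^2\<close>, \<open>p m\<close> the characteristic polynomials are
  \<open>(z^2 - z - 1) (z^2 + 1)\<close> and \<open>(z - 1) (z^3 + 1)\<close>.  Apart from the golden ratio \<open>\<phi>\<close> all their roots
  lie in the closed unit disc, so each of these sums is a polynomial in \<open>n\<close> times \<open>\<phi>^n\<close> up to an
  exponentially smaller error.  Reading off the coefficients gives means, variances and covariance.

  For the joint law the function is \<open>cis (\<epsilon> (a p + d m))\<close> with \<open>\<epsilon> = 1 / sqrt n\<close>.  The recursion then has
  coefficients of modulus one, so its solutions are dominated by those of the unperturbed recursion,
  which grow like \<open>\<phi>^n\<close>.  It suffices therefore to know the perturbed dominant root up to an error of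
  order \<open>\<epsilon>^3\<close>: the explicit expression \<open>\<phi> exp (\<i> \<epsilon> a / 5 - \<epsilon>^2 v / 2)\<close> solves the characteristic
  equation to that order (\<open>char_residual_third_order\<close>), and over \<open>n\<close> steps the error accumulates
  to the relative size \<open>n \<epsilon>^3 = 1 / sqrt n\<close> only.  This proves convergence of the characteristic functions to
  \<open>exp (- v / 2)\<close>, where \<open>v\<close> is a diagonal quadratic form in \<open>(a, d)\<close> (\<open>char_sum_central_limit\<close>);
  diagonality is the asymptotic independence of \<open>p\<close> and \<open>m\<close>.

  Weak convergence in the plane follows from a continuity theorem (\<open>plane_levy_continuity\<close>): a bounded
  continuous \<open>f\<close> is replaced by \<open>f (L sin (x / L), L sin (y / L))\<close>, which differs little from \<open>f\<close> on a
  large square if \<open>L\<close> is large and which is uniformly approximable by trigonometric polynomials.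
\<close>

section \<open>Existence and uniqueness of far-difference representations\<close>

lemma fibS_0 [simp]: "fibS 0 = 0"
  by (simp add: fibS_def)

lemma fibS_rec: "n > 0 \<Longrightarrow> fibS n = fibF n + fibS (n - 4)"
proof -
  assume n: "n > 0"
  have fin: "finite {i. 4 * i < n - 4}"
    by (rule finite_subset[of _ "{..n}"]) auto
  have eq: "{i. 4 * i < n} = insert 0 (Suc ` {i. 4 * i < n - 4})"
  proof (intro set_eqI iffI)
    fix i assume "i \<in> {i. 4 * i < n}"
    then show "i \<in> insert 0 (Suc ` {i. 4 * i < n - 4})"
      by (cases i) auto
  qed (use n in auto)
  have "fibS n = fibF n + (\<Sum>i\<in>Suc ` {i. 4 * i < n - 4}. fibF (n - 4 * i))"
    unfolding fibS_def eq using fin by (subst sum.insert) auto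
  also have "(\<Sum>i\<in>Suc ` {i. 4 * i < n - 4}. fibF (n - 4 * i)) = fibS (n - 4)"
    unfolding fibS_def by (subst sum.reindex) (auto simp: algebra_simps)
  finally show ?thesis .
qed

lemma fibF_pos: "fibF n > 0"
  by (simp add: fibF_def fib_neq_0_nat)

lemma fibS_nonneg: "fibS n \<ge> 0"
  unfolding fibS_def by (intro sum_nonneg less_imp_le fibF_pos)

text \<open>As \<open>F n = F (n - 1) + F (n - 3) + F (n - 4)\<close>, the identity for \<open>n - 4\<close> gives the one for \<open>n\<close> after one term has been
  split off each sum on the right.  Truncated subtraction is harmless since \<open>fibS 0 = 0\<close>.\<close>

lemma fibF_eq_fibS: "n > 0 \<Longrightarrow> fibF n = fibS (n - 1) + fibS (n - 3) + 1"
proof (induction n rule: less_induct)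
  case (less n)
  show ?case
  proof (cases "n \<le> 4")
    case True
    then have "n = 1 \<or> n = 2 \<or> n = 3 \<or> n = 4" using less.prems by auto
    then show ?thesis
      by (auto simp: fibS_rec fibF_def numeral_eq_Suc)
  next
    case False
    define k where "k = n - 5"
    have n: "n = k + 5" using False by (simp add: k_def)
    have IH: "fibF (k + 1) = fibS k + fibS (k - 2) + 1"
      using less.IH[of "k + 1"] by (simp add: n)
    have "fibF (k + 5) = fibF (k + 4) + fibF (k + 2) + fibF (k + 1)"
      by (simp add: fibF_def numeral_eq_Suc)
    moreover have "fibS (k + 4) = fibF (k + 4) + fibS k"
      using fibS_rec[of "k + 4"] by simp
    moreover have "fibS (k + 2) = fibF (k + 2) + fibS (k - 2)"
      using fibS_rec[of "k + 2"] by simp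
    ultimately show ?thesis using IH by (simp add: n algebra_simps numeral_eq_Suc)
  qed
qed

lemma fibS_strict_mono: "strict_mono fibS"
proof (rule strict_mono_Suc_iff[THEN iffD2], rule allI)
  fix n
  show "fibS n < fibS (Suc n)"
    using fibF_eq_fibS[of "Suc n"] fibS_rec[of "Suc n"] fibS_nonneg[of "n - 2"] fibS_nonneg[of "n - 3"]
    by simp
qed

lemma fibS_mono: "m \<le> n \<Longrightarrow> fibS m \<le> fibS n"
  using fibS_strict_mono by (simp add: strict_mono_less_eq)

lemma far_difference_rep_swap:
  "far_difference_rep (- x) (N, P) \<longleftrightarrow> far_difference_rep x (P, N)"
proof -
  have "(\<forall>i\<in>N. \<forall>j\<in>P. 3 \<le> \<bar>int i - int j\<bar>) \<longleftrightarrow> (\<forall>i\<in>P. \<forall>j\<in>N. 3 \<le> \<bar>int i - int j\<bar>)"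
    by (metis abs_minus_commute)
  then show ?thesis
    unfolding far_difference_rep_def by auto
qed

lemma far_difference_rep_empty: "far_difference_rep x ({}, {}) \<longleftrightarrow> x = 0"
  by (simp add: far_difference_rep_def)

lemma far_difference_rep_insert:
  assumes "n > 0" "n \<notin> P"
  shows "far_difference_rep x (insert n P, N) \<longleftrightarrow>
    far_difference_rep (x - fibF n) (P, N) \<and>
    (\<forall>i\<in>P. \<bar>int i - int n\<bar> \<ge> 4) \<and> (\<forall>j\<in>N. \<bar>int j - int n\<bar> \<ge> 3)"
proof (cases "finite P")
  case False
  then show ?thesis by (simp add: far_difference_rep_def)
next
  case True
  have s: "(\<Sum>i\<in>insert n P. fibF i) = fibF n + (\<Sum>i\<in>P. fibF i)"
    using True assms by simp
  show ?thesis
    unfolding far_difference_rep_def s prod.case using assms True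
    by (auto simp: abs_minus_commute)
qed

text \<open>Strip the term of index \<open>n\<close>: the remaining positive indices are at most \<open>n - 4\<close> and the negative ones
  at most \<open>n - 3\<close>, so by induction the remainder lies between \<open>- fibS (n - 3)\<close> and \<open>fibS (n - 4)\<close>, and
  \<open>fibF_eq_fibS\<close> turns these bounds into the claimed ones.\<close>

lemma far_difference_rep_bounds:
  assumes "far_difference_rep x (P, N)" "P \<union> N \<subseteq> {..n}"
  shows "\<bar>x\<bar> \<le> fibS n" "n \<in> P \<Longrightarrow> x > fibS (n - 1)" "n \<in> N \<Longrightarrow> - x > fibS (n - 1)"
proof -
  have main: "\<bar>x\<bar> \<le> fibS n \<and> (n \<in> P \<longrightarrow> x > fibS (n - 1)) \<and> (n \<in> N \<longrightarrow> - x > fibS (n - 1))"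
    using assms
  proof (induction n arbitrary: x P N rule: less_induct)
    case (less n)
    have top: "\<bar>y\<bar> \<le> fibS n \<and> y > fibS (n - 1)"
      if rep: "far_difference_rep y (A, B)" and sub: "A \<union> B \<subseteq> {..n}" and nA: "n \<in> A" for y A B
    proof -
      have n: "n > 0" using rep nA by (auto simp: far_difference_rep_def intro: gr0I)
      define A' where "A' = A - {n}"
      have A: "A = insert n A'" "n \<notin> A'" using nA by (auto simp: A'_def)
      have rest: "far_difference_rep (y - fibF n) (A', B)"
        and gA: "\<forall>i\<in>A'. \<bar>int i - int n\<bar> \<ge> 4" and gB: "\<forall>j\<in>B. \<bar>int j - int n\<bar> \<ge> 3"
        using rep far_difference_rep_insert[OF n A(2)] A(1) by auto
      have zA: "0 \<notin> A'" and zB: "0 \<notin> B" using rest by (auto simp: far_difference_rep_def)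
      have A4: "A' \<subseteq> {..n - 4}"
      proof
        fix i assume "i \<in> A'"
        then have "\<bar>int i - int n\<bar> \<ge> 4" "i \<le> n" using gA sub A by auto
        then show "i \<in> {..n - 4}" by simp
      qed
      have B3: "B \<subseteq> {..n - 3}"
      proof
        fix j assume "j \<in> B"
        then have "\<bar>int j - int n\<bar> \<ge> 3" "j \<le> n" using gB sub by auto
        then show "j \<in> {..n - 3}" by simp
      qed
      have "A' \<union> B \<subseteq> {..n - 3}" using A4 B3 by auto
      then have IH3: "\<bar>y - fibF n\<bar> \<le> fibS (n - 3)" "n - 3 \<in> B \<longrightarrow> y - fibF n < - fibS (n - 3 - 1)"
        using less.IH[OF _ rest, of "n - 3"] n by auto
      (* If the remainder has the index n - 3, that term is negative and so is the whole remainder. *)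
      have up: "y - fibF n \<le> fibS (n - 4)"
      proof (cases "n - 3 \<in> B")
        case True
        then show ?thesis using IH3(2) fibS_nonneg[of "n - 4"] by simp
      next
        case False
        have "B \<subseteq> {..n - 4}"
        proof
          fix j assume "j \<in> B"
          then have "j \<le> n - 3" "j \<noteq> n - 3" using B3 False by auto
          then show "j \<in> {..n - 4}" by simp
        qed
        then have "\<bar>y - fibF n\<bar> \<le> fibS (n - 4)" using less.IH[OF _ rest, of "n - 4"] n A4 by auto
        then show ?thesis by simp
      qed
      then show ?thesis
        using IH3(1) fibF_eq_fibS[OF n] fibS_rec[OF n] fibS_nonneg[of "n - 1"]
        by (simp add: abs_le_iff)
    qed
    consider "n \<in> P" | "n \<in> N" | "n \<notin> P" "n \<notin> N" by auto
    then show ?case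
    proof cases
      case 1
      then have "n \<notin> N" using less.prems by (force simp: far_difference_rep_def)
      then show ?thesis using top[OF less.prems 1] by auto
    next
      case 2
      then have "n \<notin> P" using less.prems by (force simp: far_difference_rep_def)
      moreover have "\<bar>- x\<bar> \<le> fibS n \<and> - x > fibS (n - 1)"
        by (rule top[of _ N P]) (use less.prems 2 far_difference_rep_swap in auto)
      ultimately show ?thesis using 2 by auto
    next
      case 3
      then have sub: "P \<union> N \<subseteq> {..<n}" using less.prems by (auto simp: less_le)
      show ?thesis
      proof (cases n)
        case 0
        then have "P = {}" "N = {}" using sub by auto
        then show ?thesis using less.prems fibS_nonneg[of n] by (simp add: far_difference_rep_empty)
      next
        case (Suc k)
        then have "\<bar>x\<bar> \<le> fibS k"
          using less.IH[of k x P N] less.prems sub by (auto simp: lessThan_Suc_atMost)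
        also have "\<dots> \<le> fibS n" by (rule fibS_mono) (simp add: Suc)
        finally show ?thesis using 3 by simp
      qed
    qed
  qed
  show "\<bar>x\<bar> \<le> fibS n" "n \<in> P \<Longrightarrow> x > fibS (n - 1)" "n \<in> N \<Longrightarrow> - x > fibS (n - 1)"
    using main by auto
qed

lemma far_difference_rep_support:
  assumes rep: "far_difference_rep x (P, N)" and x: "\<bar>x\<bar> \<le> fibS n"
  shows "P \<union> N \<subseteq> {..n}"
proof (cases "P \<union> N = {}")
  case False
  define m where "m = Max (P \<union> N)"
  have fin: "finite (P \<union> N)" using rep by (simp add: far_difference_rep_def)
  have sub: "P \<union> N \<subseteq> {..m}" and mem: "m \<in> P \<or> m \<in> N"
    using fin False Max_in[OF fin False] by (auto simp: m_def)
  have "fibS (m - 1) < \<bar>x\<bar>"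
    using far_difference_rep_bounds[OF rep sub] mem by auto
  then have "fibS (m - 1) < fibS n" using x by simp
  then have "m - 1 < n" using fibS_strict_mono by (simp add: strict_mono_less)
  then show ?thesis using sub by auto
qed auto

text \<open>The spacing conditions around the largest index come for free from the size of the remainder.\<close>

lemma far_difference_rep_step:
  assumes n: "n > 0" and x: "x \<in> {fibS (n - 1)<..fibS n}"
  shows "far_difference_rep x (P, N) \<longleftrightarrow> n \<in> P \<and> far_difference_rep (x - fibF n) (P - {n}, N)"
proof
  assume rep: "far_difference_rep x (P, N)"
  have "x > 0" using x fibS_nonneg[of "n - 1"] by auto
  then have sub: "P \<union> N \<subseteq> {..n}" using far_difference_rep_support[OF rep, of n] x by auto
  have "n \<in> P"
  proof (rule ccontr)
    assume nP: "n \<notin> P"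
    have nN: "n \<notin> N"
      using far_difference_rep_bounds(3)[OF rep sub] \<open>x > 0\<close> fibS_nonneg[of "n - 1"] by auto
    have "P \<union> N \<subseteq> {..n - 1}"
    proof
      fix j assume "j \<in> P \<union> N"
      then have "j \<le> n" "j \<noteq> n" using nP nN sub by auto
      then show "j \<in> {..n - 1}" by simp
    qed
    from far_difference_rep_bounds(1)[OF rep this] x show False by auto
  qed
  then show "n \<in> P \<and> far_difference_rep (x - fibF n) (P - {n}, N)"
    using rep far_difference_rep_insert[OF n, of "P - {n}"] by (simp add: insert_absorb)
next
  assume *: "n \<in> P \<and> far_difference_rep (x - fibF n) (P - {n}, N)"
  then have rep: "far_difference_rep (x - fibF n) (P - {n}, N)" and nP: "n \<in> P" by auto
  have lo: "x - fibF n \<ge> - fibS (n - 3)" and hi: "x - fibF n \<le> fibS (n - 4)"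
    using x fibF_eq_fibS[OF n] fibS_rec[OF n] by auto
  have "fibS (n - 4) \<le> fibS (n - 3)" by (rule fibS_mono) simp
  then have sub: "(P - {n}) \<union> N \<subseteq> {..n - 3}"
    using far_difference_rep_support[OF rep] lo hi by force
  have z: "0 \<notin> P - {n}" "0 \<notin> N" using rep by (auto simp: far_difference_rep_def)
  (* A positive term of index n - 3 would push the remainder above fibS (n - 4). *)
  have n3: "n - 3 \<notin> P - {n}"
    using far_difference_rep_bounds(2)[OF rep sub] hi by auto
  have "\<forall>i\<in>P - {n}. \<bar>int i - int n\<bar> \<ge> 4"
  proof
    fix i assume i: "i \<in> P - {n}"
    then have "i \<le> n - 3" "i \<noteq> n - 3" using sub n3 by auto
    moreover have "i \<noteq> 0" using i z(1) by metis
    ultimately show "\<bar>int i - int n\<bar> \<ge> 4" by linarith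
  qed
  moreover have "\<forall>j\<in>N. \<bar>int j - int n\<bar> \<ge> 3"
  proof
    fix j assume j: "j \<in> N"
    then have "j \<le> n - 3" using sub by auto
    moreover have "j \<noteq> 0" using j z(2) by metis
    ultimately show "\<bar>int j - int n\<bar> \<ge> 3" by linarith
  qed
  ultimately show "far_difference_rep x (P, N)"
    using rep far_difference_rep_insert[OF n, of "P - {n}"] nP by (simp add: insert_absorb)
qed

lemma fibS_interval_cover:
  assumes "0 < x" "x \<le> fibS n"
  obtains k where "0 < k" "k \<le> n" "x \<in> {fibS (k - 1)<..fibS k}"
proof -
  define k where "k = (LEAST k. x \<le> fibS k)"
  have k: "x \<le> fibS k" unfolding k_def by (rule LeastI) (rule assms(2))
  have kn: "k \<le> n" unfolding k_def by (rule Least_le) (rule assms(2))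
  have k0: "k > 0" using k assms(1) by (auto intro: gr0I)
  have "\<not> x \<le> fibS (k - 1)"
    using not_less_Least[of "k - 1" "\<lambda>k. x \<le> fibS k"] k0 by (simp add: k_def)
  then show ?thesis using that[of k] k kn k0 by auto
qed

lemma int_le_fibS: "int n \<le> fibS n"
proof (induction n)
  case (Suc n)
  have "fibS n < fibS (Suc n)" using fibS_strict_mono by (simp add: strict_mono_Suc_iff)
  then show ?case using Suc by simp
qed simp

text \<open>Existence and uniqueness descend together: by \<open>far_difference_rep_step\<close> the representations of
  \<open>y\<close> correspond to those of the smaller number \<open>y - fibF k\<close>, and negative numbers reduce to positive
  ones by exchanging the two index sets.\<close>

theorem far_difference_rep_ex1: "\<exists>!r. far_difference_rep x r"
proof -
  have "\<exists>!r. far_difference_rep x r" if "\<bar>x\<bar> \<le> fibS n" for n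
    using that
  proof (induction n arbitrary: x rule: less_induct)
    case (less n)
    have pos: "\<exists>!r. far_difference_rep y r" if y: "0 < y" "y \<le> fibS n" for y
    proof -
      obtain k where k: "0 < k" "k \<le> n" "y \<in> {fibS (k - 1)<..fibS k}"
        using fibS_interval_cover[OF y] .
      have "fibS (k - 4) \<le> fibS (k - 3)" by (rule fibS_mono) simp
      then have "\<bar>y - fibF k\<bar> \<le> fibS (k - 3)"
        using k(3) fibF_eq_fibS[OF k(1)] fibS_rec[OF k(1)] by (auto simp: abs_le_iff)
      then have ex1: "\<exists>!r. far_difference_rep (y - fibF k) r"
        using less.IH[of "k - 3"] k by auto
      then obtain P N where PN: "far_difference_rep (y - fibF k) (P, N)" by auto
      have kP: "k \<notin> P"
      proof
        assume "k \<in> P"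
        moreover have "P \<union> N \<subseteq> {..k - 3}"
          using far_difference_rep_support[OF PN] \<open>\<bar>y - fibF k\<bar> \<le> fibS (k - 3)\<close> by blast
        ultimately have "k \<le> k - 3" by auto
        then show False using k(1) by simp
      qed
      show ?thesis
      proof (rule ex1I[of _ "(insert k P, N)"])
        show "far_difference_rep y (insert k P, N)"
          unfolding far_difference_rep_step[OF k(1,3)] using PN kP by simp
        fix r assume r: "far_difference_rep y r"
        obtain P' N' where r': "r = (P', N')" by (cases r)
        have "k \<in> P'" "far_difference_rep (y - fibF k) (P' - {k}, N')"
          using r far_difference_rep_step[OF k(1,3)] by (auto simp: r')
        then have "(P' - {k}, N') = (P, N)" using ex1 PN by blast
        then show "r = (insert k P, N)" using \<open>k \<in> P'\<close> by (auto simp: r')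
      qed
    qed
    consider "x = 0" | "x > 0" | "x < 0" by linarith
    then show ?case
    proof cases
      case 1
      have "P = {} \<and> N = {}" if "far_difference_rep 0 (P, N)" for P N
        using far_difference_rep_support[OF that, of 0] that by (force simp: far_difference_rep_def)
      then show ?thesis
        unfolding 1 by (intro ex1I[of _ "({}, {})"]) (auto simp: far_difference_rep_empty)
    next
      case 2
      then show ?thesis using pos less.prems by simp
    next
      case 3
      then have "\<exists>!r. far_difference_rep (- x) r" using pos[of "- x"] less.prems by simp
      then obtain P N where PN: "far_difference_rep (- x) (P, N)"
        and u: "\<And>r. far_difference_rep (- x) r \<Longrightarrow> r = (P, N)" by auto
      show ?thesis
      proof (rule ex1I[of _ "(N, P)"])
        show "far_difference_rep x (N, P)" using PN far_difference_rep_swap by blast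
        fix r assume "far_difference_rep x r"
        moreover obtain A B where "r = (A, B)" by (cases r)
        ultimately show "r = (N, P)" using u[of "(B, A)"] far_difference_rep_swap by auto
      qed
    qed
  qed
  moreover have "\<bar>x\<bar> \<le> fibS (nat \<bar>x\<bar>)" using int_le_fibS[of "nat \<bar>x\<bar>"] by simp
  ultimately show ?thesis by blast
qed

lemma far_difference_rep_the: "far_difference_rep x (the_far_difference_rep x)"
  unfolding the_far_difference_rep_def by (rule theI'[OF far_difference_rep_ex1])

lemma the_far_difference_repI: "far_difference_rep x r \<Longrightarrow> the_far_difference_rep x = r"
  using far_difference_rep_ex1 far_difference_rep_the by blast

lemma num_pos_neg_0: "num_pos 0 = 0" "num_neg 0 = 0"
proof -
  have "the_far_difference_rep 0 = ({}, {})"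
    by (rule the_far_difference_repI) (simp add: far_difference_rep_empty)
  then show "num_pos 0 = 0" "num_neg 0 = 0" by (simp_all add: num_pos_def num_neg_def)
qed

lemma num_pos_neg_uminus: "num_pos (- x) = num_neg x" "num_neg (- x) = num_pos x"
proof -
  have "the_far_difference_rep (- x) = prod.swap (the_far_difference_rep x)"
    using far_difference_rep_the[of x]
    by (intro the_far_difference_repI) (metis far_difference_rep_swap prod.collapse swap_simp)
  then show "num_pos (- x) = num_neg x" "num_neg (- x) = num_pos x"
    by (simp_all add: num_pos_def num_neg_def)
qed

lemma num_pos_neg_step:
  assumes n: "n > 0" and x: "x \<in> {fibS (n - 1)<..fibS n}"
  shows "num_pos x = 1 + num_pos (x - fibF n)" "num_neg x = num_neg (x - fibF n)"
proof -
  obtain P N where PN: "the_far_difference_rep x = (P, N)" by fastforce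
  have "far_difference_rep x (P, N)" using far_difference_rep_the[of x] PN by simp
  then have "n \<in> P" and rep: "far_difference_rep (x - fibF n) (P - {n}, N)"
    using far_difference_rep_step[OF n x] by auto
  have "finite (P - {n})" using rep by (simp add: far_difference_rep_def)
  then have "card P = Suc (card (P - {n}))" using \<open>n \<in> P\<close> by (metis card.remove finite_Diff2 finite.emptyI finite_insert)
  then show "num_pos x = 1 + num_pos (x - fibF n)" "num_neg x = num_neg (x - fibF n)"
    using the_far_difference_repI[OF rep] PN by (simp_all add: num_pos_def num_neg_def)
qed

section \<open>Sums over blocks and their recursion\<close>

text \<open>Removing the largest term and changing the sign both act diagonally on these two coordinates, which
  is why they replace the numbers of positive and negative summands in most of the proof.\<close>

definition num_terms :: "int \<Rightarrow> real" where
  "num_terms x = num_pos x + num_neg x"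

definition num_excess :: "int \<Rightarrow> real" where
  "num_excess x = num_pos x - num_neg x"

definition block :: "nat \<Rightarrow> int set" where
  "block n = {fibS (n - 1)<..fibS n}"

definition block_sum :: "nat \<Rightarrow> (real \<Rightarrow> real \<Rightarrow> 'a::comm_monoid_add) \<Rightarrow> 'a" where
  "block_sum n h = (\<Sum>x\<in>block n. h (num_terms x) (num_excess x))"

lemma block_0: "block 0 = {}"
  by (simp add: block_def)

lemma finite_block [simp]: "finite (block n)"
  by (simp add: block_def)

lemma num_terms_excess_0: "num_terms 0 = 0" "num_excess 0 = 0"
  by (simp_all add: num_terms_def num_excess_def num_pos_neg_0)

lemma num_terms_excess_uminus:
  "num_terms (- x) = num_terms x" "num_excess (- x) = - num_excess x"
  by (simp_all add: num_terms_def num_excess_def num_pos_neg_uminus)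

lemma num_terms_excess_step:
  assumes "n > 0" "x \<in> block n"
  shows "num_terms x = 1 + num_terms (x - fibF n)" "num_excess x = 1 + num_excess (x - fibF n)"
  using num_pos_neg_step[of n x] assms by (auto simp: num_terms_def num_excess_def block_def)

lemma block_sum_strip:
  assumes n: "n > 0"
  shows "block_sum n h = (\<Sum>y = - fibS (n - 3)..fibS (n - 4). h (1 + num_terms y) (1 + num_excess y))"
proof -
  have "bij_betw (\<lambda>y. y + fibF n) {- fibS (n - 3)..fibS (n - 4)} (block n)"
    using fibF_eq_fibS[OF n] fibS_rec[OF n]
    by (intro bij_betwI[where g = "\<lambda>x. x - fibF n"]) (auto simp: block_def)
  then have "block_sum n h =
      (\<Sum>y = - fibS (n - 3)..fibS (n - 4). h (num_terms (y + fibF n)) (num_excess (y + fibF n)))"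
    unfolding block_sum_def by (rule sum.reindex_bij_betw[symmetric])
  also have "\<dots> = (\<Sum>y = - fibS (n - 3)..fibS (n - 4). h (1 + num_terms y) (1 + num_excess y))"
  proof (rule sum.cong[OF refl])
    fix y assume "y \<in> {- fibS (n - 3)..fibS (n - 4)}"
    then have "y + fibF n \<in> block n"
      using fibF_eq_fibS[OF n] fibS_rec[OF n] by (auto simp: block_def)
    from num_terms_excess_step[OF n this]
    show "h (num_terms (y + fibF n)) (num_excess (y + fibF n)) = h (1 + num_terms y) (1 + num_excess y)"
      by simp
  qed
  finally show ?thesis .
qed

lemma block_sum_initial:
  "block_sum 0 h = 0" "block_sum 1 h = h 1 1" "block_sum 2 h = h 1 1" "block_sum 3 h = h 1 1"
  using block_sum_strip[of 1 h] block_sum_strip[of 2 h] block_sum_strip[of 3 h]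
  by (simp_all add: block_sum_def block_0 num_terms_excess_0 numeral_eq_Suc)

text \<open>After their largest terms have been removed, the blocks of index \<open>n + 4\<close> and \<open>n + 3\<close> become the intervals
  \<open>[- fibS (n + 1), fibS n]\<close> and \<open>[- fibS n, fibS (n - 1)]\<close>.  The difference consists of the block of index
  \<open>n\<close> on the right and the reflected block of index \<open>n + 1\<close> on the left; the reflection is the source of
  the sign in \<open>1 - m\<close>.\<close>

lemma block_sum_rec:
  "block_sum (n + 4) h = block_sum (n + 3) h
     + block_sum (n + 1) (\<lambda>p m. h (1 + p) (1 - m)) + block_sum n (\<lambda>p m. h (1 + p) (1 + m))"
proof -
  let ?g = "\<lambda>y. h (1 + num_terms y) (1 + num_excess y)"
  have m: "fibS (n - 1) \<le> fibS n" "fibS n \<le> fibS (n + 1)" by (auto intro: fibS_mono)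
  have "{- fibS (n + 1)..fibS n} = ({- fibS n..fibS (n - 1)} \<union> uminus ` block (n + 1)) \<union> block n"
    (is "?L = (?A \<union> ?B) \<union> ?C")
  proof
    show "?L \<subseteq> (?A \<union> ?B) \<union> ?C"
    proof
      fix y assume y: "y \<in> ?L"
      consider "y < - fibS n" | "- fibS n \<le> y" "y \<le> fibS (n - 1)" | "fibS (n - 1) < y" by linarith
      then show "y \<in> (?A \<union> ?B) \<union> ?C"
      proof cases
        case 1
        then have "- y \<in> block (n + 1)" using y by (auto simp: block_def)
        then show ?thesis by (force intro: image_eqI[of _ _ "- y"])
      qed (use y in \<open>auto simp: block_def\<close>)
    qed
    show "(?A \<union> ?B) \<union> ?C \<subseteq> ?L"
      using m fibS_nonneg[of "n - 1"] by (auto simp: block_def)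
  qed
  then have "block_sum (n + 4) h = sum ?g ((?A \<union> ?B) \<union> ?C)"
    by (simp add: block_sum_strip)
  also have "\<dots> = sum ?g (?A \<union> ?B) + sum ?g ?C"
    using m fibS_nonneg[of n] fibS_nonneg[of "n - 1"] by (intro sum.union_disjoint) (auto simp: block_def)
  also have "sum ?g (?A \<union> ?B) = sum ?g ?A + sum ?g ?B"
    by (intro sum.union_disjoint) (auto simp: block_def)
  also have "sum ?g ?B = block_sum (n + 1) (\<lambda>p m. h (1 + p) (1 - m))"
    unfolding block_sum_def
    by (subst sum.reindex) (auto simp: num_terms_excess_uminus)
  also have "sum ?g ?A = block_sum (n + 3) h"
    by (simp add: block_sum_strip)
  finally show ?thesis by (simp add: block_sum_def)
qed

section \<open>Asymptotics of the moment sums\<close>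

lemma golden_ratio_bounds: "3 / 2 < golden_ratio" "golden_ratio < 2"
proof -
  have "2 < sqrt 5" "sqrt 5 < 3" by (auto intro: real_less_rsqrt real_less_lsqrt)
  then show "3 / 2 < golden_ratio" "golden_ratio < 2" by (auto simp: golden_ratio_def)
qed

lemma golden_ratio_pos [simp]: "golden_ratio > 0" and golden_ratio_nonneg [simp]: "golden_ratio \<ge> 0"
  and golden_ratio_nz [simp]: "golden_ratio \<noteq> 0"
  using golden_ratio_bounds by auto

lemma golden_ratio_square: "golden_ratio\<^sup>2 = golden_ratio + 1"
  by (simp add: golden_ratio_def power2_eq_square field_simps)

lemma golden_ratio_cube: "golden_ratio ^ 3 = 2 * golden_ratio + 1"
  using golden_ratio_square by (simp add: power3_eq_cube power2_eq_square algebra_simps)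

lemma golden_ratio_fourth: "golden_ratio ^ 4 = 3 * golden_ratio + 2"
proof -
  have "golden_ratio ^ 4 = (golden_ratio\<^sup>2)\<^sup>2" by (simp flip: power_mult)
  then show ?thesis by (simp add: golden_ratio_square power2_sum)
qed

lemma sqrt5_golden_ratio: "sqrt 5 = 2 * golden_ratio - 1"
  by (simp add: golden_ratio_def field_simps)

text \<open>Any base strictly between 1 and the golden ratio would do: polynomial growth must be
  absorbed, and division by the power of the golden ratio must leave a null sequence.\<close>

definition small :: "(nat \<Rightarrow> real) \<Rightarrow> bool" where
  "small f \<longleftrightarrow> (\<exists>C. \<forall>n. \<bar>f n\<bar> \<le> C * (3 / 2) ^ n)"

lemma smallI: "(\<And>n. \<bar>f n\<bar> \<le> C * (3 / 2) ^ n) \<Longrightarrow> small f"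
  by (auto simp: small_def)

lemma smallE:
  assumes "small f"
  obtains C where "C \<ge> 0" "\<And>n. \<bar>f n\<bar> \<le> C * (3 / 2) ^ n"
proof -
  obtain C where C: "\<And>n. \<bar>f n\<bar> \<le> C * (3 / 2) ^ n" using assms by (auto simp: small_def)
  moreover have "C \<ge> 0" using C[of 0] by simp
  ultimately show ?thesis using that by blast
qed

lemma small_add:
  assumes "small f" "small g"
  shows "small (\<lambda>n. f n + g n)"
proof -
  obtain C D where "\<And>n. \<bar>f n\<bar> \<le> C * (3 / 2) ^ n" "\<And>n. \<bar>g n\<bar> \<le> D * (3 / 2) ^ n"
    using assms by (metis smallE)
  then have "\<bar>f n + g n\<bar> \<le> (C + D) * (3 / 2) ^ n" for n
    unfolding distrib_right by (meson abs_triangle_ineq add_mono order_trans)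
  then show ?thesis by (rule smallI)
qed

lemma small_cmult:
  assumes "small f"
  shows "small (\<lambda>n. c * f n)"
proof -
  obtain C where C: "\<And>n. \<bar>f n\<bar> \<le> C * (3 / 2) ^ n" using assms by (metis smallE)
  have "\<bar>c * f n\<bar> \<le> (\<bar>c\<bar> * C) * (3 / 2) ^ n" for n
    using mult_left_mono[OF C[of n], of "\<bar>c\<bar>"] by (simp add: abs_mult mult.assoc)
  then show ?thesis by (rule smallI)
qed

lemma small_shift:
  assumes "small f"
  shows "small (\<lambda>n. f (n + k))"
proof -
  obtain C where C: "\<And>n. \<bar>f n\<bar> \<le> C * (3 / 2) ^ n" using assms by (metis smallE)
  have "\<bar>f (n + k)\<bar> \<le> (C * (3 / 2) ^ k) * (3 / 2) ^ n" for n
    using C[of "n + k"] by (simp add: power_add mult_ac)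
  then show ?thesis by (rule smallI)
qed

text \<open>The operator \<open>f \<mapsto> f (n + k) - s f n\<close> has its characteristic roots in the closed unit disc, so inverting
  it loses at most a constant factor against a growing geometric sequence.\<close>

lemma small_inverse_shift:
  assumes k: "k > 0" and s: "\<bar>s\<bar> \<le> 1" and sm: "small (\<lambda>n. f (n + k) - s * f n)"
  shows "small f"
proof -
  obtain C where C: "C \<ge> 0" "\<And>n. \<bar>f (n + k) - s * f n\<bar> \<le> C * (3 / 2) ^ n"
    using smallE[OF sm] by metis
  define K where "K = (\<Sum>j<k. \<bar>f j\<bar>) + 2 * C"
  have K: "K \<ge> 2 * C" by (simp add: K_def sum_nonneg)
  have "\<bar>f n\<bar> \<le> K * (3 / 2) ^ n" for n
  proof (induction n rule: less_induct)
    case (less n)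
    show ?case
    proof (cases "n < k")
      case True
      have "\<bar>f n\<bar> \<le> (\<Sum>j<k. \<bar>f j\<bar>)" using True by (intro member_le_sum) auto
      also have "\<dots> \<le> K * 1" using C(1) by (simp add: K_def)
      also have "\<dots> \<le> K * (3 / 2) ^ n" using K C(1) by (intro mult_left_mono one_le_power) auto
      finally show ?thesis .
    next
      case False
      define i where "i = n - k"
      have n: "n = i + k" using False by (simp add: i_def)
      have IH: "\<bar>f i\<bar> \<le> K * (3 / 2) ^ i" using less.IH[of i] k by (simp add: n)
      have "\<bar>s * f i\<bar> \<le> \<bar>f i\<bar>" using s by (simp add: abs_mult mult_left_le_one_le)
      then have "\<bar>f (i + k)\<bar> \<le> (K + C) * (3 / 2) ^ i"
        using C(2)[of i] IH by (simp add: distrib_right)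
      also have "\<dots> \<le> (K * (3 / 2)) * (3 / 2) ^ i"
        using K by (intro mult_right_mono) auto
      also have "\<dots> \<le> (K * (3 / 2) ^ k) * (3 / 2) ^ i"
        using K C(1) k power_increasing[of 1 k "3 / 2 :: real"]
        by (intro mult_right_mono mult_left_mono) auto
      finally show ?thesis by (simp add: n power_add mult_ac)
    qed
  qed
  then show ?thesis by (rule smallI)
qed

text \<open>Divided by the power of the golden ratio, the sequence has summable increments; \<open>\<gamma>\<close> is its limit,
  and the tail of the geometric majorant bounds the error.\<close>

lemma golden_recursion_small:
  assumes h: "small (\<lambda>n. f (n + 1) - golden_ratio * f n)"
  shows "\<exists>\<gamma>. small (\<lambda>n. f n - \<gamma> * golden_ratio ^ n)"
proof -
  obtain C where C: "C \<ge> 0" "\<And>n. \<bar>f (n + 1) - golden_ratio * f n\<bar> \<le> C * (3 / 2) ^ n"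
    using smallE[OF h] by metis
  define r where "r = 3 / 2 / golden_ratio"
  have r: "0 < r" "r < 1" using golden_ratio_bounds by (auto simp: r_def)
  define u where "u n = f n / golden_ratio ^ n" for n
  define g where "g n = u (Suc n) - u n" for n
  have g: "\<bar>g n\<bar> \<le> C * r ^ n" for n
  proof -
    have "g n = (f (n + 1) - golden_ratio * f n) / golden_ratio ^ Suc n"
      by (simp add: g_def u_def field_simps)
    then have "\<bar>g n\<bar> = \<bar>f (n + 1) - golden_ratio * f n\<bar> / golden_ratio ^ Suc n"
      by (simp only: abs_divide power_abs abs_of_pos[OF golden_ratio_pos])
    also have "\<dots> \<le> (C * (3 / 2) ^ n) / golden_ratio ^ Suc n"
      using C(2)[of n] by (intro divide_right_mono) auto
    also have "\<dots> \<le> (C * (3 / 2) ^ n) / golden_ratio ^ n"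
      using C(1) golden_ratio_bounds by (intro divide_left_mono power_increasing) auto
    also have "\<dots> = C * r ^ n" by (simp add: r_def power_divide)
    finally show ?thesis .
  qed
  have sumC: "summable (\<lambda>n. C * r ^ n)" using r by (intro summable_mult summable_geometric) auto
  have sumg: "summable g" by (rule summable_comparison_test'[OF sumC, of 0]) (use g in auto)
  define \<gamma> where "\<gamma> = u 0 + suminf g"
  have "\<bar>f n - \<gamma> * golden_ratio ^ n\<bar> \<le> (C / (1 - r)) * (3 / 2) ^ n" for n
  proof -
    have "(\<Sum>i<n. g i) = u n - u 0" unfolding g_def by (rule sum_lessThan_telescope)
    then have "\<gamma> - u n = (\<Sum>i. g (i + n))"
      unfolding \<gamma>_def using suminf_split_initial_segment[OF sumg, of n] by simp
    also have "\<bar>\<dots>\<bar> \<le> (\<Sum>i. C * r ^ (i + n))"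
      using norm_suminf_le[of "\<lambda>i. g (i + n)" "\<lambda>i. C * r ^ (i + n)"] g
        summable_ignore_initial_segment[OF sumC, of n] by simp
    also have "\<dots> = (C * r ^ n) * (\<Sum>i. r ^ i)"
      using r by (subst suminf_mult[symmetric]) (auto simp: power_add mult_ac intro: summable_geometric)
    also have "\<dots> = C * r ^ n / (1 - r)"
      using r by (simp add: suminf_geometric)
    finally have "\<bar>\<gamma> - u n\<bar> * golden_ratio ^ n \<le> C * r ^ n / (1 - r) * golden_ratio ^ n"
      by (intro mult_right_mono) auto
    also have "\<bar>\<gamma> - u n\<bar> * golden_ratio ^ n = \<bar>(\<gamma> - u n) * golden_ratio ^ n\<bar>"
      by (simp add: abs_mult power_abs)
    also have "(\<gamma> - u n) * golden_ratio ^ n = \<gamma> * golden_ratio ^ n - f n"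
      by (simp add: u_def left_diff_distrib)
    also have "C * r ^ n / (1 - r) * golden_ratio ^ n = (C / (1 - r)) * (3 / 2) ^ n"
      by (simp add: r_def power_divide)
    finally show ?thesis by (simp add: abs_minus_commute)
  qed
  then show ?thesis by (blast intro: smallI)
qed

text \<open>The sequence \<open>q\<close> is a polynomial in all applications.\<close>

definition near :: "(nat \<Rightarrow> real) \<Rightarrow> (nat \<Rightarrow> real) \<Rightarrow> bool" where
  "near f q \<longleftrightarrow> small (\<lambda>n. f n - q n * golden_ratio ^ n)"

lemma near_add:
  assumes "near f q" "near g r"
  shows "near (\<lambda>n. f n + g n) (\<lambda>n. q n + r n)"
  using small_add[OF assms[unfolded near_def]] by (simp add: near_def algebra_simps)

lemma near_cmult:
  assumes "near f q"
  shows "near (\<lambda>n. c * f n) (\<lambda>n. c * q n)"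
  using small_cmult[OF assms[unfolded near_def], of c] by (simp add: near_def algebra_simps)

lemma near_diff:
  assumes "near f q" "near g r"
  shows "near (\<lambda>n. f n - g n) (\<lambda>n. q n - r n)"
  using near_add[OF assms(1) near_cmult[OF assms(2), of "-1"]] by simp

lemma near_shift:
  assumes "near f q"
  shows "near (\<lambda>n. f (n + k)) (\<lambda>n. golden_ratio ^ k * q (n + k))"
  using small_shift[OF assms[unfolded near_def], of k] by (simp add: near_def power_add mult_ac)

lemma near_unit_circle_inverse:
  assumes k: "k > 0" and s: "\<bar>s\<bar> \<le> 1"
    and "near (\<lambda>n. f (n + k) - s * f n) (\<lambda>n. golden_ratio ^ k * q (n + k) - s * q n)"
  shows "near f q"
  unfolding near_def
proof (rule small_inverse_shift[OF k s])
  show "small (\<lambda>n. f (n + k) - q (n + k) * golden_ratio ^ (n + k) - s * (f n - q n * golden_ratio ^ n))"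
    using assms(3) unfolding near_def by (simp add: power_add algebra_simps)
qed

lemma near_alternating_inverse:
  assumes "near (\<lambda>n. f (n + 2) + f n) (\<lambda>n. golden_ratio\<^sup>2 * q (n + 2) + q n)"
  shows "near f q"
  by (rule near_unit_circle_inverse[of 2 "-1"]) (use assms in auto)

text \<open>This recursion governs sums that change sign under reflection.  Its polynomial
  \<open>(z - 1) (z^3 + 1)\<close> has only roots of modulus one, so the solution is determined up to a small error.\<close>

lemma near_antisymmetric_inverse:
  assumes "near (\<lambda>n. f (n + 4) - f (n + 3) + f (n + 1) - f n)
    (\<lambda>n. golden_ratio ^ 4 * q (n + 4) - golden_ratio ^ 3 * q (n + 3) + golden_ratio * q (n + 1) - q n)"
  shows "near f q"
proof (rule near_unit_circle_inverse[of 1 1])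
  show "near (\<lambda>n. f (n + 1) - 1 * f n) (\<lambda>n. golden_ratio ^ 1 * q (n + 1) - 1 * q n)"
    by (rule near_unit_circle_inverse[of 3 "-1"])
      (use assms in \<open>simp_all add: algebra_simps numeral_eq_Suc\<close>)
qed auto

text \<open>This recursion governs sums that are invariant under reflection.  Its polynomial
  \<open>(z^2 - z - 1) (z^2 + 1)\<close> has the golden ratio as a simple root, which explains the free constant \<open>\<gamma>\<close>.\<close>

lemma near_symmetric_inverse:
  assumes "near (\<lambda>n. f (n + 4) - f (n + 3) - f (n + 1) - f n)
    (\<lambda>n. golden_ratio ^ 4 * q (n + 4) - golden_ratio ^ 3 * q (n + 3) - golden_ratio * q (n + 1) - q n)"
  shows "\<exists>\<gamma>. near f (\<lambda>n. q n + \<gamma>)"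
proof -
  define d where "d n = f n - q n * golden_ratio ^ n" for n
  define e where "e n = d (n + 2) + d n" for n
  have "small (\<lambda>n. e (n + 2) - e (n + 1) - e n)"
    using assms unfolding near_def e_def d_def by (simp add: power_add algebra_simps numeral_eq_Suc)
  (* Factor z^2 - z - 1 with the conjugate root 1 - golden_ratio, which lies in the unit disc. *)
  also have "(\<lambda>n. e (n + 2) - e (n + 1) - e n) =
    (\<lambda>n. (e (n + 1 + 1) - golden_ratio * e (n + 1)) - (1 - golden_ratio) * (e (n + 1) - golden_ratio * e n))"
  proof
    fix n
    have "golden_ratio * golden_ratio = golden_ratio + 1"
      using golden_ratio_square by (simp add: power2_eq_square)
    then have "(1 - golden_ratio) * golden_ratio = -1" by (simp add: algebra_simps)
    then have "(1 - golden_ratio) * golden_ratio * e n = - e n" by simp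
    then show "e (n + 2) - e (n + 1) - e n =
      (e (n + 1 + 1) - golden_ratio * e (n + 1)) - (1 - golden_ratio) * (e (n + 1) - golden_ratio * e n)"
      by (simp add: algebra_simps)
  qed
  finally have fib_res: "small (\<lambda>n. (e (n + 1 + 1) - golden_ratio * e (n + 1))
      - (1 - golden_ratio) * (e (n + 1) - golden_ratio * e n))" .
  have "\<bar>1 - golden_ratio\<bar> \<le> 1" using golden_ratio_bounds by simp
  then have "small (\<lambda>n. e (n + 1) - golden_ratio * e n)"
    by (rule small_inverse_shift[OF zero_less_one _ fib_res])
  then obtain \<gamma>' where g: "small (\<lambda>n. e n - \<gamma>' * golden_ratio ^ n)"
    using golden_recursion_small by blast
  define \<gamma> where "\<gamma> = \<gamma>' / (golden_ratio\<^sup>2 + 1)"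
  have pos: "golden_ratio\<^sup>2 + 1 > 0" by (simp add: add_pos_pos)
  have eq: "golden_ratio\<^sup>2 * \<gamma> + \<gamma> = \<gamma>'"
  proof -
    have "golden_ratio\<^sup>2 * \<gamma> + \<gamma> = (golden_ratio\<^sup>2 + 1) * \<gamma>" by (simp add: distrib_right)
    also have "\<dots> = \<gamma>'" using pos by (simp add: \<gamma>_def)
    finally show ?thesis .
  qed
  have "near (\<lambda>n. d (n + 2) + d n) (\<lambda>n. golden_ratio\<^sup>2 * \<gamma> + \<gamma>)"
    unfolding eq near_def using g unfolding e_def .
  then have "near d (\<lambda>_. \<gamma>)" by (rule near_alternating_inverse)
  then have "near f (\<lambda>n. q n + \<gamma>)"
    by (simp add: near_def d_def algebra_simps)
  then show ?thesis ..
qed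

lemma near_cong: "near f q \<Longrightarrow> (\<And>n. f n = g n) \<Longrightarrow> (\<And>n. q n = r n) \<Longrightarrow> near g r"
  by (simp add: near_def)

text \<open>The error is the contribution of the conjugate root, of modulus less than one.\<close>

lemma fib_error_bounded: "\<bar>real (fib n) - 1 / sqrt 5 * golden_ratio ^ n\<bar> \<le> 1"
proof -
  define \<psi> :: real where "\<psi> = (1 - sqrt 5) / 2"
  have "sqrt 5 > 2" "sqrt 5 < 3" by (auto intro: real_less_rsqrt real_less_lsqrt)
  then have psi: "\<bar>\<psi>\<bar> \<le> 1" by (auto simp: \<psi>_def abs_le_iff)
  have "real (fib n) = (golden_ratio ^ n - \<psi> ^ n) / sqrt 5"
    using fib_closed_form[of n] by (simp only: golden_ratio_def \<psi>_def)
  then have "real (fib n) - 1 / sqrt 5 * golden_ratio ^ n = - (\<psi> ^ n / sqrt 5)"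
    by (simp add: diff_divide_distrib)
  then have "\<bar>real (fib n) - 1 / sqrt 5 * golden_ratio ^ n\<bar> = \<bar>\<psi>\<bar> ^ n / sqrt 5"
    by (simp add: abs_divide power_abs)
  also have "\<dots> \<le> 1 / 1"
    using psi \<open>sqrt 5 > 2\<close> by (intro frac_le power_le_one) auto
  finally show ?thesis by simp
qed

lemma near_linear_fib: "near (\<lambda>n. (a * real n + b) * real (fib n)) (\<lambda>n. (a * real n + b) / sqrt 5)"
  unfolding near_def
proof (rule smallI[of _ "2 * \<bar>a\<bar> + \<bar>b\<bar>"])
  fix n
  have n: "real n \<le> 2 * (3 / 2) ^ n"
    using Bernoulli_inequality[of "1 / 2 :: real" n] by simp
  have "(a * real n + b) * real (fib n) - (a * real n + b) / sqrt 5 * golden_ratio ^ n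
      = (a * real n + b) * (real (fib n) - 1 / sqrt 5 * golden_ratio ^ n)"
    by (simp add: field_simps)
  also have "\<bar>\<dots>\<bar> \<le> \<bar>a * real n + b\<bar> * 1"
    unfolding abs_mult by (intro mult_left_mono fib_error_bounded) auto
  also have "\<dots> \<le> \<bar>a\<bar> * real n + \<bar>b\<bar> * 1"
    using abs_triangle_ineq[of "a * real n" b] by (simp add: abs_mult)
  also have "\<dots> \<le> \<bar>a\<bar> * (2 * (3 / 2) ^ n) + \<bar>b\<bar> * (3 / 2) ^ n"
    using n by (intro add_mono mult_left_mono) auto
  also have "\<dots> = (2 * \<bar>a\<bar> + \<bar>b\<bar>) * (3 / 2) ^ n"
    by (simp add: algebra_simps)
  finally show "\<bar>(a * real n + b) * real (fib n) - (a * real n + b) / sqrt 5 * golden_ratio ^ n\<bar>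
    \<le> (2 * \<bar>a\<bar> + \<bar>b\<bar>) * (3 / 2) ^ n" .
qed

lemma near_fib: "near (\<lambda>n. real (fib n)) (\<lambda>_. 1 / sqrt 5)"
  using near_linear_fib[of 0 1] by simp

lemma block_sum_add: "block_sum n (\<lambda>p m. f p m + g p m) = block_sum n f + block_sum n g"
  by (simp add: block_sum_def sum.distrib)

lemma block_sum_cmult: "block_sum n (\<lambda>p m. c * f p m) = c * (block_sum n f :: 'a::semiring_0)"
  by (simp add: block_sum_def sum_distrib_left)

lemma block_sum_diff:
  "block_sum n (\<lambda>p m. f p m - g p m) = block_sum n f - (block_sum n g :: 'a::ab_group_add)"
  by (simp add: block_sum_def sum_subtractf)

definition block_count :: "nat \<Rightarrow> real" where "block_count n = block_sum n (\<lambda>p m. 1)"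
definition sum_p :: "nat \<Rightarrow> real" where "sum_p n = block_sum n (\<lambda>p m. p)"
definition sum_m :: "nat \<Rightarrow> real" where "sum_m n = block_sum n (\<lambda>p m. m)"
definition sum_pp :: "nat \<Rightarrow> real" where "sum_pp n = block_sum n (\<lambda>p m. p\<^sup>2)"
definition sum_mm :: "nat \<Rightarrow> real" where "sum_mm n = block_sum n (\<lambda>p m. m\<^sup>2)"
definition sum_pm :: "nat \<Rightarrow> real" where "sum_pm n = block_sum n (\<lambda>p m. p * m)"

lemmas moment_defs = block_count_def sum_p_def sum_m_def sum_pp_def sum_mm_def sum_pm_def

lemma block_count_rec: "block_count (n + 4) = block_count (n + 3) + block_count (n + 1) + block_count n"
  unfolding moment_defs by (rule block_sum_rec)

lemma sum_p_rec:
  "sum_p (n + 4) = sum_p (n + 3) + sum_p (n + 1) + sum_p n + block_count (n + 1) + block_count n"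
  unfolding moment_defs block_sum_rec[of n] by (simp add: block_sum_add)

lemma sum_m_rec:
  "sum_m (n + 4) = sum_m (n + 3) - sum_m (n + 1) + sum_m n + block_count (n + 1) + block_count n"
  unfolding moment_defs block_sum_rec[of n] by (simp add: block_sum_add block_sum_diff)

lemma sum_pp_rec:
  "sum_pp (n + 4) = sum_pp (n + 3) + sum_pp (n + 1) + sum_pp n
     + 2 * (sum_p (n + 1) + sum_p n) + block_count (n + 1) + block_count n"
proof -
  have "(1 + p)\<^sup>2 = 1 + 2 * p + p\<^sup>2" for p :: real by (simp add: power2_sum)
  then show ?thesis
    unfolding moment_defs block_sum_rec[of n] by (simp add: block_sum_add block_sum_cmult)
qed

lemma sum_mm_rec:
  "sum_mm (n + 4) = sum_mm (n + 3) + sum_mm (n + 1) + sum_mm n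
     + 2 * (sum_m n - sum_m (n + 1)) + block_count (n + 1) + block_count n"
proof -
  have "(1 + p)\<^sup>2 = 1 + 2 * p + p\<^sup>2" "(1 - p)\<^sup>2 = 1 - 2 * p + p\<^sup>2" for p :: real
    by (simp_all add: power2_sum power2_diff)
  then show ?thesis
    unfolding moment_defs block_sum_rec[of n]
    by (simp add: block_sum_add block_sum_diff block_sum_cmult)
qed

lemma sum_pm_rec:
  "sum_pm (n + 4) = sum_pm (n + 3) - sum_pm (n + 1) + sum_pm n
     + (sum_p (n + 1) + sum_p n) + (sum_m n - sum_m (n + 1)) + block_count (n + 1) + block_count n"
proof -
  have "(1 + p) * (1 + m) = 1 + p + m + p * m" "(1 + p) * (1 - m) = 1 + p - m - p * m" for p m :: real
    by (simp_all add: algebra_simps)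
  then show ?thesis
    unfolding moment_defs block_sum_rec[of n] by (simp add: block_sum_add block_sum_diff)
qed

lemma moments_initial:
  "block_count 0 = 0" "block_count 1 = 1" "block_count 2 = 1" "block_count 3 = 1"
  "sum_p 0 = 0" "sum_p 1 = 1" "sum_p 2 = 1" "sum_p 3 = 1"
  by (simp_all only: moment_defs block_sum_initial)

text \<open>The values at the arguments in the form into which simplification rewrites them.\<close>

lemmas moments_initial_Suc = moments_initial[unfolded numeral_2_eq_2 numeral_3_eq_3 One_nat_def]

lemma nat_two_step_induct [case_names 0 1 step]:
  "P 0 \<Longrightarrow> P (1::nat) \<Longrightarrow> (\<And>n. P n \<Longrightarrow> P (n + 1) \<Longrightarrow> P (n + 2)) \<Longrightarrow> P n"
  using fib.induct[of P n] by simp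

lemma block_count_fib: "block_count (n + 2) + block_count n = real (fib (n + 2))"
proof (induction n rule: nat_two_step_induct)
  case 0
  show ?case by (simp add: moments_initial_Suc numeral_2_eq_2)
next
  case 1
  show ?case by (simp add: moments_initial_Suc numeral_eq_Suc)
next
  case (step n)
  have "real (fib (n + 2 + 2)) = real (fib (n + 1 + 2)) + real (fib (n + 2))"
    by (simp add: numeral_eq_Suc)
  then show ?case using step block_count_rec[of n] by (simp add: algebra_simps numeral_eq_Suc)
qed

text \<open>The mean is needed up to \<open>o(1)\<close>, so the constant multiplying the power of the golden ratio in \<open>sum_p\<close>
  must be known exactly, and it depends on the initial values.  Applying \<open>f (n + 2) + f n\<close> twice, which
  is invertible up to small errors, removes the roots \<open>\<plusminus> \<i>\<close>, double for \<open>sum_p\<close>, and leaves a closed form in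
  Fibonacci numbers.\<close>

lemma sum_p_fib:
  "sum_p (n + 4) + 2 * sum_p (n + 2) + sum_p n
     = ((3 * real n + 18) * real (fib n) + (4 * real n + 25) * real (fib (n + 1))) / 5"
proof (induction n rule: nat_two_step_induct)
  case 0
  have "sum_p 4 + 2 * sum_p 2 + sum_p 0 = 5" using sum_p_rec[of 0] moments_initial by simp
  then show ?case by (simp add: numeral_2_eq_2)
next
  case 1
  have "sum_p 4 = 3" "sum_p 5 = 7"
    using sum_p_rec[of 0] sum_p_rec[of 1] moments_initial by (simp_all add: moments_initial_Suc)
  then have "sum_p 5 + 2 * sum_p 3 + sum_p 1 = 10" using moments_initial by simp
  then show ?case by (simp add: numeral_eq_Suc)
next
  case (step n)
  have f: "real (fib (n + 3)) = 2 * real (fib (n + 1)) + real (fib n)"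
    "real (fib (n + 2)) = real (fib (n + 1)) + real (fib n)"
    "real (fib (n + 2 + 1)) = 2 * real (fib (n + 1)) + real (fib n)"
    "real (fib (n + 1 + 1)) = real (fib (n + 1)) + real (fib n)"
    by (simp_all add: numeral_eq_Suc)
  have "block_count (n + 3) + block_count (n + 2) + block_count (n + 1) + block_count n
      = 3 * real (fib (n + 1)) + 2 * real (fib n)"
    using block_count_fib[of "n + 1"] block_count_fib[of n] f by (simp add: algebra_simps numeral_eq_Suc)
  then have "sum_p (n + 6) + 2 * sum_p (n + 4) + sum_p (n + 2)
      = (sum_p (n + 5) + 2 * sum_p (n + 3) + sum_p (n + 1))
        + (sum_p (n + 4) + 2 * sum_p (n + 2) + sum_p n)
        + (3 * real (fib (n + 1)) + 2 * real (fib n))"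
    using sum_p_rec[of n] sum_p_rec[of "n + 2"] by (simp add: algebra_simps numeral_eq_Suc)
  also have "sum_p (n + 5) + 2 * sum_p (n + 3) + sum_p (n + 1)
      = ((3 * real (n + 1) + 18) * real (fib (n + 1)) + (4 * real (n + 1) + 25) * real (fib (n + 1 + 1))) / 5"
    using step(2) by (simp add: algebra_simps numeral_eq_Suc)
  also have "sum_p (n + 4) + 2 * sum_p (n + 2) + sum_p n
      = ((3 * real n + 18) * real (fib n) + (4 * real n + 25) * real (fib (n + 1))) / 5"
    by (rule step(1))
  also have "((3 * real (n + 1) + 18) * real (fib (n + 1)) + (4 * real (n + 1) + 25) * real (fib (n + 1 + 1))) / 5
      + ((3 * real n + 18) * real (fib n) + (4 * real n + 25) * real (fib (n + 1))) / 5
      + (3 * real (fib (n + 1)) + 2 * real (fib n))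
      = ((3 * real (n + 2) + 18) * real (fib (n + 2)) + (4 * real (n + 2) + 25) * real (fib (n + 2 + 1))) / 5"
    unfolding f by (simp add: field_simps)
  finally show ?case by (simp add: algebra_simps numeral_eq_Suc)
qed


lemma near_block_count: "near block_count (\<lambda>_. golden_ratio / 5)"
proof (rule near_alternating_inverse)
  have "golden_ratio\<^sup>2 * (1 / sqrt 5) = golden_ratio\<^sup>2 * (golden_ratio / 5) + golden_ratio / 5"
    by (simp add: golden_ratio_def field_simps power2_eq_square)
  then show "near (\<lambda>n. block_count (n + 2) + block_count n)
      (\<lambda>n. golden_ratio\<^sup>2 * (golden_ratio / 5) + golden_ratio / 5)"
    using near_shift[OF near_fib, of 2] by (simp only: block_count_fib)
qed


lemma near_sum_p: "near sum_p (\<lambda>n. golden_ratio / 25 * real n + (17 * golden_ratio - 1) / 125)"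
proof -
  let ?q = "\<lambda>n. golden_ratio / 25 * real n + (17 * golden_ratio - 1) / 125"
  have "near (\<lambda>n. (3 * real n + 18) * real (fib n) + (4 * real (n + 1) + 21) * real (fib (n + 1)))
      (\<lambda>n. (3 * real n + 18) / sqrt 5 + golden_ratio ^ 1 * ((4 * real (n + 1) + 21) / sqrt 5))"
    by (intro near_add near_linear_fib near_shift[OF near_linear_fib])
  then have "near (\<lambda>n. 1 / 5 * ((3 * real n + 18) * real (fib n) + (4 * real (n + 1) + 21) * real (fib (n + 1))))
      (\<lambda>n. 1 / 5 * ((3 * real n + 18) / sqrt 5 + golden_ratio ^ 1 * ((4 * real (n + 1) + 21) / sqrt 5)))"
    by (rule near_cmult)
  then have "near (\<lambda>n. (sum_p (n + 2 + 2) + sum_p (n + 2)) + (sum_p (n + 2) + sum_p n))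
      (\<lambda>n. golden_ratio\<^sup>2 * (golden_ratio\<^sup>2 * ?q (n + 2 + 2) + ?q (n + 2)) + (golden_ratio\<^sup>2 * ?q (n + 2) + ?q n))"
  proof (rule near_cong)
    fix n
    show "1 / 5 * ((3 * real n + 18) * real (fib n) + (4 * real (n + 1) + 21) * real (fib (n + 1)))
        = (sum_p (n + 2 + 2) + sum_p (n + 2)) + (sum_p (n + 2) + sum_p n)"
    proof -
      have "n + 2 + 2 = n + 4" "4 * real (n + 1) + 21 = 4 * real n + 25" by simp_all
      note idx = this
      show ?thesis using sum_p_fib[of n] unfolding idx by linarith
    qed
    define Z where "Z = golden_ratio\<^sup>2 * (golden_ratio\<^sup>2 * ?q (n + 2 + 2) + ?q (n + 2)) + (golden_ratio\<^sup>2 * ?q (n + 2) + ?q n)"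
    have eqn: "(3 * real n + 18) + golden_ratio * (4 * real (n + 1) + 21) = 5 * sqrt 5 * Z"
      unfolding Z_def sqrt5_golden_ratio of_nat_add of_nat_numeral of_nat_1
      using golden_ratio_square by algebra
    have "1 / 5 * ((3 * real n + 18) / sqrt 5 + golden_ratio ^ 1 * ((4 * real (n + 1) + 21) / sqrt 5))
        = ((3 * real n + 18) + golden_ratio * (4 * real (n + 1) + 21)) / (5 * sqrt 5)"
      by (simp add: field_simps)
    also have "\<dots> = Z" unfolding eqn by simp
    finally show "1 / 5 * ((3 * real n + 18) / sqrt 5 + golden_ratio ^ 1 * ((4 * real (n + 1) + 21) / sqrt 5)) =
      golden_ratio\<^sup>2 * (golden_ratio\<^sup>2 * ?q (n + 2 + 2) + ?q (n + 2)) + (golden_ratio\<^sup>2 * ?q (n + 2) + ?q n)"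
      unfolding Z_def .
  qed
  then have "near (\<lambda>n. sum_p (n + 2) + sum_p n) (\<lambda>n. golden_ratio\<^sup>2 * ?q (n + 2) + ?q n)"
    by (rule near_alternating_inverse)
  then show ?thesis by (rule near_alternating_inverse)
qed

lemma near_sum_m: "near sum_m (\<lambda>n. golden_ratio\<^sup>2 / 10)"
proof (rule near_antisymmetric_inverse)
  have "near (\<lambda>n. block_count (n + 1) + block_count n) (\<lambda>n. golden_ratio ^ 1 * (golden_ratio / 5) + golden_ratio / 5)"
    by (intro near_add near_shift[OF near_block_count] near_block_count)
  then show "near (\<lambda>n. sum_m (n + 4) - sum_m (n + 3) + sum_m (n + 1) - sum_m n)
    (\<lambda>n. golden_ratio ^ 4 * (golden_ratio\<^sup>2 / 10) - golden_ratio ^ 3 * (golden_ratio\<^sup>2 / 10)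
       + golden_ratio * (golden_ratio\<^sup>2 / 10) - golden_ratio\<^sup>2 / 10)"
  proof (rule near_cong)
    show "block_count (n + 1) + block_count n = sum_m (n + 4) - sum_m (n + 3) + sum_m (n + 1) - sum_m n" for n
      using sum_m_rec[of n] by simp
    show "golden_ratio ^ 1 * (golden_ratio / 5) + golden_ratio / 5 =
      golden_ratio ^ 4 * (golden_ratio\<^sup>2 / 10) - golden_ratio ^ 3 * (golden_ratio\<^sup>2 / 10)
       + golden_ratio * (golden_ratio\<^sup>2 / 10) - golden_ratio\<^sup>2 / 10"
      using golden_ratio_square by algebra
  qed
qed

text \<open>The quadratic and linear coefficients are forced by the inhomogeneous terms; the constant \<open>\<gamma>\<close>
  changes the variance by a bounded amount.\<close>

lemma near_sum_pp:
  "\<exists>\<gamma>. near sum_pp (\<lambda>n. golden_ratio / 125 * (real n)\<^sup>2 + (36 * golden_ratio + 2) / 625 * real n + \<gamma>)"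
proof (rule near_symmetric_inverse)
  let ?p = "\<lambda>n. golden_ratio / 25 * real n + (17 * golden_ratio - 1) / 125"
  let ?q = "\<lambda>n. golden_ratio / 125 * (real n)\<^sup>2 + (36 * golden_ratio + 2) / 625 * real n"
  have "near (\<lambda>n. 2 * (sum_p (n + 1) + sum_p n) + (block_count (n + 1) + block_count n))
    (\<lambda>n. 2 * (golden_ratio ^ 1 * ?p (n + 1) + ?p n) + (golden_ratio ^ 1 * (golden_ratio / 5) + golden_ratio / 5))"
    by (intro near_add near_cmult near_shift[OF near_block_count] near_block_count near_shift[OF near_sum_p] near_sum_p)
  then show "near (\<lambda>n. sum_pp (n + 4) - sum_pp (n + 3) - sum_pp (n + 1) - sum_pp n)
    (\<lambda>n. golden_ratio ^ 4 * ?q (n + 4) - golden_ratio ^ 3 * ?q (n + 3) - golden_ratio * ?q (n + 1) - ?q n)"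
  proof (rule near_cong)
    show "2 * (sum_p (n + 1) + sum_p n) + (block_count (n + 1) + block_count n) =
        sum_pp (n + 4) - sum_pp (n + 3) - sum_pp (n + 1) - sum_pp n" for n
      using sum_pp_rec[of n] by simp
    fix n
    (* Abstract coefficients keep the reduction modulo the quadratic equation of the golden ratio small. *)
    define a b where "a = golden_ratio / 125" and "b = (36 * golden_ratio + 2) / 625"
    have "golden_ratio ^ 4 * ?q (n + 4) - golden_ratio ^ 3 * ?q (n + 3) - golden_ratio * ?q (n + 1) - ?q n
        = 2 * a * real n * (5 * golden_ratio + 5) + a * (29 * golden_ratio + 23) + b * (5 * golden_ratio + 5)"
      unfolding golden_ratio_cube golden_ratio_fourth a_def[symmetric] b_def[symmetric] power2_eq_square
      by (simp add: algebra_simps)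
    also have "\<dots> = 2 * (golden_ratio ^ 1 * ?p (n + 1) + ?p n) + (golden_ratio ^ 1 * (golden_ratio / 5) + golden_ratio / 5)"
      unfolding a_def b_def of_nat_add of_nat_1
      using golden_ratio_square by algebra
    finally show "2 * (golden_ratio ^ 1 * ?p (n + 1) + ?p n) + (golden_ratio ^ 1 * (golden_ratio / 5) + golden_ratio / 5)
        = golden_ratio ^ 4 * ?q (n + 4) - golden_ratio ^ 3 * ?q (n + 3) - golden_ratio * ?q (n + 1) - ?q n" ..
  qed
qed

lemma near_sum_mm: "\<exists>\<gamma>. near sum_mm (\<lambda>n. 1 / 25 * real n + \<gamma>)"
proof (rule near_symmetric_inverse)
  let ?q = "\<lambda>n. 1 / 25 * real n"
  have "near (\<lambda>n. 2 * (sum_m n - sum_m (n + 1)) + (block_count (n + 1) + block_count n))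
    (\<lambda>n. 2 * (golden_ratio\<^sup>2 / 10 - golden_ratio ^ 1 * (golden_ratio\<^sup>2 / 10))
        + (golden_ratio ^ 1 * (golden_ratio / 5) + golden_ratio / 5))"
    by (intro near_add near_diff near_cmult near_shift[OF near_block_count] near_block_count near_shift[OF near_sum_m] near_sum_m)
  then show "near (\<lambda>n. sum_mm (n + 4) - sum_mm (n + 3) - sum_mm (n + 1) - sum_mm n)
    (\<lambda>n. golden_ratio ^ 4 * ?q (n + 4) - golden_ratio ^ 3 * ?q (n + 3) - golden_ratio * ?q (n + 1) - ?q n)"
  proof (rule near_cong)
    show "2 * (sum_m n - sum_m (n + 1)) + (block_count (n + 1) + block_count n) =
        sum_mm (n + 4) - sum_mm (n + 3) - sum_mm (n + 1) - sum_mm n" for n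
      using sum_mm_rec[of n] by simp
    fix n
    have "golden_ratio ^ 4 * ?q (n + 4) - golden_ratio ^ 3 * ?q (n + 3) - golden_ratio * ?q (n + 1) - ?q n
        = (golden_ratio + 1) / 5"
      unfolding golden_ratio_cube golden_ratio_fourth
      by (simp add: algebra_simps add_divide_distrib)
    also have "\<dots> = 2 * (golden_ratio\<^sup>2 / 10 - golden_ratio ^ 1 * (golden_ratio\<^sup>2 / 10))
        + (golden_ratio ^ 1 * (golden_ratio / 5) + golden_ratio / 5)"
    proof -
      have "golden_ratio * golden_ratio = golden_ratio + 1"
        using golden_ratio_square by (simp add: power2_eq_square)
      then show ?thesis unfolding golden_ratio_square by (simp add: algebra_simps)
    qed
    finally show "2 * (golden_ratio\<^sup>2 / 10 - golden_ratio ^ 1 * (golden_ratio\<^sup>2 / 10))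
        + (golden_ratio ^ 1 * (golden_ratio / 5) + golden_ratio / 5)
        = golden_ratio ^ 4 * ?q (n + 4) - golden_ratio ^ 3 * ?q (n + 3) - golden_ratio * ?q (n + 1) - ?q n" ..
  qed
qed

lemma near_sum_pm: "\<exists>\<gamma>. near sum_pm (\<lambda>n. golden_ratio\<^sup>2 / 50 * real n + \<gamma>)"
proof -
  let ?p = "\<lambda>n. golden_ratio / 25 * real n + (17 * golden_ratio - 1) / 125"
  define r where "r = golden_ratio * (golden_ratio / 25) + (golden_ratio + 1) * ((17 * golden_ratio - 1) / 125)
    + (golden_ratio\<^sup>2 / 10 - golden_ratio * (golden_ratio\<^sup>2 / 10)) + (golden_ratio * (golden_ratio / 5) + golden_ratio / 5)"
  (* The constant term of the ansatz, solved from the constant term r of the inhomogeneity. *)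
  define \<gamma> where "\<gamma> = (r - golden_ratio\<^sup>2 / 50 * (7 * golden_ratio + 5)) / (2 * golden_ratio)"
  let ?q = "\<lambda>n. golden_ratio\<^sup>2 / 50 * real n + \<gamma>"
  have "near (\<lambda>n. (sum_p (n + 1) + sum_p n) + (sum_m n - sum_m (n + 1)) + (block_count (n + 1) + block_count n))
    (\<lambda>n. (golden_ratio ^ 1 * ?p (n + 1) + ?p n) + (golden_ratio\<^sup>2 / 10 - golden_ratio ^ 1 * (golden_ratio\<^sup>2 / 10))
        + (golden_ratio ^ 1 * (golden_ratio / 5) + golden_ratio / 5))"
    by (intro near_add near_diff near_cmult near_shift[OF near_block_count] near_block_count
        near_shift[OF near_sum_m] near_sum_m near_shift[OF near_sum_p] near_sum_p)
  then have "near (\<lambda>n. sum_pm (n + 4) - sum_pm (n + 3) + sum_pm (n + 1) - sum_pm n)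
    (\<lambda>n. golden_ratio ^ 4 * ?q (n + 4) - golden_ratio ^ 3 * ?q (n + 3) + golden_ratio * ?q (n + 1) - ?q n)"
  proof (rule near_cong)
    show "(sum_p (n + 1) + sum_p n) + (sum_m n - sum_m (n + 1)) + (block_count (n + 1) + block_count n) =
        sum_pm (n + 4) - sum_pm (n + 3) + sum_pm (n + 1) - sum_pm n" for n
      using sum_pm_rec[of n] by simp
    have "2 * golden_ratio * \<gamma> = r - golden_ratio\<^sup>2 / 50 * (7 * golden_ratio + 5)"
      by (simp add: \<gamma>_def)
    then have \<gamma>: "r = 2 * golden_ratio * \<gamma> + golden_ratio\<^sup>2 / 50 * (7 * golden_ratio + 5)" by simp
    fix n
    have "(golden_ratio ^ 1 * ?p (n + 1) + ?p n) + (golden_ratio\<^sup>2 / 10 - golden_ratio ^ 1 * (golden_ratio\<^sup>2 / 10))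
        + (golden_ratio ^ 1 * (golden_ratio / 5) + golden_ratio / 5)
        = golden_ratio\<^sup>2 / 50 * real n * (2 * golden_ratio) + r"
      unfolding of_nat_add of_nat_numeral of_nat_1 r_def
      using golden_ratio_square by algebra
    also have "\<dots> = golden_ratio ^ 4 * ?q (n + 4) - golden_ratio ^ 3 * ?q (n + 3) + golden_ratio * ?q (n + 1) - ?q n"
    proof -
      define h where "h = golden_ratio\<^sup>2 / 50"
      show ?thesis
        unfolding \<gamma> golden_ratio_cube golden_ratio_fourth h_def[symmetric] by (simp add: algebra_simps)
    qed
    finally show "(golden_ratio ^ 1 * ?p (n + 1) + ?p n) + (golden_ratio\<^sup>2 / 10 - golden_ratio ^ 1 * (golden_ratio\<^sup>2 / 10))
        + (golden_ratio ^ 1 * (golden_ratio / 5) + golden_ratio / 5)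
        = golden_ratio ^ 4 * ?q (n + 4) - golden_ratio ^ 3 * ?q (n + 3) + golden_ratio * ?q (n + 1) - ?q n" .
  qed
  then show ?thesis by (intro exI) (rule near_antisymmetric_inverse)
qed

lemma block_count_pos: "n > 0 \<Longrightarrow> block_count n > 0"
proof -
  assume "n > 0"
  then have "fibS (n - 1) < fibS n" using fibS_strict_mono by (simp add: strict_mono_less)
  then show ?thesis by (simp add: block_count_def block_sum_def block_def)
qed

lemma poly_small_tendsto_0:
  assumes "small e"
  shows "(\<lambda>n. (real n + 1) ^ k * (e n / golden_ratio ^ n)) \<longlonglongrightarrow> 0"
proof -
  obtain C where C: "C \<ge> 0" "\<And>n. \<bar>e n\<bar> \<le> C * (3 / 2) ^ n" using smallE[OF assms] by metis
  define r where "r = 3 / 2 / golden_ratio"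
  have r: "0 < r" "r < 1" using golden_ratio_bounds by (auto simp: r_def)
  show ?thesis
  proof (rule Lim_null_comparison)
    have "(\<lambda>n. (real n + 1) ^ k * r ^ n) \<longlonglongrightarrow> 0"
      using r by real_asymp
    then show "(\<lambda>n. C * ((real n + 1) ^ k * r ^ n)) \<longlonglongrightarrow> 0"
      by (rule tendsto_mult_right_zero)
    show "\<forall>\<^sub>F n in sequentially. norm ((real n + 1) ^ k * (e n / golden_ratio ^ n)) \<le> C * ((real n + 1) ^ k * r ^ n)"
    proof (rule always_eventually, rule allI)
      fix n
      have "\<bar>e n\<bar> / golden_ratio ^ n \<le> C * r ^ n"
        using divide_right_mono[OF C(2)[of n], of "golden_ratio ^ n"] by (simp add: r_def power_divide)
      then have "(real n + 1) ^ k * (\<bar>e n\<bar> / golden_ratio ^ n) \<le> (real n + 1) ^ k * (C * r ^ n)"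
        by (intro mult_left_mono) auto
      then show "norm ((real n + 1) ^ k * (e n / golden_ratio ^ n)) \<le> C * ((real n + 1) ^ k * r ^ n)"
        by (simp add: abs_mult power_abs mult_ac)
    qed
  qed
qed

lemma block_count_asymp: "(\<lambda>n. block_count n / golden_ratio ^ n) \<longlonglongrightarrow> golden_ratio / 5"
proof -
  have "(\<lambda>n. (block_count n - golden_ratio / 5 * golden_ratio ^ n) / golden_ratio ^ n + golden_ratio / 5)
      \<longlonglongrightarrow> 0 + golden_ratio / 5"
    using poly_small_tendsto_0[OF near_block_count[unfolded near_def], of 0] by (intro tendsto_intros) simp
  then show ?thesis by (simp add: diff_divide_distrib)
qed

text \<open>The factor \<open>n\<close> in front is what makes the products of two expectations, one of which grows linearly,
  accurate enough for the variance.\<close>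

lemma near_ratio:
  assumes f: "near f q" and q: "\<And>n. \<bar>q n\<bar> \<le> K * (real n + 1)\<^sup>2"
  shows "(\<lambda>n. real n * (f n / block_count n - q n / (golden_ratio / 5))) \<longlonglongrightarrow> 0"
proof -
  let ?\<alpha> = "golden_ratio / 5"
  define u where "u n = f n - q n * golden_ratio ^ n" for n
  define v where "v n = block_count n - ?\<alpha> * golden_ratio ^ n" for n
  have su: "small u" using f unfolding near_def u_def[abs_def] .
  have sv: "small v" using near_block_count unfolding near_def v_def[abs_def] .
  have lu: "(\<lambda>n. real n * (u n / golden_ratio ^ n)) \<longlonglongrightarrow> 0"
  proof (rule Lim_null_comparison)
    show "(\<lambda>n. norm ((real n + 1) ^ 1 * (u n / golden_ratio ^ n))) \<longlonglongrightarrow> 0"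
      using poly_small_tendsto_0[OF su, of 1] by (rule tendsto_norm_zero)
  qed (auto simp: abs_mult intro!: always_eventually divide_right_mono mult_right_mono)
  have lv: "(\<lambda>n. real n * q n * (v n / golden_ratio ^ n)) \<longlonglongrightarrow> 0"
  proof (rule Lim_null_comparison)
    have "(\<lambda>n. norm ((real n + 1) ^ 3 * (v n / golden_ratio ^ n))) \<longlonglongrightarrow> 0"
      using poly_small_tendsto_0[OF sv, of 3] by (rule tendsto_norm_zero)
    then show "(\<lambda>n. K * norm ((real n + 1) ^ 3 * (v n / golden_ratio ^ n))) \<longlonglongrightarrow> 0"
      by (rule tendsto_mult_right_zero)
    show "\<forall>\<^sub>F n in sequentially. norm (real n * q n * (v n / golden_ratio ^ n))
        \<le> K * norm ((real n + 1) ^ 3 * (v n / golden_ratio ^ n))"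
    proof (rule always_eventually, rule allI)
      fix n
      have "real n * \<bar>q n\<bar> \<le> (real n + 1) * (K * (real n + 1)\<^sup>2)"
        by (intro mult_mono q) auto
      also have "\<dots> = K * (real n + 1) ^ 3" by (simp add: power3_eq_cube power2_eq_square)
      finally have "real n * \<bar>q n\<bar> * \<bar>v n / golden_ratio ^ n\<bar> \<le> K * (real n + 1) ^ 3 * \<bar>v n / golden_ratio ^ n\<bar>"
        by (rule mult_right_mono) simp
      then show "norm (real n * q n * (v n / golden_ratio ^ n)) \<le> K * norm ((real n + 1) ^ 3 * (v n / golden_ratio ^ n))"
        by (simp add: abs_mult power_abs mult_ac)
    qed
  qed
  have "(\<lambda>n. (real n * (u n / golden_ratio ^ n) - real n * q n * (v n / golden_ratio ^ n) / ?\<alpha>)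
      / (block_count n / golden_ratio ^ n)) \<longlonglongrightarrow> (0 - 0 / ?\<alpha>) / ?\<alpha>"
    by (intro tendsto_intros lu lv block_count_asymp) auto
  then have "(\<lambda>n. (real n * (u n / golden_ratio ^ n) - real n * q n * (v n / golden_ratio ^ n) / ?\<alpha>)
      / (block_count n / golden_ratio ^ n)) \<longlonglongrightarrow> 0" by simp
  then show ?thesis
  proof (rule Lim_transform_eventually)
    show "\<forall>\<^sub>F n in sequentially. (real n * (u n / golden_ratio ^ n) - real n * q n * (v n / golden_ratio ^ n) / ?\<alpha>)
      / (block_count n / golden_ratio ^ n) = real n * (f n / block_count n - q n / ?\<alpha>)"
    proof (rule eventually_sequentiallyI[of 1])
      fix n :: nat assume "n \<ge> 1"
      then have c: "block_count n > 0" by (intro block_count_pos) simp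
      define y where "y = golden_ratio ^ n"
      have y: "y > 0" by (simp add: y_def)
      show "(real n * (u n / golden_ratio ^ n) - real n * q n * (v n / golden_ratio ^ n) / ?\<alpha>)
        / (block_count n / golden_ratio ^ n) = real n * (f n / block_count n - q n / ?\<alpha>)"
        unfolding u_def v_def y_def[symmetric] using c y golden_ratio_pos by (simp add: field_simps)
    qed
  qed
qed

section \<open>Means, variances and covariance\<close>

lemma unif_block: "unif n = pmf_of_set (block n)"
  by (simp add: unif_def block_def)

lemma block_nonempty: "n > 0 \<Longrightarrow> block n \<noteq> {}"
  using fibS_strict_mono by (auto simp: block_def strict_mono_less)

lemma block_count_card: "block_count n = real (card (block n))"
  by (simp add: block_count_def block_sum_def)

lemma expectation_unif:
  fixes h :: "real \<Rightarrow> real \<Rightarrow> 'b::{banach, second_countable_topology}"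
  assumes "n > 0"
  shows "(\<integral>x. h (num_terms x) (num_excess x) \<partial>measure_pmf (unif n)) = (1 / block_count n) *\<^sub>R block_sum n h"
proof -
  have "(\<integral>x. h (num_terms x) (num_excess x) \<partial>measure_pmf (unif n))
      = (\<Sum>x\<in>block n. pmf (unif n) x *\<^sub>R h (num_terms x) (num_excess x))"
    by (rule integral_measure_pmf)
      (auto simp: unif_block set_pmf_of_set[OF block_nonempty[OF assms] finite_block])
  also have "\<dots> = (\<Sum>x\<in>block n. (1 / block_count n) *\<^sub>R h (num_terms x) (num_excess x))"
    using block_nonempty[OF assms] by (intro sum.cong) (auto simp: unif_block block_count_card)
  finally show ?thesis by (simp add: block_sum_def scaleR_sum_right)
qed

lemma integrable_unif:
  fixes f :: "int \<Rightarrow> 'b::{banach, second_countable_topology}"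
  assumes "n > 0"
  shows "integrable (measure_pmf (unif n)) f"
  by (rule integrable_measure_pmf_finite)
    (simp add: unif_block set_pmf_of_set[OF block_nonempty[OF assms] finite_block])

abbreviation E_unif :: "nat \<Rightarrow> (int \<Rightarrow> real) \<Rightarrow> real" where
  "E_unif n X \<equiv> measure_pmf.expectation (unif n) X"

definition covariance :: "nat \<Rightarrow> (int \<Rightarrow> real) \<Rightarrow> (int \<Rightarrow> real) \<Rightarrow> real" where
  "covariance n X Y = E_unif n (\<lambda>x. X x * Y x) - E_unif n X * E_unif n Y"

lemma variance_covariance:
  assumes "n > 0"
  shows "measure_pmf.variance (unif n) X = covariance n X X"
  unfolding measure_pmf.variance_eq[OF integrable_unif[OF assms] integrable_unif[OF assms]]
  by (simp add: covariance_def power2_eq_square)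

text \<open>The quadratic terms of \<open>E(XY)\<close> and of \<open>E(X) E(Y)\<close> cancel, and the linear coefficient of what remains is
  the limit.\<close>

lemma covariance_linear_limit:
  fixes u v w :: "nat \<Rightarrow> real"
  assumes u: "(\<lambda>n. real n * (u n - (A * B * (real n)\<^sup>2 + G * real n + D))) \<longlonglongrightarrow> 0"
    and v: "(\<lambda>n. real n * (v n - (A * real n + b))) \<longlonglongrightarrow> 0"
    and w: "(\<lambda>n. real n * (w n - (B * real n + c))) \<longlonglongrightarrow> 0"
  shows "(\<lambda>n. (u n - v n * w n) / real n) \<longlonglongrightarrow> G - A * c - B * b"
proof -
  (* With i = 1/n and the rescaled errors e, f, g the quotient is a polynomial in null sequences. *)
  define i where "i n = 1 / real n" for n
  define e where "e n = real n * (v n - (A * real n + b))" for n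
  define f where "f n = real n * (w n - (B * real n + c))" for n
  define g where "g n = real n * (u n - (A * B * (real n)\<^sup>2 + G * real n + D))" for n
  have i: "i \<longlonglongrightarrow> 0" unfolding i_def by (rule lim_1_over_n)
  have "(\<lambda>n. G - A * c - B * b + (D - b * c) * i n + g n * (i n)\<^sup>2 - A * f n * i n - B * e n * i n
      - b * f n * (i n)\<^sup>2 - c * e n * (i n)\<^sup>2 - e n * f n * (i n) ^ 3)
    \<longlonglongrightarrow> G - A * c - B * b + (D - b * c) * 0 + 0 * 0\<^sup>2 - A * 0 * 0 - B * 0 * 0
      - b * 0 * 0\<^sup>2 - c * 0 * 0\<^sup>2 - 0 * 0 * 0 ^ 3"
    using u v w unfolding e_def[symmetric] f_def[symmetric] g_def[symmetric]
    by (intro tendsto_intros i)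
  then have "(\<lambda>n. G - A * c - B * b + (D - b * c) * i n + g n * (i n)\<^sup>2 - A * f n * i n - B * e n * i n
      - b * f n * (i n)\<^sup>2 - c * e n * (i n)\<^sup>2 - e n * f n * (i n) ^ 3)
    \<longlonglongrightarrow> G - A * c - B * b" by simp
  then show ?thesis
  proof (rule Lim_transform_eventually)
    show "\<forall>\<^sub>F n in sequentially. G - A * c - B * b + (D - b * c) * i n + g n * (i n)\<^sup>2 - A * f n * i n - B * e n * i n
      - b * f n * (i n)\<^sup>2 - c * e n * (i n)\<^sup>2 - e n * f n * (i n) ^ 3 = (u n - v n * w n) / real n"
    proof (rule eventually_sequentiallyI[of 1])
      fix n :: nat assume "n \<ge> 1"
      define x where "x = real n"
      have x: "x > 0" using \<open>n \<ge> 1\<close> by (simp add: x_def)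
      define e' f' g' where "e' = v n - (A * x + b)" and "f' = w n - (B * x + c)"
        and "g' = u n - (A * B * x\<^sup>2 + G * x + D)"
      have eq: "v n = A * x + b + e'" "w n = B * x + c + f'" "u n = A * B * x\<^sup>2 + G * x + D + g'"
        by (simp_all add: e'_def f'_def g'_def)
      have "(u n - v n * w n) / x = G - A * c - B * b + (D - b * c) / x + g' / x - A * f' - B * e'
          - b * f' / x - c * e' / x - e' * f' / x"
        unfolding eq using x by (simp add: field_simps power2_eq_square)
      also have "\<dots> = G - A * c - B * b + (D - b * c) * i n + g n * (i n)\<^sup>2 - A * f n * i n - B * e n * i n
          - b * f n * (i n)\<^sup>2 - c * e n * (i n)\<^sup>2 - e n * f n * (i n) ^ 3"
        unfolding i_def e_def f_def g_def x_def[symmetric] e'_def[symmetric] f'_def[symmetric] g'_def[symmetric]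
        using x by (simp add: power2_eq_square power3_eq_cube)
      finally show "G - A * c - B * b + (D - b * c) * i n + g n * (i n)\<^sup>2 - A * f n * i n - B * e n * i n
          - b * f n * (i n)\<^sup>2 - c * e n * (i n)\<^sup>2 - e n * f n * (i n) ^ 3 = (u n - v n * w n) / real n"
        by (simp add: x_def)
    qed
  qed
qed

lemma poly_bound:
  "\<bar>a * (real n)\<^sup>2 + b * real n + c\<bar> \<le> (\<bar>a\<bar> + \<bar>b\<bar> + \<bar>c\<bar>) * (real n + 1)\<^sup>2"
proof -
  have "(real n)\<^sup>2 \<le> (real n + 1)\<^sup>2" "real n \<le> (real n + 1)\<^sup>2" "1 \<le> (real n + 1)\<^sup>2"
    by (simp_all add: power2_eq_square algebra_simps)
  then have "\<bar>a\<bar> * (real n)\<^sup>2 + \<bar>b\<bar> * real n + \<bar>c\<bar> * 1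
      \<le> \<bar>a\<bar> * (real n + 1)\<^sup>2 + \<bar>b\<bar> * (real n + 1)\<^sup>2 + \<bar>c\<bar> * (real n + 1)\<^sup>2"
    by (intro add_mono mult_left_mono) auto
  moreover have "\<bar>a * (real n)\<^sup>2 + b * real n + c\<bar> \<le> \<bar>a\<bar> * (real n)\<^sup>2 + \<bar>b\<bar> * real n + \<bar>c\<bar> * 1"
    using abs_triangle_ineq[of "a * (real n)\<^sup>2 + b * real n" c] abs_triangle_ineq[of "a * (real n)\<^sup>2" "b * real n"]
    by (simp add: abs_mult)
  ultimately show ?thesis by (simp add: distrib_right)
qed

text \<open>Division by the number of elements of the block, which is asymptotic to \<open>golden_ratio / 5\<close> times the power of
  the golden ratio.\<close>

lemma expectation_quadratic:
  assumes f: "near (\<lambda>n. block_sum n h) (\<lambda>n. a * (real n)\<^sup>2 + b * real n + c)"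
  shows "(\<lambda>n. real n * (E_unif n (\<lambda>x. h (num_terms x) (num_excess x))
      - (5 * a / golden_ratio * (real n)\<^sup>2 + 5 * b / golden_ratio * real n + 5 * c / golden_ratio))) \<longlonglongrightarrow> 0"
proof (rule Lim_transform_eventually[OF near_ratio[OF f poly_bound]])
  show "\<forall>\<^sub>F n in sequentially. real n * (block_sum n h / block_count n
        - (a * (real n)\<^sup>2 + b * real n + c) / (golden_ratio / 5))
    = real n * (E_unif n (\<lambda>x. h (num_terms x) (num_excess x))
      - (5 * a / golden_ratio * (real n)\<^sup>2 + 5 * b / golden_ratio * real n + 5 * c / golden_ratio))"
  proof (rule eventually_sequentiallyI[of 1])
    fix n :: nat assume "n \<ge> 1"
    then have "E_unif n (\<lambda>x. h (num_terms x) (num_excess x)) = block_sum n h / block_count n"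
      using expectation_unif[of n h] by simp
    moreover have "(a * (real n)\<^sup>2 + b * real n + c) / (golden_ratio / 5)
        = 5 * a / golden_ratio * (real n)\<^sup>2 + 5 * b / golden_ratio * real n + 5 * c / golden_ratio"
      by (simp add: field_simps)
    ultimately show "real n * (block_sum n h / block_count n
        - (a * (real n)\<^sup>2 + b * real n + c) / (golden_ratio / 5))
    = real n * (E_unif n (\<lambda>x. h (num_terms x) (num_excess x))
      - (5 * a / golden_ratio * (real n)\<^sup>2 + 5 * b / golden_ratio * real n + 5 * c / golden_ratio))"
      by simp
  qed
qed

lemma inverse_golden_ratio: "1 / golden_ratio = golden_ratio - 1"
  using golden_ratio_square by (simp add: field_simps power2_eq_square)

lemma expectation_terms:
  "(\<lambda>n. real n * (E_unif n num_terms - (1 / 5 * real n + (35 - sqrt 5) / 50))) \<longlonglongrightarrow> 0"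
proof -
  have "near (\<lambda>n. block_sum n (\<lambda>p m. p))
      (\<lambda>n. 0 * (real n)\<^sup>2 + golden_ratio / 25 * real n + (17 * golden_ratio - 1) / 125)"
    using near_sum_p by (simp add: sum_p_def[abs_def])
  note * = expectation_quadratic[OF this]
  have "(\<lambda>n. real n * (E_unif n num_terms - (1 / 5 * real n + (17 * golden_ratio - 1) / 25 / golden_ratio))) \<longlonglongrightarrow> 0"
  proof -
    have "5 * (golden_ratio / 25) / golden_ratio = 1 / 5" "5 * 0 / golden_ratio = 0"
      "5 * ((17 * golden_ratio - 1) / 125) / golden_ratio = (17 * golden_ratio - 1) / 25 / golden_ratio"
      by (simp_all add: field_simps)
    then show ?thesis using * by (simp only: mult_zero_left add_0_left)
  qed
  also have "(17 * golden_ratio - 1) / 25 / golden_ratio = (35 - sqrt 5) / 50"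
  proof -
    have "(17 * golden_ratio - 1) / 25 / golden_ratio = (17 - 1 / golden_ratio) / 25"
      by (simp add: field_simps)
    then show ?thesis unfolding inverse_golden_ratio by (simp add: golden_ratio_def field_simps)
  qed
  finally show ?thesis .
qed

lemma expectation_excess:
  "(\<lambda>n. real n * (E_unif n num_excess - golden_ratio / 2)) \<longlonglongrightarrow> 0"
proof -
  have "near (\<lambda>n. block_sum n (\<lambda>p m. m)) (\<lambda>n. 0 * (real n)\<^sup>2 + 0 * real n + golden_ratio\<^sup>2 / 10)"
    using near_sum_m by (simp add: sum_m_def[abs_def])
  from expectation_quadratic[OF this] show ?thesis
    by (simp add: power2_eq_square)
qed

lemma variance_terms: "(\<lambda>n. covariance n num_terms num_terms / real n) \<longlonglongrightarrow> 2 * sqrt 5 / 125"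
proof -
  obtain \<gamma> where "near (\<lambda>n. block_sum n (\<lambda>p m. p * p))
      (\<lambda>n. golden_ratio / 125 * (real n)\<^sup>2 + (36 * golden_ratio + 2) / 625 * real n + \<gamma>)"
    using near_sum_pp by (auto simp: sum_pp_def[abs_def] power2_eq_square)
  note * = expectation_quadratic[OF this]
  have u: "(\<lambda>n. real n * (E_unif n (\<lambda>x. num_terms x * num_terms x)
      - (1 / 5 * (1 / 5) * (real n)\<^sup>2 + (36 * golden_ratio + 2) / 125 / golden_ratio * real n + 5 * \<gamma> / golden_ratio))) \<longlonglongrightarrow> 0"
  proof -
    have "5 * (golden_ratio / 125) / golden_ratio = 1 / 5 * (1 / 5)"
      "5 * ((36 * golden_ratio + 2) / 625) / golden_ratio = (36 * golden_ratio + 2) / 125 / golden_ratio"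
      by (simp_all add: field_simps)
    then show ?thesis using * by (simp only:)
  qed
  have "(36 * golden_ratio + 2) / 125 / golden_ratio - 1 / 5 * ((35 - sqrt 5) / 50) - 1 / 5 * ((35 - sqrt 5) / 50)
      = 2 * sqrt 5 / 125"
  proof -
    have "(36 * golden_ratio + 2) / 125 / golden_ratio = (36 + 2 * (1 / golden_ratio)) / 125"
      by (simp add: field_simps)
    then show ?thesis unfolding inverse_golden_ratio by (simp add: golden_ratio_def field_simps)
  qed
  then show ?thesis
    using covariance_linear_limit[OF u expectation_terms expectation_terms]
    by (simp only: covariance_def)
qed

lemma variance_excess: "(\<lambda>n. covariance n num_excess num_excess / real n) \<longlonglongrightarrow> (sqrt 5 - 1) / 10"
proof -
  obtain \<gamma> where "near (\<lambda>n. block_sum n (\<lambda>p m. m * m)) (\<lambda>n. 0 * (real n)\<^sup>2 + 1 / 25 * real n + \<gamma>)"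
    using near_sum_mm by (auto simp: sum_mm_def[abs_def] power2_eq_square)
  note * = expectation_quadratic[OF this]
  have u: "(\<lambda>n. real n * (E_unif n (\<lambda>x. num_excess x * num_excess x)
      - (0 * 0 * (real n)\<^sup>2 + (sqrt 5 - 1) / 10 * real n + 5 * \<gamma> / golden_ratio))) \<longlonglongrightarrow> 0"
  proof -
    have "5 * (1 / 25) / golden_ratio = 1 / golden_ratio / 5" by simp
    also have "\<dots> = (sqrt 5 - 1) / 10"
      unfolding inverse_golden_ratio by (simp add: golden_ratio_def field_simps)
    finally have "5 * (1 / 25) / golden_ratio = (sqrt 5 - 1) / 10" .
    moreover have "5 * 0 / golden_ratio = (0 * 0 :: real)" by simp
    ultimately show ?thesis using * by (simp only:)
  qed
  have v: "(\<lambda>n. real n * (E_unif n num_excess - (0 * real n + golden_ratio / 2))) \<longlonglongrightarrow> 0"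
    using expectation_excess by simp
  show ?thesis
    using covariance_linear_limit[OF u v v] by (simp add: covariance_def)
qed

lemma covariance_terms_excess: "(\<lambda>n. covariance n num_terms num_excess / real n) \<longlonglongrightarrow> 0"
proof -
  obtain \<gamma> where "near (\<lambda>n. block_sum n (\<lambda>p m. p * m)) (\<lambda>n. 0 * (real n)\<^sup>2 + golden_ratio\<^sup>2 / 50 * real n + \<gamma>)"
    using near_sum_pm by (auto simp: sum_pm_def[abs_def])
  from expectation_quadratic[OF this]
  have u: "(\<lambda>n. real n * (E_unif n (\<lambda>x. num_terms x * num_excess x)
      - (1 / 5 * 0 * (real n)\<^sup>2 + golden_ratio / 10 * real n + 5 * \<gamma> / golden_ratio))) \<longlonglongrightarrow> 0"
    by (simp add: power2_eq_square)
  have v: "(\<lambda>n. real n * (E_unif n num_excess - (0 * real n + golden_ratio / 2))) \<longlonglongrightarrow> 0"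
    using expectation_excess by simp
  show ?thesis
    using covariance_linear_limit[OF u expectation_terms v] by (simp add: covariance_def)
qed

section \<open>Characteristic functions of the summand counts\<close>

text \<open>Up to normalization, the joint characteristic function of \<open>num_terms\<close> and \<open>num_excess\<close> at \<open>(a, d)\<close>.
  Its recursion couples it with the same sum at \<open>(a, - d)\<close>.\<close>

definition char_sum :: "real \<Rightarrow> real \<Rightarrow> nat \<Rightarrow> complex" where
  "char_sum a d n = block_sum n (\<lambda>p m. cis (a * p + d * m))"

lemma char_sum_rec:
  "char_sum a d (n + 4) = char_sum a d (n + 3) + cis (a + d) * (char_sum a (- d) (n + 1) + char_sum a d n)"
proof -
  have "cis (a * (1 + p) + d * (1 - m)) = cis (a + d) * cis (a * p + - d * m)"
    "cis (a * (1 + p) + d * (1 + m)) = cis (a + d) * cis (a * p + d * m)" for p m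
    by (simp_all add: cis_mult algebra_simps)
  then show ?thesis
    unfolding char_sum_def block_sum_rec[of n] by (simp only: block_sum_cmult distrib_left add.assoc)
qed

lemma char_sum_tendsto_count:
  assumes "e \<longlonglongrightarrow> 0"
  shows "(\<lambda>k. char_sum (e k * a) (e k * d) n) \<longlonglongrightarrow> of_real (block_count n)"
proof -
  have "(\<lambda>k. \<Sum>x\<in>block n. cis (e k * a * num_terms x + e k * d * num_excess x))
    \<longlonglongrightarrow> (\<Sum>x\<in>block n. cis (0 * a * num_terms x + 0 * d * num_excess x))"
    by (intro tendsto_intros assms)
  then show ?thesis by (simp add: char_sum_def block_sum_def block_count_def)
qed

text \<open>The golden ratio satisfies \<open>z^4 = z^3 + z + 1\<close>, so its powers solve the homogeneous recursion; every
  step adds at most \<open>\<eta>\<close> to the coefficient.\<close>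

lemma weighted_recursion_bound:
  fixes E :: "nat \<Rightarrow> real"
  assumes rec: "\<And>n. E (n + 4) \<le> E (n + 3) + E (n + 1) + E n + \<eta> * golden_ratio ^ n"
    and init: "\<And>i. i < 4 \<Longrightarrow> E i \<le> K * golden_ratio ^ i" and "\<eta> \<ge> 0"
  shows "E n \<le> (K + real n * \<eta>) * golden_ratio ^ n"
proof (induction n rule: less_induct)
  case (less n)
  show ?case
  proof (cases "n < 4")
    case True
    have "E n \<le> K * golden_ratio ^ n" by (rule init) (rule True)
    also have "\<dots> \<le> (K + real n * \<eta>) * golden_ratio ^ n"
      using \<open>\<eta> \<ge> 0\<close> by (intro mult_right_mono) auto
    finally show ?thesis .
  next
    case False
    define k where "k = n - 4"
    have n: "n = k + 4" using False by (simp add: k_def)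
    define L where "L = K + real (k + 3) * \<eta>"
    have IH: "E i \<le> L * golden_ratio ^ i" if "i < n" for i
    proof -
      have "E i \<le> (K + real i * \<eta>) * golden_ratio ^ i" by (rule less.IH) (rule that)
      also have "\<dots> \<le> L * golden_ratio ^ i"
        unfolding L_def using that n \<open>\<eta> \<ge> 0\<close> by (intro mult_right_mono add_left_mono) auto
      finally show ?thesis .
    qed
    have "E (k + 4) \<le> L * golden_ratio ^ (k + 3) + L * golden_ratio ^ (k + 1) + L * golden_ratio ^ k + \<eta> * golden_ratio ^ k"
      using rec[of k] IH[of "k + 3"] IH[of "k + 1"] IH[of k] by (simp add: n)
    also have "\<dots> = (L * (golden_ratio ^ 3 + golden_ratio + 1) + \<eta>) * golden_ratio ^ k"
      by (simp add: power_add algebra_simps)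
    also have "golden_ratio ^ 3 + golden_ratio + 1 = golden_ratio ^ 4"
      by (simp add: golden_ratio_cube golden_ratio_fourth)
    also have "(L * golden_ratio ^ 4 + \<eta>) * golden_ratio ^ k \<le> (L * golden_ratio ^ 4 + \<eta> * golden_ratio ^ 4) * golden_ratio ^ k"
      using \<open>\<eta> \<ge> 0\<close> golden_ratio_bounds one_le_power[of golden_ratio 4]
      by (intro mult_right_mono add_left_mono) (auto simp: mult_le_cancel_left1)
    also have "\<dots> = (K + real (k + 4) * \<eta>) * golden_ratio ^ (k + 4)"
      by (simp add: L_def power_add algebra_simps)
    finally show ?thesis by (simp add: n)
  qed
qed

text \<open>A quantitative version of \<open>O(e^3)\<close> at 0, with a range of validity that does not depend on \<open>f\<close>.\<close>

definition third_order :: "(real \<Rightarrow> complex) \<Rightarrow> bool" where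
  "third_order f \<longleftrightarrow> (\<exists>C\<ge>0. \<forall>e. \<bar>e\<bar> \<le> 1 \<longrightarrow> norm (f e) \<le> C * \<bar>e\<bar> ^ 3)"

lemma third_order_add:
  assumes "third_order f" "third_order g"
  shows "third_order (\<lambda>e. f e + g e)"
proof -
  obtain C D where C: "C \<ge> 0" "\<And>e. \<bar>e\<bar> \<le> 1 \<Longrightarrow> norm (f e) \<le> C * \<bar>e\<bar> ^ 3"
    and D: "D \<ge> 0" "\<And>e. \<bar>e\<bar> \<le> 1 \<Longrightarrow> norm (g e) \<le> D * \<bar>e\<bar> ^ 3"
    using assms unfolding third_order_def by blast
  have "norm (f e + g e) \<le> (C + D) * \<bar>e\<bar> ^ 3" if "\<bar>e\<bar> \<le> 1" for e
    using C(2)[OF that] D(2)[OF that] norm_triangle_ineq[of "f e" "g e"] by (simp add: distrib_right)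
  then show ?thesis unfolding third_order_def using C D by (intro exI[of _ "C + D"]) auto
qed

lemma third_order_cmult:
  assumes "third_order f"
  shows "third_order (\<lambda>e. c * f e)"
proof -
  obtain C where C: "C \<ge> 0" "\<And>e. \<bar>e\<bar> \<le> 1 \<Longrightarrow> norm (f e) \<le> C * \<bar>e\<bar> ^ 3"
    using assms unfolding third_order_def by blast
  have "norm (c * f e) \<le> (norm c * C) * \<bar>e\<bar> ^ 3" if "\<bar>e\<bar> \<le> 1" for e
    using mult_left_mono[OF C(2)[OF that], of "norm c"] by (simp add: norm_mult mult.assoc)
  then show ?thesis unfolding third_order_def using C by (intro exI[of _ "norm c * C"]) auto
qed

definition damped_wave :: "real \<Rightarrow> real \<Rightarrow> real \<Rightarrow> complex" where
  "damped_wave c k e = exp (\<i> * of_real (e * c) - of_real (e\<^sup>2 * k))"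

lemma damped_wave_mult: "damped_wave c k e * damped_wave c' k' e = damped_wave (c + c') (k + k') e"
  by (simp add: damped_wave_def exp_add[symmetric] algebra_simps)

lemma damped_wave_power: "damped_wave c k e ^ n = damped_wave (real n * c) (real n * k) e"
  by (simp add: damped_wave_def exp_of_nat_mult[symmetric] algebra_simps)

lemma damped_wave_cis: "damped_wave c 0 e = cis (e * c)"
  by (simp add: damped_wave_def cis_conv_exp)

lemma norm_damped_wave: "norm (damped_wave c k e) = exp (- (e\<^sup>2 * k))"
  by (simp add: damped_wave_def norm_exp_eq_Re)

lemma damped_wave_taylor:
  "third_order (\<lambda>e. damped_wave c k e - (1 + \<i> * of_real (e * c) - of_real (e\<^sup>2 * (k + c\<^sup>2 / 2))))"
proof -
  define B where "B = \<bar>c\<bar> + \<bar>k\<bar>"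
  have B: "B \<ge> 0" by (simp add: B_def)
  have "norm (damped_wave c k e - (1 + \<i> * of_real (e * c) - of_real (e\<^sup>2 * (k + c\<^sup>2 / 2))))
      \<le> (exp B * B ^ 3 + B\<^sup>2 + B\<^sup>2) * \<bar>e\<bar> ^ 3" if e: "\<bar>e\<bar> \<le> 1" for e
  proof -
    define u where "u = \<i> * of_real (e * c) - of_real (e\<^sup>2 * k)"
    have e2: "e\<^sup>2 \<le> \<bar>e\<bar>" using e     proof -
      have "e\<^sup>2 = \<bar>e\<bar> * \<bar>e\<bar>" by (simp add: power2_eq_square)
      also have "\<dots> \<le> \<bar>e\<bar>" by (rule mult_left_le) (use e in auto)
      finally show ?thesis .
    qed
    have "norm u \<le> norm (\<i> * of_real (e * c) :: complex) + norm (of_real (e\<^sup>2 * k) :: complex)"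
      unfolding u_def by (rule norm_triangle_ineq4)
    also have "\<dots> = \<bar>e\<bar> * \<bar>c\<bar> + e\<^sup>2 * \<bar>k\<bar>" by (simp add: norm_mult norm_power)
    also have "\<dots> \<le> \<bar>e\<bar> * B"
      using mult_right_mono[OF e2, of "\<bar>k\<bar>"] by (simp add: B_def distrib_left)
    finally have u: "norm u \<le> \<bar>e\<bar> * B" .
    also have "\<dots> \<le> B" using e B by (simp add: mult_left_le_one_le)
    finally have uB: "norm u \<le> B" .
    have "Suc 2 = (3::nat)" by simp
    then have "norm (exp u - (\<Sum>i\<le>2. u ^ i / fact i)) \<le> exp \<bar>Re u\<bar> * norm u ^ 3 / fact 2"
      using Taylor_exp[of u 2] by (simp only:)
    also have "\<dots> \<le> exp B * (\<bar>e\<bar> * B) ^ 3 / 1"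
      using u uB abs_Re_le_cmod[of u] by (intro frac_le mult_mono power_mono) auto
    also have "(\<Sum>i\<le>2. u ^ i / fact i) = 1 + u + u\<^sup>2 / 2"
      by (simp add: numeral_2_eq_2)
    finally have t1: "norm (exp u - (1 + u + u\<^sup>2 / 2)) \<le> exp B * B ^ 3 * \<bar>e\<bar> ^ 3"
      by (simp add: power_mult_distrib mult_ac)
    have "u\<^sup>2 / 2 + of_real (e\<^sup>2 * (c\<^sup>2 / 2)) = of_real (- (e ^ 3 * c * k)) * \<i> + of_real (e ^ 4 * k\<^sup>2 / 2)"
      unfolding u_def by (simp add: power2_eq_square field_simps power3_eq_cube power4_eq_xxxx)
    also have "norm \<dots> \<le> norm (of_real (- (e ^ 3 * c * k)) * \<i> :: complex) + norm (of_real (e ^ 4 * k\<^sup>2 / 2) :: complex)"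
      by (rule norm_triangle_ineq)
    also have "\<dots> = \<bar>e\<bar> ^ 3 * (\<bar>c\<bar> * \<bar>k\<bar>) + \<bar>e\<bar> ^ 4 * (k\<^sup>2 / 2)"
      by (simp only: norm_mult norm_of_real norm_ii) (simp add: abs_mult power_abs)
    also have "\<dots> \<le> \<bar>e\<bar> ^ 3 * B\<^sup>2 + \<bar>e\<bar> ^ 3 * B\<^sup>2"
    proof (intro add_mono mult_mono)
      show "\<bar>c\<bar> * \<bar>k\<bar> \<le> B\<^sup>2" unfolding B_def power2_eq_square by (intro mult_mono) auto
      have "\<bar>k\<bar>\<^sup>2 \<le> B\<^sup>2" unfolding B_def by (intro power_mono) auto
      then show "k\<^sup>2 / 2 \<le> B\<^sup>2" using zero_le_power2[of k] unfolding power2_abs by linarith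
      show "\<bar>e\<bar> ^ 4 \<le> \<bar>e\<bar> ^ 3" using e by (intro power_decreasing) auto
    qed auto
    finally have t2: "norm (u\<^sup>2 / 2 + of_real (e\<^sup>2 * (c\<^sup>2 / 2))) \<le> (B\<^sup>2 + B\<^sup>2) * \<bar>e\<bar> ^ 3"
      by (simp add: algebra_simps)
    have "damped_wave c k e - (1 + \<i> * of_real (e * c) - of_real (e\<^sup>2 * (k + c\<^sup>2 / 2)))
        = (exp u - (1 + u + u\<^sup>2 / 2)) + (u\<^sup>2 / 2 + of_real (e\<^sup>2 * (c\<^sup>2 / 2)))"
      unfolding damped_wave_def u_def[symmetric] by (simp add: u_def algebra_simps)
    also have "norm \<dots> \<le> exp B * B ^ 3 * \<bar>e\<bar> ^ 3 + (B\<^sup>2 + B\<^sup>2) * \<bar>e\<bar> ^ 3"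
      using t1 t2 by (rule norm_triangle_mono)
    finally show ?thesis by (simp add: algebra_simps)
  qed
  then show ?thesis unfolding third_order_def
    using B by (intro exI[of _ "exp B * B ^ 3 + B\<^sup>2 + B\<^sup>2"]) auto
qed

text \<open>A combination of exponentials is of third order when its Taylor coefficients of order 0, 1 and 2
  vanish; these are the three hypotheses.\<close>

lemma third_order_damped_wave_sum:
  fixes ws :: "(real \<times> real \<times> real) list"
  assumes "(\<Sum>(w, c, k)\<leftarrow>ws. w) = 0" "(\<Sum>(w, c, k)\<leftarrow>ws. w * c) = 0"
    "(\<Sum>(w, c, k)\<leftarrow>ws. w * (k + c\<^sup>2 / 2)) = 0"
  shows "third_order (\<lambda>e. \<Sum>(w, c, k)\<leftarrow>ws. of_real w * damped_wave c k e)"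
proof -
  define Q where "Q ws e = (\<Sum>(w, c, k)\<leftarrow>ws. of_real w * (1 + \<i> * of_real (e * c) - of_real (e\<^sup>2 * (k + c\<^sup>2 / 2))))"
    for ws :: "(real \<times> real \<times> real) list" and e :: real
  have Q: "Q ws e = of_real (\<Sum>(w, c, k)\<leftarrow>ws. w) + \<i> * of_real e * of_real (\<Sum>(w, c, k)\<leftarrow>ws. w * c)
      - of_real (e\<^sup>2) * of_real (\<Sum>(w, c, k)\<leftarrow>ws. w * (k + c\<^sup>2 / 2))" for ws e
    unfolding Q_def by (induction ws) (auto simp: algebra_simps)
  have "third_order (\<lambda>e. (\<Sum>(w, c, k)\<leftarrow>ws. of_real w * damped_wave c k e) - Q ws e)" for ws
  proof (induction ws)
    case Nil
    show ?case by (auto simp: third_order_def Q_def)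
  next
    case (Cons t ws)
    obtain w c k where t: "t = (w, c, k)" by (cases t)
    have "(\<lambda>e. (\<Sum>(w, c, k)\<leftarrow>t # ws. of_real w * damped_wave c k e) - Q (t # ws) e)
      = (\<lambda>e. of_real w * (damped_wave c k e - (1 + \<i> * of_real (e * c) - of_real (e\<^sup>2 * (k + c\<^sup>2 / 2))))
          + ((\<Sum>(w, c, k)\<leftarrow>ws. of_real w * damped_wave c k e) - Q ws e))"
      by (simp add: t Q_def algebra_simps)
    then show ?case
      by (simp only:) (intro third_order_add third_order_cmult damped_wave_taylor Cons.IH)
  qed
  from this[of ws] show ?thesis using assms by (simp only: Q of_real_0 mult_zero_right add_0_left diff_zero)
qed

text \<open>The coefficients are the variances per step of \<open>num_terms\<close> and \<open>num_excess\<close>.\<close>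

definition limit_variance :: "real \<Rightarrow> real \<Rightarrow> real" where
  "limit_variance a d = 2 * sqrt 5 / 125 * a\<^sup>2 + (sqrt 5 - 1) / 10 * d\<^sup>2"

lemma limit_variance_nonneg: "limit_variance a d \<ge> 0"
  by (simp add: limit_variance_def)

text \<open>The dominant characteristic root of the perturbed recursion, up to third order in \<open>e\<close>.\<close>

definition approx_root :: "real \<Rightarrow> real \<Rightarrow> real \<Rightarrow> complex" where
  "approx_root a d e = of_real golden_ratio * damped_wave (a / 5) (limit_variance a d / 2) e"

text \<open>The determinant of the linear system which decides whether geometric sequences with ratio \<open>l\<close> solve
  the pair of coupled recursions with coefficients \<open>x\<close> and \<open>y\<close>.\<close>

definition char_residual :: "real \<Rightarrow> real \<Rightarrow> real \<Rightarrow> complex" where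
  "char_residual a d e = (let l = approx_root a d e; x = cis (e * (a + d)); y = cis (e * (a - d)) in
     (l ^ 4 - l ^ 3 - x) * (l ^ 4 - l ^ 3 - y) - x * y * l\<^sup>2)"

text \<open>Expanded, the residual is a combination of nine damped waves whose weights, frequencies and dampings
  are explicit.  The moment conditions are identities in the field of the golden ratio; the last one
  is what fixes the coefficients of \<open>limit_variance\<close>.\<close>

lemma char_residual_third_order: "third_order (char_residual a d)"
proof -
  let ?g = golden_ratio
  define v where "v = limit_variance a d"
  define ws where "ws = [(?g ^ 8, 8 * (a / 5), 8 * (v / 2)), (- 2 * ?g ^ 7, 7 * (a / 5), 7 * (v / 2)),
    (?g ^ 6, 6 * (a / 5), 6 * (v / 2)),
    (- (?g ^ 4), 4 * (a / 5) + (a + d), 4 * (v / 2)), (- (?g ^ 4), 4 * (a / 5) + (a - d), 4 * (v / 2)),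
    (?g ^ 3, 3 * (a / 5) + (a + d), 3 * (v / 2)), (?g ^ 3, 3 * (a / 5) + (a - d), 3 * (v / 2)),
    (1, (a + d) + (a - d), 0), (- (?g ^ 2), (a + d) + (a - d) + 2 * (a / 5), 2 * (v / 2))]"
  have p6: "?g ^ 6 = 8 * ?g + 5"
  proof -
    have "?g ^ 6 = (?g ^ 3)\<^sup>2" by (simp flip: power_mult)
    then show ?thesis unfolding golden_ratio_cube using golden_ratio_square
      by (simp add: power2_eq_square algebra_simps)
  qed
  have gg: "?g * ?g = ?g + 1" using golden_ratio_square by (simp add: power2_eq_square)
  have p7: "?g ^ 7 = 13 * ?g + 8"
  proof -
    have "?g ^ 7 = ?g ^ 6 * ?g" by (simp add: eval_nat_numeral)
    then show ?thesis unfolding p6 using gg by (simp add: algebra_simps)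
  qed
  have p8: "?g ^ 8 = 21 * ?g + 13"
  proof -
    have "?g ^ 8 = ?g ^ 7 * ?g" by (simp add: eval_nat_numeral)
    then show ?thesis unfolding p7 using gg by (simp add: algebra_simps)
  qed
  note pows = p6 p7 p8 golden_ratio_cube golden_ratio_fourth golden_ratio_square
  have v: "v = (4 * ?g - 2) / 125 * a\<^sup>2 + (?g - 1) / 5 * d\<^sup>2"
    by (simp add: v_def limit_variance_def sqrt5_golden_ratio)
  have s0: "(\<Sum>(w, c, k)\<leftarrow>ws. w) = 0"
    unfolding ws_def by (simp add: pows)
  have s1: "(\<Sum>(w, c, k)\<leftarrow>ws. w * c) = 0"
    unfolding ws_def by (simp add: pows) (simp add: algebra_simps add_divide_distrib diff_divide_distrib)
  have s2: "(\<Sum>(w, c, k)\<leftarrow>ws. w * (k + c\<^sup>2 / 2)) = 0"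
  proof -
    have "(\<Sum>(w, c, k)\<leftarrow>ws. w * (k + c\<^sup>2 / 2))
        = v * (10 * ?g + 5) - a\<^sup>2 * ((8 * ?g + 6) / 25) - d\<^sup>2 * (?g + 1)"
      unfolding ws_def by (simp add: pows)
        (simp add: power2_eq_square algebra_simps add_divide_distrib diff_divide_distrib)
    also have "\<dots> = 0"
    proof -
      have "v * (10 * ?g + 5) = a\<^sup>2 * ((4 * ?g - 2) * (10 * ?g + 5) / 125) + d\<^sup>2 * ((?g - 1) * (10 * ?g + 5) / 5)"
        unfolding v by (simp add: algebra_simps)
      also have "(4 * ?g - 2) * (10 * ?g + 5) / 125 = (8 * ?g + 6) / 25"
        using gg by (simp add: algebra_simps)
      also have "(?g - 1) * (10 * ?g + 5) / 5 = ?g + 1"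
        using gg by (simp add: algebra_simps)
      finally show ?thesis by simp
    qed
    finally show ?thesis .
  qed
  have "char_residual a d = (\<lambda>e. \<Sum>(w, c, k)\<leftarrow>ws. of_real w * damped_wave c k e)"
  proof
    fix e
    define X Y Z where "X = damped_wave (a + d) 0 e" and "Y = damped_wave (a - d) 0 e" and "Z = damped_wave (a / 5) (v / 2) e"
    define g :: complex where "g = of_real ?g"
    have 1: "(\<Sum>(w, c, k)\<leftarrow>ws. of_real w * damped_wave c k e)
      = g ^ 8 * Z ^ 8 - 2 * g ^ 7 * Z ^ 7 + g ^ 6 * Z ^ 6 - g ^ 4 * (Z ^ 4 * X) - g ^ 4 * (Z ^ 4 * Y)
        + g ^ 3 * (Z ^ 3 * X) + g ^ 3 * (Z ^ 3 * Y) + X * Y - g\<^sup>2 * (X * Y * Z\<^sup>2)"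
      unfolding X_def Y_def Z_def damped_wave_power damped_wave_mult ws_def g_def by simp
    have 2: "char_residual a d e = ((g * Z) ^ 4 - (g * Z) ^ 3 - X) * ((g * Z) ^ 4 - (g * Z) ^ 3 - Y) - X * Y * (g * Z)\<^sup>2"
      unfolding char_residual_def Let_def approx_root_def v_def[symmetric] damped_wave_cis[symmetric]
        X_def[symmetric] Y_def[symmetric] Z_def[symmetric] g_def[symmetric] ..
    show "char_residual a d e = (\<Sum>(w, c, k)\<leftarrow>ws. of_real w * damped_wave c k e)"
      unfolding 1 2 by (simp add: algebra_simps eval_nat_numeral)
  qed
  then show ?thesis using third_order_damped_wave_sum[OF s0 s1 s2] by simp
qed


text \<open>Since the coefficient has modulus one, norms obey the recursion of the unperturbed problem.\<close>

lemma norm_char_sum_gap_rec: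
  fixes X Y :: "nat \<Rightarrow> complex"
  assumes "norm x = 1"
    and "X (n + 4) = X (n + 3) + x * (Y (n + 1) + X n) + r"
  shows "norm (X (n + 4)) \<le> norm (X (n + 3)) + norm (Y (n + 1)) + norm (X n) + norm r"
proof -
  have "norm (X (n + 4)) \<le> norm (X (n + 3)) + norm (x * (Y (n + 1) + X n)) + norm r"
    unfolding assms(2) using norm_triangle_ineq[of "X (n + 3) + x * (Y (n + 1) + X n)" r]
      norm_triangle_ineq[of "X (n + 3)" "x * (Y (n + 1) + X n)"] by linarith
  also have "norm (x * (Y (n + 1) + X n)) \<le> norm (Y (n + 1)) + norm (X n)"
    using assms(1) norm_triangle_ineq[of "Y (n + 1)" "X n"] by (simp add: norm_mult)
  finally show ?thesis by simp
qed

text \<open>Given the approximate root \<open>l\<close>, the amplitudes \<open>x l\<close> here and \<open>l^4 - l^3 - x\<close> below satisfy the first of the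
  two coupled recursions exactly, and the second up to the residual.  At \<open>e = 0\<close> both equal the golden
  ratio, so the factor \<open>1 / 5\<close> matches the size \<open>golden_ratio^(n + 1) / 5\<close> of the block.\<close>

definition char_model :: "real \<Rightarrow> real \<Rightarrow> real \<Rightarrow> nat \<Rightarrow> complex" where
  "char_model a d e n = (1 / 5) * cis (e * (a + d)) * approx_root a d e ^ (n + 1)"

definition char_model' :: "real \<Rightarrow> real \<Rightarrow> real \<Rightarrow> nat \<Rightarrow> complex" where
  "char_model' a d e n = (1 / 5) *
     (approx_root a d e ^ 4 - approx_root a d e ^ 3 - cis (e * (a + d))) * approx_root a d e ^ n"

text \<open>The sum of both errors is used because each recursion feeds on the other sequence.\<close>

definition gap :: "real \<Rightarrow> real \<Rightarrow> real \<Rightarrow> nat \<Rightarrow> real" where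
  "gap a d e n = norm (char_sum (e * a) (e * d) n - char_model a d e n)
     + norm (char_sum (e * a) (- (e * d)) n - char_model' a d e n)"

lemma norm_approx_root: "norm (approx_root a d e) \<le> golden_ratio"
  using limit_variance_nonneg[of a d]
  by (simp add: approx_root_def norm_mult norm_damped_wave mult_left_le)

lemma gap_rec:
  "gap a d e (n + 4) \<le> gap a d e (n + 3) + gap a d e (n + 1) + gap a d e n
     + norm (char_residual a d e) * golden_ratio ^ n"
proof -
  define l x y where "l = approx_root a d e" and "x = cis (e * (a + d))" and "y = cis (e * (a - d))"
  define X Y where "X n = char_sum (e * a) (e * d) n - char_model a d e n"
    and "Y n = char_sum (e * a) (- (e * d)) n - char_model' a d e n" for n
  have "X (n + 4) = X (n + 3) + x * (Y (n + 1) + X n) + 0"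
  proof -
    have "char_model a d e (n + 4) = char_model a d e (n + 3) + x * (char_model' a d e (n + 1) + char_model a d e n)"
      unfolding char_model_def char_model'_def l_def[symmetric] x_def[symmetric]
      by (simp add: algebra_simps eval_nat_numeral)
    moreover have "char_sum (e * a) (e * d) (n + 4) = char_sum (e * a) (e * d) (n + 3)
        + x * (char_sum (e * a) (- (e * d)) (n + 1) + char_sum (e * a) (e * d) n)"
      using char_sum_rec[of "e * a" "e * d" n] by (simp add: x_def distrib_left)
    ultimately show ?thesis by (simp add: X_def Y_def algebra_simps)
  qed
  then have 1: "norm (X (n + 4)) \<le> norm (X (n + 3)) + norm (Y (n + 1)) + norm (X n) + norm (0 :: complex)"
    by (intro norm_char_sum_gap_rec) (auto simp: x_def)
  define r where "r = - (1 / 5) * char_residual a d e * l ^ n"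
  have "Y (n + 4) = Y (n + 3) + y * (X (n + 1) + Y n) + r"
  proof -
    have "char_model' a d e (n + 4) = char_model' a d e (n + 3) + y * (char_model a d e (n + 1) + char_model' a d e n) - r"
      unfolding char_model_def char_model'_def r_def char_residual_def Let_def
        l_def[symmetric] x_def[symmetric] y_def[symmetric]
      by (simp add: algebra_simps eval_nat_numeral)
    moreover have "char_sum (e * a) (- (e * d)) (n + 4) = char_sum (e * a) (- (e * d)) (n + 3)
        + y * (char_sum (e * a) (e * d) (n + 1) + char_sum (e * a) (- (e * d)) n)"
      using char_sum_rec[of "e * a" "- (e * d)" n] by (simp add: y_def right_diff_distrib)
    ultimately show ?thesis by (simp add: X_def Y_def algebra_simps)
  qed
  then have 2: "norm (Y (n + 4)) \<le> norm (Y (n + 3)) + norm (X (n + 1)) + norm (Y n) + norm r"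
    by (intro norm_char_sum_gap_rec) (auto simp: y_def)
  have "norm r = 1 / 5 * norm (char_residual a d e) * norm l ^ n"
    by (simp add: r_def norm_mult norm_power)
  also have "\<dots> \<le> 1 * norm (char_residual a d e) * golden_ratio ^ n"
    unfolding l_def by (intro mult_mono power_mono norm_approx_root) auto
  finally have "norm r \<le> norm (char_residual a d e) * golden_ratio ^ n" by simp
  then show ?thesis
    using 1 2 unfolding gap_def X_def[symmetric] Y_def[symmetric] by simp
qed

text \<open>Starting the comparison at an arbitrary index \<open>m\<close> is essential: the recursion does not damp the initial
  error, so this error has to be small relative to the power of the golden ratio already at the start.\<close>

lemma gap_bound:
  "gap a d e (m + i) \<le> ((\<Sum>j<4. gap a d e (m + j)) + real i * (norm (char_residual a d e) * golden_ratio ^ m)) * golden_ratio ^ i"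
proof (rule weighted_recursion_bound)
  show "gap a d e (m + (n + 4)) \<le> gap a d e (m + (n + 3)) + gap a d e (m + (n + 1)) + gap a d e (m + n)
      + norm (char_residual a d e) * golden_ratio ^ m * golden_ratio ^ n" for n
    using gap_rec[of a d e "m + n"] by (simp add: power_add add.assoc mult.assoc)
  show "gap a d e (m + i) \<le> (\<Sum>j<4. gap a d e (m + j)) * golden_ratio ^ i" if "i < 4" for i
  proof -
    have nonneg: "gap a d e j \<ge> 0" for j by (simp add: gap_def)
    have "gap a d e (m + i) \<le> (\<Sum>j<4. gap a d e (m + j)) * 1"
      using that nonneg member_le_sum[of i "{..<4}" "\<lambda>j. gap a d e (m + j)"] by simp
    also have "\<dots> \<le> (\<Sum>j<4. gap a d e (m + j)) * golden_ratio ^ i"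
      using golden_ratio_bounds nonneg by (intro mult_left_mono one_le_power sum_nonneg) auto
    finally show ?thesis .
  qed
qed auto

lemma approx_root_tendsto:
  assumes "e \<longlonglongrightarrow> 0"
  shows "(\<lambda>k. approx_root a d (e k)) \<longlonglongrightarrow> of_real golden_ratio"
proof -
  have "(\<lambda>k. approx_root a d (e k)) \<longlonglongrightarrow>
      of_real golden_ratio * exp (\<i> * of_real (0 * (a / 5)) - of_real (0\<^sup>2 * (limit_variance a d / 2)))"
    unfolding approx_root_def damped_wave_def by (intro tendsto_intros assms)
  then show ?thesis by simp
qed

lemma gap_tendsto:
  assumes "e \<longlonglongrightarrow> 0"
  shows "(\<lambda>k. gap a d (e k) n) \<longlonglongrightarrow> 2 * \<bar>block_count n - golden_ratio / 5 * golden_ratio ^ n\<bar>"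
proof -
  let ?g = "of_real golden_ratio :: complex"
  let ?y = "of_real (block_count n - golden_ratio / 5 * golden_ratio ^ n) :: complex"
  have g2: "?g ^ 4 - ?g ^ 3 - 1 = ?g"
    unfolding of_real_power[symmetric] golden_ratio_cube golden_ratio_fourth by simp
  have cis0: "(\<lambda>k. cis (e k * (a + d))) \<longlonglongrightarrow> cis (0 * (a + d))"
    by (intro tendsto_intros assms)
  have "(\<lambda>k. gap a d (e k) n) \<longlonglongrightarrow>
      norm (of_real (block_count n) - (1 / 5) * cis (0 * (a + d)) * ?g ^ (n + 1))
      + norm (of_real (block_count n) - (1 / 5) * (?g ^ 4 - ?g ^ 3 - cis (0 * (a + d))) * ?g ^ n)"
    unfolding gap_def char_model_def char_model'_def mult_minus_right[symmetric]
    by (intro tendsto_intros char_sum_tendsto_count[OF assms] approx_root_tendsto[OF assms] cis0)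
  also have "of_real (block_count n) - (1 / 5) * cis (0 * (a + d)) * ?g ^ (n + 1) = ?y" by simp
  also have "of_real (block_count n) - (1 / 5) * (?g ^ 4 - ?g ^ 3 - cis (0 * (a + d))) * ?g ^ n = ?y"
    using g2 by simp
  finally show ?thesis unfolding norm_of_real by simp
qed

text \<open>Choose \<open>m\<close> so large that the unperturbed sums have settled on their dominant part, then let \<open>n\<close> tend
  to infinity for fixed \<open>m\<close>.  The initial error tends to that of the unperturbed problem, and the
  accumulated residual is of order \<open>n e^3 = 1 / sqrt n\<close>.\<close>

lemma char_sum_near_model:
  fixes a d :: real
  defines "e \<equiv> \<lambda>n. 1 / sqrt (real n)"
  shows "(\<lambda>n. gap a d (e n) n / golden_ratio ^ n) \<longlonglongrightarrow> 0"
proof (rule LIMSEQ_I)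
  fix \<delta> :: real assume \<delta>: "\<delta> > 0"
  have e0: "e \<longlonglongrightarrow> 0" unfolding e_def by real_asymp
  obtain C where C: "C \<ge> 0" "\<And>t. \<bar>t\<bar> \<le> 1 \<Longrightarrow> norm (char_residual a d t) \<le> C * \<bar>t\<bar> ^ 3"
    using char_residual_third_order unfolding third_order_def by blast
  define D where "D m = 2 * \<bar>block_count m - golden_ratio / 5 * golden_ratio ^ m\<bar>" for m
  have "(\<lambda>m. \<Sum>j<4. 2 * golden_ratio ^ j * \<bar>(block_count (m + j) - golden_ratio / 5 * golden_ratio ^ (m + j)) / golden_ratio ^ (m + j)\<bar>)
      \<longlonglongrightarrow> (\<Sum>j<4. 2 * golden_ratio ^ j * \<bar>0\<bar>)"
    using LIMSEQ_ignore_initial_segment[OF poly_small_tendsto_0[OF near_block_count[unfolded near_def], of 0]]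
    by (intro tendsto_intros) simp
  also have "(\<lambda>m. \<Sum>j<4. 2 * golden_ratio ^ j * \<bar>(block_count (m + j) - golden_ratio / 5 * golden_ratio ^ (m + j)) / golden_ratio ^ (m + j)\<bar>)
      = (\<lambda>m. (\<Sum>j<4. D (m + j)) / golden_ratio ^ m)"
    unfolding sum_divide_distrib by (intro ext sum.cong) (auto simp: D_def abs_divide power_add)
  finally have "(\<lambda>m. (\<Sum>j<4. D (m + j)) / golden_ratio ^ m) \<longlonglongrightarrow> 0" by simp
  then have "eventually (\<lambda>m. (\<Sum>j<4. D (m + j)) / golden_ratio ^ m < \<delta> / 2) sequentially"
    using \<delta> by (intro order_tendstoD(2)) auto
  then obtain m where m: "(\<Sum>j<4. D (m + j)) / golden_ratio ^ m < \<delta> / 2"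
    by (auto simp: eventually_sequentially)
  have "(\<lambda>n. (\<Sum>j<4. gap a d (e n) (m + j)) / golden_ratio ^ m + real n * (C * \<bar>e n\<bar> ^ 3))
      \<longlonglongrightarrow> (\<Sum>j<4. D (m + j)) / golden_ratio ^ m + 0"
  proof (intro tendsto_add tendsto_divide tendsto_sum tendsto_const)
    show "(\<lambda>n. gap a d (e n) (m + j)) \<longlonglongrightarrow> D (m + j)" for j
      unfolding D_def by (rule gap_tendsto[OF e0])
    have "(\<lambda>n. real n * \<bar>e n\<bar> ^ 3) \<longlonglongrightarrow> 0" unfolding e_def by real_asymp
    then have "(\<lambda>n. C * (real n * \<bar>e n\<bar> ^ 3)) \<longlonglongrightarrow> 0" by (rule tendsto_mult_right_zero)
    then show "(\<lambda>n. real n * (C * \<bar>e n\<bar> ^ 3)) \<longlonglongrightarrow> 0" by (simp add: mult.left_commute)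
  qed auto
  moreover have "(\<Sum>j<4. D (m + j)) / golden_ratio ^ m + 0 < \<delta>" using m \<delta> by linarith
  ultimately have "eventually (\<lambda>n. (\<Sum>j<4. gap a d (e n) (m + j)) / golden_ratio ^ m + real n * (C * \<bar>e n\<bar> ^ 3) < \<delta>) sequentially"
    by (rule order_tendstoD(2))
  then have "eventually (\<lambda>n. norm (gap a d (e n) n / golden_ratio ^ n - 0) < \<delta>) sequentially"
    using eventually_ge_at_top[of "max m 1"]
  proof eventually_elim
    case (elim n)
    define i where "i = n - m"
    have n: "n = m + i" "i \<le> n" using elim by (simp_all add: i_def)
    have en: "\<bar>e n\<bar> \<le> 1" using elim by (simp add: e_def)
    have "gap a d (e n) n \<le> ((\<Sum>j<4. gap a d (e n) (m + j)) + real i * (norm (char_residual a d (e n)) * golden_ratio ^ m)) * golden_ratio ^ i"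
      unfolding n(1) by (rule gap_bound)
    then have "gap a d (e n) n / golden_ratio ^ n \<le> ((\<Sum>j<4. gap a d (e n) (m + j)) + real i * (norm (char_residual a d (e n)) * golden_ratio ^ m)) * golden_ratio ^ i / golden_ratio ^ n"
      by (rule divide_right_mono) simp
    also have "\<dots> = (\<Sum>j<4. gap a d (e n) (m + j)) / golden_ratio ^ m + real i * norm (char_residual a d (e n))"
      unfolding n(1) by (simp add: power_add add_divide_distrib distrib_right)
    also have "\<dots> \<le> (\<Sum>j<4. gap a d (e n) (m + j)) / golden_ratio ^ m + real n * (C * \<bar>e n\<bar> ^ 3)"
      using C(2)[OF en] n(2) by (intro add_left_mono mult_mono) auto
    also have "\<dots> < \<delta>" using elim by simp
    finally show ?case by (simp add: gap_def)
  qed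
  then show "\<exists>no. \<forall>n\<ge>no. norm (gap a d (e n) n / golden_ratio ^ n - 0) < \<delta>"
    by (simp add: eventually_sequentially)
qed

text \<open>The model is explicit: \<open>n e = sqrt n\<close> produces the drift, which the first factor cancels, and
  \<open>n e^2 = 1\<close> the Gaussian factor.\<close>

theorem char_sum_central_limit:
  "(\<lambda>n. cis (- (a * sqrt (real n) / 5)) * char_sum (a / sqrt (real n)) (d / sqrt (real n)) n / of_real (block_count n))
     \<longlonglongrightarrow> of_real (exp (- limit_variance a d / 2))"
proof -
  define e where "e n = 1 / sqrt (real n)" for n
  define v where "v = limit_variance a d"
  define w where "w n = cis (- (a * sqrt (real n) / 5))" for n
  let ?g = "of_real golden_ratio :: complex"
  have e0: "e \<longlonglongrightarrow> 0" unfolding e_def by real_asymp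
  have "(\<lambda>n. w n * (char_sum (e n * a) (e n * d) n - char_model a d (e n) n) / ?g ^ n) \<longlonglongrightarrow> 0"
  proof (rule Lim_null_comparison)
    show "(\<lambda>n. gap a d (e n) n / golden_ratio ^ n) \<longlonglongrightarrow> 0"
      unfolding e_def by (rule char_sum_near_model)
    show "\<forall>\<^sub>F n in sequentially. norm (w n * (char_sum (e n * a) (e n * d) n - char_model a d (e n) n) / ?g ^ n)
        \<le> gap a d (e n) n / golden_ratio ^ n"
      by (intro always_eventually allI)
        (simp add: w_def gap_def norm_mult norm_divide norm_power divide_right_mono)
  qed
  moreover have "(\<lambda>n. w n * char_model a d (e n) n / ?g ^ n) \<longlonglongrightarrow> ?g / 5 * of_real (exp (- v / 2))"
  proof (rule Lim_transform_eventually)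
    have "(\<lambda>n. (1 / 5) * cis (e n * (a + d)) * approx_root a d (e n) * of_real (exp (- v / 2)))
        \<longlonglongrightarrow> (1 / 5) * cis (0 * (a + d)) * ?g * of_real (exp (- v / 2))"
      by (intro tendsto_intros e0 approx_root_tendsto[OF e0])
    then show "(\<lambda>n. (1 / 5) * cis (e n * (a + d)) * approx_root a d (e n) * of_real (exp (- v / 2)))
        \<longlonglongrightarrow> ?g / 5 * of_real (exp (- v / 2))" by simp
    show "\<forall>\<^sub>F n in sequentially. (1 / 5) * cis (e n * (a + d)) * approx_root a d (e n) * of_real (exp (- v / 2))
        = w n * char_model a d (e n) n / ?g ^ n"
    proof (rule eventually_sequentiallyI[of 1])
      fix n :: nat assume n: "n \<ge> 1"
      have ne: "real n * (e n * (a / 5)) = a * sqrt (real n) / 5" "real n * ((e n)\<^sup>2 * (v / 2)) = v / 2"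
        using n by (simp_all add: e_def power_divide real_div_sqrt field_simps)
      have "damped_wave (a / 5) (v / 2) (e n) ^ n = exp (\<i> * of_real (real n * (e n * (a / 5))) - of_real (real n * ((e n)\<^sup>2 * (v / 2))))"
        unfolding damped_wave_def exp_of_nat_mult[symmetric] by (simp add: algebra_simps)
      also have "\<dots> = cis (a * sqrt (real n) / 5) * of_real (exp (- v / 2))"
      proof -
        have "\<i> * of_real (a * sqrt (real n) / 5) - of_real (v / 2)
            = \<i> * complex_of_real (a * sqrt (real n) / 5) + of_real (- v / 2)" by simp
        then show ?thesis unfolding ne cis_conv_exp exp_of_real[symmetric] exp_add[symmetric] by (simp only:)
      qed
      finally have wave_eq: "damped_wave (a / 5) (v / 2) (e n) ^ n = cis (a * sqrt (real n) / 5) * of_real (exp (- v / 2))" .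
      have "w n * approx_root a d (e n) ^ n = ?g ^ n * of_real (exp (- v / 2))"
        unfolding approx_root_def v_def[symmetric] power_mult_distrib w_def proof -
        have "cis (- (a * sqrt (real n) / 5)) * cis (a * sqrt (real n) / 5) = 1" by (simp add: cis_mult)
        then show "cis (- (a * sqrt (real n) / 5)) * (?g ^ n * damped_wave (a / 5) (v / 2) (e n) ^ n) = ?g ^ n * of_real (exp (- v / 2))"
          unfolding wave_eq by (simp add: algebra_simps flip: mult.assoc[of _ "cis _"])
      qed
      then have "w n * char_model a d (e n) n = (1 / 5) * cis (e n * (a + d)) * approx_root a d (e n) * (?g ^ n * of_real (exp (- v / 2)))"
        unfolding char_model_def by (simp add: mult_ac)
      then show "(1 / 5) * cis (e n * (a + d)) * approx_root a d (e n) * of_real (exp (- v / 2))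
          = w n * char_model a d (e n) n / ?g ^ n" by simp
    qed
  qed
  ultimately have "(\<lambda>n. w n * (char_sum (e n * a) (e n * d) n - char_model a d (e n) n) / ?g ^ n
      + w n * char_model a d (e n) n / ?g ^ n) \<longlonglongrightarrow> 0 + ?g / 5 * of_real (exp (- v / 2))"
    by (rule tendsto_add)
  then have "(\<lambda>n. w n * char_sum (e n * a) (e n * d) n / ?g ^ n) \<longlonglongrightarrow> ?g / 5 * of_real (exp (- v / 2))"
    by (simp add: right_diff_distrib diff_divide_distrib)
  moreover have "(\<lambda>n. of_real (block_count n / golden_ratio ^ n) :: complex) \<longlonglongrightarrow> of_real (golden_ratio / 5)"
    by (intro tendsto_of_real block_count_asymp)
  ultimately have "(\<lambda>n. (w n * char_sum (e n * a) (e n * d) n / ?g ^ n) / of_real (block_count n / golden_ratio ^ n))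
      \<longlonglongrightarrow> (?g / 5 * of_real (exp (- v / 2))) / of_real (golden_ratio / 5)"
    by (rule tendsto_divide) simp
  then show ?thesis
    by (simp add: w_def e_def v_def)
qed

section \<open>A continuity theorem for characteristic functions in the plane\<close>

text \<open>Real waves with a phase suffice: they include sines and constants, and products of two of them are
  again sums of two.\<close>

inductive_set trig_poly :: "(real \<times> real \<Rightarrow> real) set" where
  wave: "(\<lambda>z. c * cos (a * fst z + b * snd z + d)) \<in> trig_poly"
| add: "f \<in> trig_poly \<Longrightarrow> g \<in> trig_poly \<Longrightarrow> (\<lambda>z. f z + g z) \<in> trig_poly"

lemma trig_poly_mult:
  assumes "f \<in> trig_poly" "g \<in> trig_poly"
  shows "(\<lambda>z. f z * g z) \<in> trig_poly"
  using assms
proof (induction f rule: trig_poly.induct)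
  case (wave c a b d)
  from wave.prems show ?case
  proof (induction g rule: trig_poly.induct)
    case (wave c' a' b' d')
    have "(\<lambda>z. (c * cos (a * fst z + b * snd z + d)) * (c' * cos (a' * fst z + b' * snd z + d')))
        = (\<lambda>z. (c * c' / 2) * cos ((a - a') * fst z + (b - b') * snd z + (d - d'))
             + (c * c' / 2) * cos ((a + a') * fst z + (b + b') * snd z + (d + d')))" (is "?l = ?r")
    proof
      fix z :: "real \<times> real"
      define u v where "u = a * fst z + b * snd z + d" and "v = a' * fst z + b' * snd z + d'"
      have uv: "(a - a') * fst z + (b - b') * snd z + (d - d') = u - v"
           "(a + a') * fst z + (b + b') * snd z + (d + d') = u + v"
        by (simp_all add: u_def v_def algebra_simps)
      have "c * cos u * (c' * cos v) = c * c' * (cos u * cos v)" by simp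
      also have "\<dots> = c * c' / 2 * cos (u - v) + c * c' / 2 * cos (u + v)"
        unfolding cos_times_cos by (simp add: distrib_left add_divide_distrib)
      finally show "?l z = ?r z"
        unfolding uv u_def[symmetric] v_def[symmetric] .
    qed
    then show ?case by (simp only:) (intro trig_poly.intros)
  next
    case (add f g)
    then show ?case by (simp only: distrib_left) (rule trig_poly.add)
  qed
next
  case (add f1 f2)
  then show ?case by (simp only: distrib_right) (rule trig_poly.add, auto)
qed

lemma trig_poly_const: "(\<lambda>_. c) \<in> trig_poly"
  using trig_poly.wave[of c 0 0 0] by simp

lemma trig_poly_sin_fst: "(\<lambda>z. sin (a * fst z)) \<in> trig_poly"
  using trig_poly.wave[of 1 a 0 "- pi / 2"] by (simp add: cos_diff)

lemma trig_poly_sin_snd: "(\<lambda>z. sin (a * snd z)) \<in> trig_poly"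
  using trig_poly.wave[of 1 0 a "- pi / 2"] by (simp add: cos_diff)

text \<open>For large \<open>L\<close> this map is close to the identity near the origin; its values stay in a compact
  square, and it turns polynomials into trigonometric polynomials.\<close>

definition sine_wrap :: "real \<Rightarrow> real \<times> real \<Rightarrow> real \<times> real" where
  "sine_wrap L z = (L * sin (fst z / L), L * sin (snd z / L))"

lemma polynomial_sine_wrap_trig_poly:
  assumes "real_polynomial_function g"
  shows "(\<lambda>z. g (sine_wrap L z)) \<in> trig_poly"
  using assms
proof (induction g rule: real_polynomial_function.induct)
  case (linear f)
  interpret bounded_linear f by fact
  have "f (sine_wrap L z) = (L * f (1, 0)) * sin ((1 / L) * fst z) + (L * f (0, 1)) * sin ((1 / L) * snd z)" for z
  proof -
    have "sine_wrap L z = (L * sin (fst z / L)) *\<^sub>R (1, 0) + (L * sin (snd z / L)) *\<^sub>R (0, 1)"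
      by (simp add: sine_wrap_def)
    then show ?thesis by (simp only: add scaleR) (simp add: mult_ac)
  qed
  then show ?case
    by (simp only:) (intro trig_poly.add trig_poly_mult trig_poly_const trig_poly_sin_fst trig_poly_sin_snd)
next
  case (const c)
  show ?case by (rule trig_poly_const)
next
  case (add f g)
  then show ?case by (intro trig_poly.add)
next
  case (mult f g)
  then show ?case by (intro trig_poly_mult)
qed

lemma abs_sin_diff_le: "\<bar>sin x - x\<bar> \<le> \<bar>x\<bar> ^ 2 / 2" for x :: real
proof -
  have "norm (sin (of_real x :: real) - (\<Sum>k\<le>1. sin_coeff k * x ^ k)) \<le> inverse (fact 2) * \<bar>x\<bar> ^ 2"
    using Maclaurin_sin_bound[of x 2] by (simp add: numeral_2_eq_2 lessThan_Suc_atMost)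
  then show ?thesis by (simp add: sin_coeff_def numeral_2_eq_2)
qed

lemma sine_wrap_close:
  assumes "L > 0" "\<bar>fst z\<bar> \<le> A" "\<bar>snd z\<bar> \<le> A"
  shows "dist (sine_wrap L z) z \<le> A\<^sup>2 / L"
proof -
  have one: "\<bar>L * sin (x / L) - x\<bar> \<le> A\<^sup>2 / (2 * L)" if "\<bar>x\<bar> \<le> A" for x
  proof -
    have "\<bar>L * sin (x / L) - x\<bar> = L * \<bar>sin (x / L) - x / L\<bar>"
    proof -
      have "L * sin (x / L) - x = L * (sin (x / L) - x / L)"
        using assms(1) by (simp add: field_simps)
      then show ?thesis using assms(1) by (simp add: abs_mult)
    qed
    also have "\<dots> \<le> L * (\<bar>x / L\<bar>\<^sup>2 / 2)"
      using assms(1) abs_sin_diff_le[of "x / L"] by (intro mult_left_mono) auto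
    also have "\<dots> = \<bar>x\<bar>\<^sup>2 / (2 * L)"
      using assms(1) by (simp add: power2_eq_square field_simps)
    also have "\<dots> \<le> A\<^sup>2 / (2 * L)"
      using assms(1) that by (intro divide_right_mono power_mono) auto
    finally show ?thesis .
  qed
  have "dist (sine_wrap L z) z \<le> \<bar>L * sin (fst z / L) - fst z\<bar> + \<bar>L * sin (snd z / L) - snd z\<bar>"
    unfolding sine_wrap_def dist_prod_def dist_real_def fst_conv snd_conv
    by (simp only: power2_abs sqrt_sum_squares_le_sum_abs)
  also have "\<dots> \<le> A\<^sup>2 / (2 * L) + A\<^sup>2 / (2 * L)"
    using assms by (intro add_mono one)
  finally show ?thesis by (simp add: field_simps)
qed

text \<open>Approximate \<open>f\<close> by a polynomial on the square of half side \<open>L\<close> and compose with \<open>sine_wrap L\<close>.  The composite is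
  controlled everywhere, since \<open>sine_wrap L\<close> never leaves that square, and \<open>L\<close> is so large that the wrapping
  moves the points of the inner square by less than the modulus of continuity of \<open>f\<close>.\<close>

lemma trig_poly_approximation:
  fixes f :: "real \<times> real \<Rightarrow> real"
  assumes f: "continuous_on UNIV f" and B: "\<And>z. \<bar>f z\<bar> \<le> B" and A: "A > 0" and e: "e > 0"
  obtains g where "g \<in> trig_poly"
    "\<And>z. \<bar>fst z\<bar> \<le> A \<Longrightarrow> \<bar>snd z\<bar> \<le> A \<Longrightarrow> \<bar>f z - g z\<bar> \<le> e" "\<And>z. \<bar>g z\<bar> \<le> B + e"
proof -
  define K where "K = {- A - 1..A + 1} \<times> {- A - 1..A + 1}"
  have "uniformly_continuous_on K f"
    unfolding K_def
    by (intro compact_uniformly_continuous continuous_on_subset[OF f] compact_Times) auto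
  then obtain d where d: "d > 0"
    and dK: "\<And>x y. x \<in> K \<Longrightarrow> y \<in> K \<Longrightarrow> dist y x < d \<Longrightarrow> dist (f y) (f x) < e / 2"
    unfolding uniformly_continuous_on_def using e by (metis half_gt_zero)
  (* Both A^2 / L <= 1, which keeps the wrapped points in K, and A^2 / L < d hold for this L. *)
  define L where "L = A\<^sup>2 + 2 * A\<^sup>2 / d"
  have L: "L > 0" using A d by (simp add: L_def add_pos_pos)
  have "A\<^sup>2 / L \<le> 1" using L A d by (simp add: L_def field_simps)
  have "A\<^sup>2 / L < d"
  proof -
    have "A\<^sup>2 < d * L" using A d by (simp add: L_def field_simps add_pos_pos)
    then show ?thesis using L by (simp add: field_simps)
  qed
  obtain g where g: "real_polynomial_function g"
    and gf: "\<And>z. z \<in> {- L..L} \<times> {- L..L} \<Longrightarrow> \<bar>f z - g z\<bar> < e / 2"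
    using Stone_Weierstrass_real_polynomial_function[of "{- L..L} \<times> {- L..L}" f "e / 2"] e
      continuous_on_subset[OF f] by (metis compact_Icc compact_Times half_gt_zero subset_UNIV)
  have in_box: "sine_wrap L z \<in> {- L..L} \<times> {- L..L}" for z
  proof -
    have "\<bar>L * sin t\<bar> \<le> L" for t
      using L abs_sin_le_one[of t] by (simp add: abs_mult mult_left_le)
    from this[of "fst z / L"] this[of "snd z / L"] show ?thesis
      by (auto simp: sine_wrap_def abs_le_iff)
  qed
  show ?thesis
  proof (rule that[of "\<lambda>z. g (sine_wrap L z)"])
    show "(\<lambda>z. g (sine_wrap L z)) \<in> trig_poly"
      using g by (rule polynomial_sine_wrap_trig_poly)
    show "\<bar>g (sine_wrap L z)\<bar> \<le> B + e" for z
      using gf[OF in_box[of z]] B[of "sine_wrap L z"] e by linarith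
    show "\<bar>f z - g (sine_wrap L z)\<bar> \<le> e" if z: "\<bar>fst z\<bar> \<le> A" "\<bar>snd z\<bar> \<le> A" for z
    proof -
      have dist: "dist (sine_wrap L z) z \<le> A\<^sup>2 / L" using L z by (rule sine_wrap_close)
      have "\<bar>fst (sine_wrap L z) - fst z\<bar> \<le> 1" "\<bar>snd (sine_wrap L z) - snd z\<bar> \<le> 1"
        using dist \<open>A\<^sup>2 / L \<le> 1\<close> dist_fst_le[of "sine_wrap L z" z] dist_snd_le[of "sine_wrap L z" z]
        by (auto simp: dist_real_def)
      then have "sine_wrap L z \<in> K" "z \<in> K"
        using z by (auto simp: K_def mem_Times_iff abs_le_iff)
      then have "\<bar>f (sine_wrap L z) - f z\<bar> < e / 2"
        using dK[of z "sine_wrap L z"] dist \<open>A\<^sup>2 / L < d\<close> by (auto simp: dist_real_def)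
      then show ?thesis using gf[OF in_box[of z]] by linarith
    qed
  qed
qed

definition plane_char :: "(real \<times> real) measure \<Rightarrow> real \<Rightarrow> real \<Rightarrow> complex" where
  "plane_char M s t = (CLINT z|M. iexp (s * fst z + t * snd z))"

lemma integral_trig_wave:
  fixes M :: "(real \<times> real) measure"
  assumes "prob_space M" "sets M = sets borel"
  shows "(\<integral>z. c * cos (a * fst z + b * snd z + d) \<partial>M) = Re (c * iexp d * plane_char M a b)"
    and "integrable M (\<lambda>z. c * cos (a * fst z + b * snd z + d))"
proof -
  interpret prob_space M by fact
  have [measurable_cong]: "sets M = sets (borel \<Otimes>\<^sub>M borel)"
    unfolding assms(2) borel_prod ..
  have int: "integrable M (\<lambda>z. iexp (a * fst z + b * snd z))"
    by (rule integrable_const_bound[of _ 1]) (auto simp: borel_prod[symmetric])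
  have int': "integrable M (\<lambda>z. c * iexp d * iexp (a * fst z + b * snd z))"
    using int by (rule integrable_mult_right)
  have eq: "c * cos (a * fst z + b * snd z + d) = Re (c * iexp d * iexp (a * fst z + b * snd z))" for z
  proof -
    have "c * iexp d * iexp (a * fst z + b * snd z) = c * iexp (a * fst z + b * snd z + d)"
      by (simp add: algebra_simps exp_add)
    also have "iexp (a * fst z + b * snd z + d) = cis (a * fst z + b * snd z + d)"
      by (simp only: cis_conv_exp)
    finally have "c * iexp d * iexp (a * fst z + b * snd z) = c * cis (a * fst z + b * snd z + d)" .
    then show ?thesis by (metis Re_complex_of_real mult_zero_left diff_zero cis.sel(1) times_complex.sel(1) Im_complex_of_real)
  qed
  show "integrable M (\<lambda>z. c * cos (a * fst z + b * snd z + d))"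
    unfolding eq using int' by (rule integrable_Re)
  show "(\<integral>z. c * cos (a * fst z + b * snd z + d) \<partial>M) = Re (c * iexp d * plane_char M a b)"
    unfolding eq plane_char_def using int int' by (subst integral_Re) auto
qed

lemma trig_poly_integrable:
  assumes "prob_space M" "sets M = sets borel" "g \<in> trig_poly"
  shows "integrable M g"
  using assms(3)
proof (induction rule: trig_poly.induct)
  case (wave c a b d)
  show ?case by (rule integral_trig_wave(2)[OF assms(1,2)])
next
  case (add f g)
  then show ?case by (intro Bochner_Integration.integrable_add)
qed

lemma trig_poly_integral_tendsto:
  assumes M: "\<And>n. prob_space (M n)" "\<And>n. sets (M n) = sets borel"
    and N: "prob_space N" "sets N = sets borel"
    and char: "\<And>s t. (\<lambda>n. plane_char (M n) s t) \<longlonglongrightarrow> plane_char N s t"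
    and g: "g \<in> trig_poly"
  shows "(\<lambda>n. \<integral>z. g z \<partial>M n) \<longlonglongrightarrow> (\<integral>z. g z \<partial>N)"
  using g
proof (induction rule: trig_poly.induct)
  case (wave c a b d)
  show ?case
    unfolding integral_trig_wave(1)[OF M] integral_trig_wave(1)[OF N]
    by (intro tendsto_intros char)
next
  case (add f g)
  then have "(\<lambda>n. (\<integral>z. f z \<partial>M n) + (\<integral>z. g z \<partial>M n)) \<longlonglongrightarrow> (\<integral>z. f z \<partial>N) + (\<integral>z. g z \<partial>N)"
    by (intro tendsto_add)
  then show ?case
    using add.hyps trig_poly_integrable[OF M] trig_poly_integrable[OF N] by simp
qed

lemma approx_integral_on_box:
  fixes f g :: "real \<times> real \<Rightarrow> real"
  assumes M: "prob_space M" "sets M = sets borel"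
    and f: "f \<in> borel_measurable borel" and B: "\<And>z. \<bar>f z\<bar> \<le> B"
    and g: "g \<in> borel_measurable borel" and gB: "\<And>z. \<bar>g z\<bar> \<le> C"
    and close: "\<And>z. \<bar>fst z\<bar> \<le> A \<Longrightarrow> \<bar>snd z\<bar> \<le> A \<Longrightarrow> \<bar>f z - g z\<bar> \<le> e" and "e \<ge> 0"
  shows "\<bar>(\<integral>z. f z \<partial>M) - (\<integral>z. g z \<partial>M)\<bar> \<le> e + (B + C) * measure M {z. \<bar>fst z\<bar> > A \<or> \<bar>snd z\<bar> > A}"
proof -
  interpret prob_space M by fact
  have [measurable]: "f \<in> borel_measurable M" "g \<in> borel_measurable M"
    using f g M(2) by (auto cong: measurable_cong_sets)
  let ?S = "{z::real \<times> real. \<bar>fst z\<bar> > A \<or> \<bar>snd z\<bar> > A}"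
  have "open ?S"
    by (intro open_Collect_disj open_Collect_less continuous_intros)
  then have S: "?S \<in> sets M" using M(2) by auto
  have intf: "integrable M f" by (rule integrable_const_bound[of _ B]) (use B in auto)
  have intg: "integrable M g" by (rule integrable_const_bound[of _ C]) (use gB in auto)
  have "\<bar>(\<integral>z. f z \<partial>M) - (\<integral>z. g z \<partial>M)\<bar> = \<bar>\<integral>z. f z - g z \<partial>M\<bar>"
    using intf intg by simp
  also have "\<dots> \<le> (\<integral>z. \<bar>f z - g z\<bar> \<partial>M)" by (rule integral_abs_bound)
  also have "\<dots> \<le> (\<integral>z. e + (B + C) * indicator ?S z \<partial>M)"
  proof (rule integral_mono)
    show "integrable M (\<lambda>z. \<bar>f z - g z\<bar>)" using intf intg by auto
    show "integrable M (\<lambda>z. e + (B + C) * indicator ?S z)"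
      using S by (auto intro!: integrable_real_mult_indicator simp: emeasure_eq_measure)
    show "\<bar>f z - g z\<bar> \<le> e + (B + C) * indicator ?S z" for z
      using B[of z] gB[of z] close[of z] \<open>e \<ge> 0\<close> by (auto simp: indicator_def)
  qed
  also have "\<dots> = e + (B + C) * measure M ?S"
    using S by (subst Bochner_Integration.integral_add) (auto simp: emeasure_eq_measure prob_space)
  finally show ?thesis .
qed

lemma prob_tail_small:
  fixes N :: "(real \<times> real) measure"
  assumes N: "prob_space N" "sets N = sets borel" and e: "e > 0"
  obtains A where "A > 0" "\<And>A'. A' \<ge> A \<Longrightarrow> measure N {z. \<bar>fst z\<bar> > A' \<or> \<bar>snd z\<bar> > A'} < e"
proof -
  interpret prob_space N by fact
  let ?S = "\<lambda>A. {z::real \<times> real. \<bar>fst z\<bar> > A \<or> \<bar>snd z\<bar> > A}"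
  have S: "?S A \<in> sets N" for A
  proof -
    have "open (?S A)" by (intro open_Collect_disj open_Collect_less continuous_intros)
    then show ?thesis using N(2) by auto
  qed
  have "(\<lambda>k::nat. measure N (?S (real k))) \<longlonglongrightarrow> measure N (\<Inter>k. ?S (real k))"
    using S by (intro finite_Lim_measure_decseq) (auto simp: decseq_def)
  also have "(\<Inter>k::nat. ?S (real k)) = {}"
  proof -
    have "\<exists>k::nat. \<not> (\<bar>fst z\<bar> > real k \<or> \<bar>snd z\<bar> > real k)" for z :: "real \<times> real"
      using real_arch_simple[of "max \<bar>fst z\<bar> \<bar>snd z\<bar>"] by (auto simp: not_less)
    then show ?thesis by blast
  qed
  finally have "eventually (\<lambda>k::nat. measure N (?S (real k)) < e) sequentially"
    using e by (intro order_tendstoD(2)) auto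
  then obtain k :: nat where k: "\<And>n. n \<ge> k \<Longrightarrow> measure N (?S (real n)) < e"
    by (auto simp: eventually_sequentially)
  show ?thesis
  proof (rule that[of "real (Suc k)"])
    fix A' assume A': "A' \<ge> real (Suc k)"
    have "measure N (?S A') \<le> measure N (?S (real (Suc k)))"
      using A' S by (intro finite_measure_mono) auto
    also have "\<dots> < e" by (rule k) simp
    finally show "measure N (?S A') < e" .
  qed simp
qed

text \<open>The Chebyshev form of the tightness hypothesis is the one that standardized variables satisfy.  On a
  large square \<open>f\<close> is replaced by a trigonometric polynomial, whose integrals converge by hypothesis; outside
  the square both functions are bounded and the masses are small.\<close>

theorem plane_levy_continuity:
  fixes M :: "nat \<Rightarrow> (real \<times> real) measure"
  assumes M: "\<And>n. prob_space (M n)" "\<And>n. sets (M n) = sets borel"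
    and N: "prob_space N" "sets N = sets borel"
    and tight: "\<And>A n. A > 0 \<Longrightarrow> measure (M n) {z. \<bar>fst z\<bar> > A \<or> \<bar>snd z\<bar> > A} \<le> C / A\<^sup>2"
    and char: "\<And>s t. (\<lambda>n. plane_char (M n) s t) \<longlonglongrightarrow> plane_char N s t"
  shows "weakly_converges M N"
  unfolding weakly_converges_def
proof (intro allI impI, elim conjE)
  fix f :: "real \<times> real \<Rightarrow> real"
  assume f: "continuous_on UNIV f" and "bounded (range f)"
  then obtain B where B: "\<And>z. \<bar>f z\<bar> \<le> B" by (auto simp: bounded_iff)
  have B0: "B \<ge> 0" using B[of 0] by simp
  have fm: "f \<in> borel_measurable borel" using f by (rule borel_measurable_continuous_onI)
  have C: "C \<ge> 0" using order_trans[OF measure_nonneg tight[of 1 0]] by simp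
  show "(\<lambda>n. \<integral>x. f x \<partial>M n) \<longlonglongrightarrow> (\<integral>x. f x \<partial>N)"
  proof (rule LIMSEQ_I)
    fix r :: real assume r: "r > 0"
    (* Twice e + (2 B + 1) e for the two replacements plus e for the convergence stays below r. *)
    define e where "e = min 1 (r / (6 + 4 * (2 * B + 1)))"
    have e: "0 < e" "e \<le> 1" "e * (6 + 4 * (2 * B + 1)) \<le> r"
    proof -
      have p: "6 + 4 * (2 * B + 1) > 0" using B0 by simp
      show "0 < e" "e \<le> 1" using r p by (auto simp: e_def)
      have "e \<le> r / (6 + 4 * (2 * B + 1))" by (simp add: e_def)
      then show "e * (6 + 4 * (2 * B + 1)) \<le> r" using p by (simp add: pos_le_divide_eq)
    qed
    obtain A1 where A1: "A1 > 0" "\<And>A'. A' \<ge> A1 \<Longrightarrow> measure N {z. \<bar>fst z\<bar> > A' \<or> \<bar>snd z\<bar> > A'} < e"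
      using prob_tail_small[OF N e(1)] by metis
    define A where "A = max A1 (sqrt (C / e) + 1)"
    have A: "A > 0" "A \<ge> A1" using A1 by (auto simp: A_def)
    have "C / e \<le> A\<^sup>2"
    proof -
      have "sqrt (C / e) \<le> A" by (simp add: A_def)
      then have "(sqrt (C / e))\<^sup>2 \<le> A\<^sup>2" using C e by (intro power_mono) auto
      then show ?thesis using C e by simp
    qed
    then have "C / A\<^sup>2 \<le> e" using A e by (simp add: field_simps)
    then have tM: "measure (M n) {z. \<bar>fst z\<bar> > A \<or> \<bar>snd z\<bar> > A} \<le> e" for n
      using tight[OF A(1), of n] by simp
    have tN: "measure N {z. \<bar>fst z\<bar> > A \<or> \<bar>snd z\<bar> > A} \<le> e"
      using A1(2)[OF A(2)] by simp
    obtain g where g: "g \<in> trig_poly"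
      "\<And>z. \<bar>fst z\<bar> \<le> A \<Longrightarrow> \<bar>snd z\<bar> \<le> A \<Longrightarrow> \<bar>f z - g z\<bar> \<le> e" "\<And>z. \<bar>g z\<bar> \<le> B + e"
      using trig_poly_approximation[OF f B A(1) e(1)] by blast
    have gm: "g \<in> borel_measurable borel"
      using g(1) by (induction rule: trig_poly.induct)
        (auto intro!: borel_measurable_continuous_onI continuous_intros)
    have bound: "\<bar>(\<integral>z. f z \<partial>K) - (\<integral>z. g z \<partial>K)\<bar> \<le> e + (2 * B + 1) * e"
      if K: "prob_space K" "sets K = sets borel" "measure K {z. \<bar>fst z\<bar> > A \<or> \<bar>snd z\<bar> > A} \<le> e" for K
    proof -
      have "\<bar>(\<integral>z. f z \<partial>K) - (\<integral>z. g z \<partial>K)\<bar> \<le>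
          e + (B + (B + e)) * measure K {z. \<bar>fst z\<bar> > A \<or> \<bar>snd z\<bar> > A}"
        using e(1) by (intro approx_integral_on_box[OF K(1,2) fm B gm g(3) g(2)]) auto
      also have "\<dots> \<le> e + (2 * B + 1) * e"
        using e B0 K(3) by (intro add_left_mono mult_mono) auto
      finally show ?thesis .
    qed
    have "eventually (\<lambda>n. \<bar>(\<integral>z. g z \<partial>M n) - (\<integral>z. g z \<partial>N)\<bar> < e) sequentially"
      using tendstoD[OF trig_poly_integral_tendsto[OF M N char g(1)] e(1)]
      by (simp add: dist_real_def)
    then obtain n0 where n0: "\<And>n. n \<ge> n0 \<Longrightarrow> \<bar>(\<integral>z. g z \<partial>M n) - (\<integral>z. g z \<partial>N)\<bar> < e"
      by (auto simp: eventually_sequentially)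
    have tri: "\<bar>a - b\<bar> \<le> u \<Longrightarrow> \<bar>c - d\<bar> \<le> u \<Longrightarrow> \<bar>b - d\<bar> < v \<Longrightarrow> \<bar>a - c\<bar> < 2 * u + v"
      for a b c d u v :: real
      by linarith
    have "norm ((\<integral>z. f z \<partial>M n) - (\<integral>z. f z \<partial>N)) < r" if "n \<ge> n0" for n
    proof -
      have "\<bar>(\<integral>z. f z \<partial>M n) - (\<integral>z. f z \<partial>N)\<bar> < 2 * (e + (2 * B + 1) * e) + e"
        by (rule tri[OF bound[OF M tM] bound[OF N tN] n0[OF that]])
      also have "\<dots> \<le> e * (6 + 4 * (2 * B + 1))"
        using e(1) B0 by (simp add: algebra_simps)
      finally show ?thesis using e(3) by simp
    qed
    then show "\<exists>n0. \<forall>n\<ge>n0. norm ((\<integral>z. f z \<partial>M n) - (\<integral>z. f z \<partial>N)) < r" by blast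
  qed
qed

section \<open>The bivariate normal law\<close>

lemma char_normal_density:
  assumes "\<sigma> > 0"
  shows "(CLINT y|lborel. of_real (normal_density \<mu> \<sigma> y) * iexp (t * y))
      = iexp (t * \<mu>) * of_real (exp (- (\<sigma>\<^sup>2 * t\<^sup>2) / 2))"
proof -
  have std: "(CLINT y|lborel. of_real (std_normal_density y) * iexp (s * y)) = of_real (exp (- (s\<^sup>2) / 2))" for s
  proof -
    have "char std_normal_distribution s = (CLINT y|lborel. std_normal_density y *\<^sub>R iexp (s * y))"
      unfolding char_def by (subst integral_density) auto
    then show ?thesis
      unfolding char_std_normal_distribution by (simp add: scaleR_conv_of_real)
  qed
  have "(CLINT y|lborel. of_real (normal_density \<mu> \<sigma> y) * iexp (t * y))
      = \<bar>\<sigma>\<bar> *\<^sub>R (CLINT y|lborel. of_real (normal_density \<mu> \<sigma> (\<mu> + \<sigma> * y)) * iexp (t * (\<mu> + \<sigma> * y)))"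
    using assms by (intro lborel_integral_real_affine) auto
  also have "(\<lambda>y. of_real (normal_density \<mu> \<sigma> (\<mu> + \<sigma> * y)) * iexp (t * (\<mu> + \<sigma> * y)))
      = (\<lambda>y. (iexp (t * \<mu>) / of_real \<sigma>) * (of_real (std_normal_density y) * iexp (t * \<sigma> * y)))"
  proof
    fix y
    have "normal_density \<mu> \<sigma> (\<mu> + \<sigma> * y) = std_normal_density y / \<sigma>"
      using assms by (simp add: normal_density_def real_sqrt_mult power_mult_distrib)
    moreover have "iexp (t * (\<mu> + \<sigma> * y)) = iexp (t * \<mu>) * iexp (t * \<sigma> * y)"
      by (simp add: exp_add[symmetric] algebra_simps)
    ultimately show "of_real (normal_density \<mu> \<sigma> (\<mu> + \<sigma> * y)) * iexp (t * (\<mu> + \<sigma> * y))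
      = (iexp (t * \<mu>) / of_real \<sigma>) * (of_real (std_normal_density y) * iexp (t * \<sigma> * y))"
      by simp
  qed
  also have "(CLINT y|lborel. (iexp (t * \<mu>) / of_real \<sigma>) * (of_real (std_normal_density y) * iexp (t * \<sigma> * y)))
      = (iexp (t * \<mu>) / of_real \<sigma>) * of_real (exp (- ((t * \<sigma>)\<^sup>2) / 2))"
    by (subst integral_mult_right_zero) (simp only: std)
  also have "\<bar>\<sigma>\<bar> *\<^sub>R \<dots> = iexp (t * \<mu>) * of_real (exp (- (\<sigma>\<^sup>2 * t\<^sup>2) / 2))"
    using assms by (simp add: scaleR_conv_of_real power_mult_distrib mult_ac)
  finally show ?thesis .
qed

definition gauss_density :: "real \<Rightarrow> real \<Rightarrow> real \<Rightarrow> real" where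
  "gauss_density \<rho> x y = exp (- (x\<^sup>2 - 2 * \<rho> * x * y + y\<^sup>2) / (2 * (1 - \<rho>\<^sup>2))) / (2 * pi * sqrt (1 - \<rho>\<^sup>2))"

text \<open>Completing the square in \<open>y\<close>: the marginal law of \<open>x\<close> is standard normal and the conditional law of \<open>y\<close> is
  normal with mean \<open>\<rho> x\<close> and variance \<open>1 - \<rho>\<^sup>2\<close>.  All computations for this law are therefore iterated
  one-dimensional ones.\<close>

lemma gauss_density_factor:
  assumes "\<bar>\<rho>\<bar> < 1"
  shows "gauss_density \<rho> x y = std_normal_density x * normal_density (\<rho> * x) (sqrt (1 - \<rho>\<^sup>2)) y"
proof -
  have r: "1 - \<rho>\<^sup>2 > 0" using assms by (simp add: abs_square_less_1)
  have "- (x\<^sup>2 - 2 * \<rho> * x * y + y\<^sup>2) / (2 * (1 - \<rho>\<^sup>2)) = - x\<^sup>2 / 2 + - (y - \<rho> * x)\<^sup>2 / (2 * (1 - \<rho>\<^sup>2))"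
    using r by (simp add: field_simps power2_eq_square)
  then have e: "exp (- (x\<^sup>2 - 2 * \<rho> * x * y + y\<^sup>2) / (2 * (1 - \<rho>\<^sup>2)))
      = exp (- x\<^sup>2 / 2) * exp (- (y - \<rho> * x)\<^sup>2 / (2 * (1 - \<rho>\<^sup>2)))"
    by (simp only: exp_add)
  have "sqrt (2 * pi) * sqrt (2 * pi * (1 - \<rho>\<^sup>2)) = 2 * pi * sqrt (1 - \<rho>\<^sup>2)"
  proof -
    have "sqrt (2 * pi) * sqrt (2 * pi * (1 - \<rho>\<^sup>2)) = (sqrt (2 * pi) * sqrt (2 * pi)) * sqrt (1 - \<rho>\<^sup>2)"
      unfolding real_sqrt_mult[of "2 * pi" "1 - \<rho>\<^sup>2"] by (simp only: mult.assoc)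
    then show ?thesis by (simp only: real_sqrt_mult_self) simp
  qed
  then show ?thesis
    unfolding gauss_density_def e normal_density_def using r by simp
qed

lemma bivariate_std_normal_density:
  "bivariate_std_normal \<rho> = density (lborel \<Otimes>\<^sub>M lborel) (\<lambda>z. ennreal (gauss_density \<rho> (fst z) (snd z)))"
  unfolding bivariate_std_normal_def gauss_density_def lborel_prod[symmetric]
  by (intro arg_cong2[where f = density]) (auto simp: fun_eq_iff)

lemma gauss_density_measurable [measurable]:
  "(\<lambda>z. gauss_density \<rho> (fst z) (snd z)) \<in> borel_measurable (borel \<Otimes>\<^sub>M borel)"
  unfolding gauss_density_def by measurable

lemma sets_bivariate_std_normal: "sets (bivariate_std_normal \<rho>) = sets borel"
  by (simp add: bivariate_std_normal_def)

lemma nn_integral_normal_density: "\<sigma> > 0 \<Longrightarrow> (\<integral>\<^sup>+ y. ennreal (normal_density \<mu> \<sigma> y) \<partial>lborel) = 1"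
  by (subst nn_integral_eq_integral) auto

lemma prob_space_bivariate_std_normal:
  assumes "\<bar>\<rho>\<bar> < 1"
  shows "prob_space (bivariate_std_normal \<rho>)"
proof
  have r: "sqrt (1 - \<rho>\<^sup>2) > 0" using assms by (simp add: abs_square_less_1)
  have "emeasure (bivariate_std_normal \<rho>) (space (bivariate_std_normal \<rho>))
      = (\<integral>\<^sup>+ z. ennreal (gauss_density \<rho> (fst z) (snd z)) \<partial>(lborel \<Otimes>\<^sub>M lborel))"
  proof -
    have "UNIV \<in> sets (borel \<Otimes>\<^sub>M borel :: (real \<times> real) measure)"
      unfolding borel_prod by simp
    then show ?thesis
      unfolding bivariate_std_normal_density by (subst emeasure_density) (auto simp: space_pair_measure)
  qed
  also have "\<dots> = (\<integral>\<^sup>+ x. \<integral>\<^sup>+ y. ennreal (gauss_density \<rho> x y) \<partial>lborel \<partial>lborel)"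
    by (subst lborel.nn_integral_fst[symmetric]) auto
  also have "\<dots> = (\<integral>\<^sup>+ x. ennreal (std_normal_density x) \<partial>lborel)"
    unfolding gauss_density_factor[OF assms]
    by (simp add: ennreal_mult nn_integral_cmult nn_integral_normal_density[OF r])
  also have "\<dots> = 1" by (rule nn_integral_normal_density) simp
  finally show "emeasure (bivariate_std_normal \<rho>) (space (bivariate_std_normal \<rho>)) = 1" .
qed

lemma plane_char_bivariate_std_normal:
  assumes "\<bar>\<rho>\<bar> < 1"
  shows "plane_char (bivariate_std_normal \<rho>) s t = of_real (exp (- (s\<^sup>2 + 2 * \<rho> * s * t + t\<^sup>2) / 2))"
proof -
  have r: "sqrt (1 - \<rho>\<^sup>2) > 0" and r2: "1 - \<rho>\<^sup>2 > 0" using assms by (simp_all add: abs_square_less_1)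
  have reorder: "a * b * (c * d) = d * (a * e)" if "b * c = e" for a b c d e :: complex
    unfolding that[symmetric] by (simp add: mult_ac)
  let ?f = "\<lambda>z. gauss_density \<rho> (fst z) (snd z) *\<^sub>R iexp (s * fst z + t * snd z)"
  interpret N: prob_space "bivariate_std_normal \<rho>" by (rule prob_space_bivariate_std_normal[OF assms])
  have nonneg: "gauss_density \<rho> x y \<ge> 0" for x y
    using r by (simp add: gauss_density_def)
  have m: "(\<lambda>z. iexp (s * fst z + t * snd z)) \<in> borel_measurable (lborel \<Otimes>\<^sub>M lborel)" by simp
  have "integrable (bivariate_std_normal \<rho>) (\<lambda>z. iexp (s * fst z + t * snd z))"
    by (rule N.integrable_const_bound[of _ 1]) (auto simp: bivariate_std_normal_density)
  then have int: "integrable (lborel \<Otimes>\<^sub>M lborel) ?f"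
    unfolding bivariate_std_normal_density using nonneg by (subst (asm) integrable_density) auto
  have "plane_char (bivariate_std_normal \<rho>) s t = (CLINT z|lborel \<Otimes>\<^sub>M lborel. ?f z)"
    unfolding plane_char_def bivariate_std_normal_density using nonneg by (subst integral_density) auto
  also have "\<dots> = (CLINT x|lborel. CLINT y|lborel. ?f (x, y))"
    using lborel_pair.integral_fst'[OF int] by simp
  also have "\<dots> = (CLINT x|lborel. of_real (std_normal_density x) * iexp (s * x)
      * (CLINT y|lborel. of_real (normal_density (\<rho> * x) (sqrt (1 - \<rho>\<^sup>2)) y) * iexp (t * y)))"
  proof (rule Bochner_Integration.integral_cong[OF refl])
    fix x
    have "(\<lambda>y. ?f (x, y)) = (\<lambda>y. (of_real (std_normal_density x) * iexp (s * x))
        * (of_real (normal_density (\<rho> * x) (sqrt (1 - \<rho>\<^sup>2)) y) * iexp (t * y)))"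
      unfolding gauss_density_factor[OF assms] by (simp add: fun_eq_iff scaleR_conv_of_real exp_add distrib_left mult_ac)
    then show "(CLINT y|lborel. ?f (x, y)) = of_real (std_normal_density x) * iexp (s * x)
      * (CLINT y|lborel. of_real (normal_density (\<rho> * x) (sqrt (1 - \<rho>\<^sup>2)) y) * iexp (t * y))"
      by (simp only: integral_mult_right_zero)
  qed
  also have "\<dots> = (CLINT x|lborel. of_real (exp (- ((1 - \<rho>\<^sup>2) * t\<^sup>2) / 2)) * (of_real (normal_density 0 1 x) * iexp ((s + t * \<rho>) * x)))"
  proof (rule Bochner_Integration.integral_cong[OF refl])
    fix x
    have "iexp (s * x) * iexp (t * (\<rho> * x)) = iexp ((s + t * \<rho>) * x)"
      by (simp add: exp_add[symmetric] algebra_simps)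
    then show "of_real (std_normal_density x) * iexp (s * x)
      * (CLINT y|lborel. of_real (normal_density (\<rho> * x) (sqrt (1 - \<rho>\<^sup>2)) y) * iexp (t * y))
      = of_real (exp (- ((1 - \<rho>\<^sup>2) * t\<^sup>2) / 2)) * (of_real (normal_density 0 1 x) * iexp ((s + t * \<rho>) * x))"
      unfolding char_normal_density[OF r] real_sqrt_pow2[OF less_imp_le[OF r2]] by (rule reorder)
  qed
  also have "\<dots> = of_real (exp (- ((1 - \<rho>\<^sup>2) * t\<^sup>2) / 2)) * (iexp ((s + t * \<rho>) * 0) * of_real (exp (- (1\<^sup>2 * (s + t * \<rho>)\<^sup>2) / 2)))"
    by (simp only: integral_mult_right_zero char_normal_density[OF zero_less_one])
  also have "\<dots> = of_real (exp (- ((1 - \<rho>\<^sup>2) * t\<^sup>2) / 2 + - ((s + t * \<rho>)\<^sup>2) / 2))"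
    by (simp only: exp_add of_real_mult) simp
  also have "- ((1 - \<rho>\<^sup>2) * t\<^sup>2) / 2 + - ((s + t * \<rho>)\<^sup>2) / 2 = - (s\<^sup>2 + 2 * \<rho> * s * t + t\<^sup>2) / 2"
    by (simp add: power2_eq_square algebra_simps add_divide_distrib diff_divide_distrib)
  finally show ?thesis .
qed

lemma std_normal_pair: "std_normal \<Otimes>\<^sub>M std_normal = bivariate_std_normal 0"
proof -
  have "sigma_finite_measure std_normal"
    unfolding std_normal_def by (intro prob_space_imp_sigma_finite prob_space_normal_density) simp
  then have "std_normal \<Otimes>\<^sub>M std_normal = density (lborel \<Otimes>\<^sub>M lborel)
      (\<lambda>(x, y). ennreal (std_normal_density x) * ennreal (std_normal_density y))"
    unfolding std_normal_def
    by (intro pair_measure_density) (auto intro: lborel.sigma_finite_measure_axioms)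
  also have "(\<lambda>(x, y). ennreal (std_normal_density x) * ennreal (std_normal_density y))
      = (\<lambda>z. ennreal (gauss_density 0 (fst z) (snd z)))"
    by (auto simp: fun_eq_iff gauss_density_factor ennreal_mult)
  finally show ?thesis by (simp add: bivariate_std_normal_density)
qed

section \<open>Passage to standardized variables\<close>

lemma norm_cis_diff_le: "norm (cis u - cis w) \<le> \<bar>u - w\<bar>"
proof -
  have "cis u - cis w = cis w * (iexp (u - w) - 1)"
    unfolding cis_conv_exp[symmetric] by (simp add: right_diff_distrib cis_mult)
  also have "norm \<dots> = norm (iexp (u - w) - 1)" by (simp add: norm_mult)
  also have "\<dots> \<le> \<bar>u - w\<bar>" using iexp_approx1[of "u - w" 0] by simp
  finally show ?thesis .
qed

text \<open>Only an inequality holds in general, since a variable of variance zero is standardized to zero.\<close>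

lemma standardize_second_moment:
  fixes X :: "'a \<Rightarrow> real"
  shows "measure_pmf.expectation p (\<lambda>\<omega>. (standardize p X \<omega>)\<^sup>2) \<le> 1"
proof -
  let ?V = "measure_pmf.variance p X"
  have V: "?V \<ge> 0" by (rule integral_nonneg_AE) simp
  have "measure_pmf.expectation p (\<lambda>\<omega>. (standardize p X \<omega>)\<^sup>2) = ?V / ?V"
    unfolding standardize_def power_divide using V by simp
  then show ?thesis by simp
qed

lemma standardize_first_moment:
  fixes X :: "'a \<Rightarrow> real"
  assumes fin: "finite (set_pmf p)"
  shows "measure_pmf.expectation p (\<lambda>\<omega>. \<bar>standardize p X \<omega>\<bar>) \<le> 1"
proof -
  note int = integrable_measure_pmf_finite[OF fin]
  have "measure_pmf.expectation p (\<lambda>\<omega>. \<bar>standardize p X \<omega>\<bar>)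
      \<le> measure_pmf.expectation p (\<lambda>\<omega>. (1 + (standardize p X \<omega>)\<^sup>2) / 2)"
  proof (intro integral_mono int)
    fix \<omega>
    have "0 \<le> (\<bar>standardize p X \<omega>\<bar> - 1)\<^sup>2" by simp
    then show "\<bar>standardize p X \<omega>\<bar> \<le> (1 + (standardize p X \<omega>)\<^sup>2) / 2"
      by (simp add: power2_diff)
  qed
  also have "\<dots> = (1 + measure_pmf.expectation p (\<lambda>\<omega>. (standardize p X \<omega>)\<^sup>2)) / 2"
    by (simp add: int)
  finally show ?thesis using standardize_second_moment[of p X] by simp
qed

lemma standardized_joint_law_basic:
  "prob_space (standardized_joint_law p X Y)" "sets (standardized_joint_law p X Y) = sets borel"
  unfolding standardized_joint_law_def by (auto intro: measure_pmf.prob_space_distr)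

lemma plane_char_standardized:
  "plane_char (standardized_joint_law p X Y) s t
     = (\<integral>\<omega>. cis (s * standardize p X \<omega> + t * standardize p Y \<omega>) \<partial>measure_pmf p)"
proof -
  have "(\<lambda>z::real \<times> real. cis (s * fst z + t * snd z)) \<in> borel_measurable borel"
    by (intro borel_measurable_continuous_onI continuous_intros)
  then show ?thesis
    unfolding plane_char_def standardized_joint_law_def cis_conv_exp[symmetric]
    by (subst integral_distr) auto
qed

lemma standardized_tail:
  assumes fin: "finite (set_pmf p)" and A: "A > 0"
  shows "measure (standardized_joint_law p X Y) {z. \<bar>fst z\<bar> > A \<or> \<bar>snd z\<bar> > A} \<le> 2 / A\<^sup>2"
proof -
  note int = integrable_measure_pmf_finite[OF fin]
  let ?S = "{z::real \<times> real. \<bar>fst z\<bar> > A \<or> \<bar>snd z\<bar> > A}"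
  let ?u = "\<lambda>\<omega>. (standardize p X \<omega>)\<^sup>2 + (standardize p Y \<omega>)\<^sup>2"
  have "open ?S" by (intro open_Collect_disj open_Collect_less continuous_intros)
  then have "measure (standardized_joint_law p X Y) ?S
      = measure (measure_pmf p) ((\<lambda>\<omega>. (standardize p X \<omega>, standardize p Y \<omega>)) -` ?S)"
    unfolding standardized_joint_law_def by (subst measure_distr) auto
  also have "\<dots> \<le> measure (measure_pmf p) {\<omega> \<in> space (measure_pmf p). ?u \<omega> \<ge> A\<^sup>2}"
  proof (intro measure_pmf.finite_measure_mono subsetI)
    have square: "A\<^sup>2 \<le> x\<^sup>2" if "A < \<bar>x\<bar>" for x
      using power_mono[of A "\<bar>x\<bar>" 2] A that by simp
    fix \<omega> assume "\<omega> \<in> (\<lambda>\<omega>. (standardize p X \<omega>, standardize p Y \<omega>)) -` ?S"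
    then have "A\<^sup>2 \<le> (standardize p X \<omega>)\<^sup>2 \<or> A\<^sup>2 \<le> (standardize p Y \<omega>)\<^sup>2"
      using square by auto
    then show "\<omega> \<in> {\<omega> \<in> space (measure_pmf p). ?u \<omega> \<ge> A\<^sup>2}"
      by (auto intro: add_increasing add_increasing2)
  qed simp
  also have "\<dots> \<le> measure_pmf.expectation p ?u / A\<^sup>2"
    using A by (intro integral_Markov_inequality_measure[where A = "UNIV"] int) auto
  also have "measure_pmf.expectation p ?u \<le> 2"
    using standardize_second_moment[of p X] standardize_second_moment[of p Y] by (simp add: int)
  finally show ?thesis using A by (simp add: divide_right_mono)
qed

text \<open>Standardization by the exact mean and deviation may be replaced by an approximate affine
  normalization, because \<open>cis\<close> is Lipschitz and standardized variables have first absolute moment at most one.\<close>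

lemma char_standardized_close:
  fixes X Y :: "'a \<Rightarrow> real"
  assumes fin: "finite (set_pmf p)"
    and pos: "measure_pmf.variance p X > 0" "measure_pmf.variance p Y > 0"
  shows "norm ((\<integral>\<omega>. cis (s * standardize p X \<omega> + t * standardize p Y \<omega>) \<partial>measure_pmf p)
      - (\<integral>\<omega>. cis (\<alpha> * (X \<omega> - \<mu>) + \<beta> * (Y \<omega> - \<nu>)) \<partial>measure_pmf p))
    \<le> \<bar>s - \<alpha> * sqrt (measure_pmf.variance p X)\<bar> + \<bar>\<alpha> * (measure_pmf.expectation p X - \<mu>)\<bar>
      + (\<bar>t - \<beta> * sqrt (measure_pmf.variance p Y)\<bar> + \<bar>\<beta> * (measure_pmf.expectation p Y - \<nu>)\<bar>)"
proof -
  note int = integrable_measure_pmf_finite[OF fin]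
  define x y where "x = standardize p X" and "y = standardize p Y"
  define c where "c = s - \<alpha> * sqrt (measure_pmf.variance p X)"
  define c' where "c' = t - \<beta> * sqrt (measure_pmf.variance p Y)"
  define b where "b = \<alpha> * (measure_pmf.expectation p X - \<mu>)"
  define b' where "b' = \<beta> * (measure_pmf.expectation p Y - \<nu>)"
  have split: "\<sigma> * (Z \<omega> - \<mu>) = \<sigma> * sqrt (measure_pmf.variance p Z) * standardize p Z \<omega>
      + \<sigma> * (measure_pmf.expectation p Z - \<mu>)"
    if "measure_pmf.variance p Z > 0" for Z :: "'a \<Rightarrow> real" and \<sigma> \<mu> \<omega>
  proof -
    have "sqrt (measure_pmf.variance p Z) * standardize p Z \<omega> = Z \<omega> - measure_pmf.expectation p Z"
      using that by (simp add: standardize_def)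
    then show ?thesis by (simp only: mult.assoc) (simp add: algebra_simps)
  qed
  have diff: "(s * x \<omega> + t * y \<omega>) - (\<alpha> * (X \<omega> - \<mu>) + \<beta> * (Y \<omega> - \<nu>))
      = c * x \<omega> - b + (c' * y \<omega> - b')" for \<omega>
    unfolding split[OF pos(1)] split[OF pos(2)] x_def y_def c_def c'_def b_def b'_def
    by (simp add: algebra_simps)
  have "norm ((\<integral>\<omega>. cis (s * x \<omega> + t * y \<omega>) \<partial>measure_pmf p)
      - (\<integral>\<omega>. cis (\<alpha> * (X \<omega> - \<mu>) + \<beta> * (Y \<omega> - \<nu>)) \<partial>measure_pmf p))
    = norm (\<integral>\<omega>. cis (s * x \<omega> + t * y \<omega>) - cis (\<alpha> * (X \<omega> - \<mu>) + \<beta> * (Y \<omega> - \<nu>)) \<partial>measure_pmf p)"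
    by (simp add: int)
  also have "\<dots> \<le> (\<integral>\<omega>. norm (cis (s * x \<omega> + t * y \<omega>) - cis (\<alpha> * (X \<omega> - \<mu>) + \<beta> * (Y \<omega> - \<nu>))) \<partial>measure_pmf p)"
    by (rule integral_norm_bound)
  also have "\<dots> \<le> (\<integral>\<omega>. \<bar>c\<bar> * \<bar>x \<omega>\<bar> + \<bar>b\<bar> + (\<bar>c'\<bar> * \<bar>y \<omega>\<bar> + \<bar>b'\<bar>) \<partial>measure_pmf p)"
  proof (intro integral_mono int)
    fix \<omega>
    have "norm (cis (s * x \<omega> + t * y \<omega>) - cis (\<alpha> * (X \<omega> - \<mu>) + \<beta> * (Y \<omega> - \<nu>)))
        \<le> \<bar>c * x \<omega> - b + (c' * y \<omega> - b')\<bar>"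
      unfolding diff[symmetric] by (rule norm_cis_diff_le)
    also have "\<dots> \<le> \<bar>c * x \<omega>\<bar> + \<bar>b\<bar> + (\<bar>c' * y \<omega>\<bar> + \<bar>b'\<bar>)" by linarith
    finally show "norm (cis (s * x \<omega> + t * y \<omega>) - cis (\<alpha> * (X \<omega> - \<mu>) + \<beta> * (Y \<omega> - \<nu>)))
        \<le> \<bar>c\<bar> * \<bar>x \<omega>\<bar> + \<bar>b\<bar> + (\<bar>c'\<bar> * \<bar>y \<omega>\<bar> + \<bar>b'\<bar>)" by (simp only: abs_mult)
  qed
  also have "\<dots> = \<bar>c\<bar> * measure_pmf.expectation p (\<lambda>\<omega>. \<bar>x \<omega>\<bar>) + \<bar>b\<bar>
      + (\<bar>c'\<bar> * measure_pmf.expectation p (\<lambda>\<omega>. \<bar>y \<omega>\<bar>) + \<bar>b'\<bar>)"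
    by (simp add: int)
  also have "\<dots> \<le> \<bar>c\<bar> * 1 + \<bar>b\<bar> + (\<bar>c'\<bar> * 1 + \<bar>b'\<bar>)"
    unfolding x_def y_def by (intro add_mono mult_left_mono standardize_first_moment fin) auto
  finally show ?thesis by (simp add: x_def y_def c_def c'_def b_def b'_def)
qed

lemma weakly_converges_Suc:
  assumes "weakly_converges (\<lambda>n. M (Suc n)) N"
  shows "weakly_converges M N"
  using assms unfolding weakly_converges_def by (blast intro: LIMSEQ_imp_Suc)

text \<open>A central limit theorem with deterministic centering and scaling by \<open>sqrt n\<close> passes to the standardized
  variables as soon as the centering is right up to \<open>o(sqrt n)\<close> and the variances are asymptotically linear.\<close>

theorem standardized_joint_law_limit:
  fixes p :: "nat \<Rightarrow> 'a pmf" and X Y :: "'a \<Rightarrow> real" and \<mu> \<nu> :: "nat \<Rightarrow> real"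
  assumes fin: "\<And>n. n > 0 \<Longrightarrow> finite (set_pmf (p n))"
    and char: "\<And>s t. (\<lambda>n. \<integral>\<omega>. cis (s / sqrt (real n) * (X \<omega> - \<mu> n) + t / sqrt (real n) * (Y \<omega> - \<nu> n)) \<partial>measure_pmf (p n))
        \<longlonglongrightarrow> of_real (exp (- (V * s\<^sup>2 + 2 * C * s * t + W * t\<^sup>2) / 2))"
    and centre: "(\<lambda>n. (measure_pmf.expectation (p n) X - \<mu> n) / sqrt (real n)) \<longlonglongrightarrow> 0"
      "(\<lambda>n. (measure_pmf.expectation (p n) Y - \<nu> n) / sqrt (real n)) \<longlonglongrightarrow> 0"
    and var: "(\<lambda>n. measure_pmf.variance (p n) X / real n) \<longlonglongrightarrow> V"
      "(\<lambda>n. measure_pmf.variance (p n) Y / real n) \<longlonglongrightarrow> W"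
    and pos: "V > 0" "W > 0" and C: "\<bar>C\<bar> < sqrt V * sqrt W"
  shows "weakly_converges (\<lambda>n. standardized_joint_law (p n) X Y) (bivariate_std_normal (C / (sqrt V * sqrt W)))"
proof (rule weakly_converges_Suc, rule plane_levy_continuity)
  define \<rho> where "\<rho> = C / (sqrt V * sqrt W)"
  have VW: "sqrt V * sqrt W > 0" using pos by simp
  have rho: "\<bar>\<rho>\<bar> < 1" proof -
    have "\<bar>\<rho>\<bar> = \<bar>C\<bar> / (sqrt V * sqrt W)" by (simp only: \<rho>_def abs_divide abs_of_pos[OF VW])
    then show ?thesis using C VW by (simp only: divide_less_eq_1_pos)
  qed
  show "prob_space (bivariate_std_normal (C / (sqrt V * sqrt W)))"
    using prob_space_bivariate_std_normal[OF rho] by (simp add: \<rho>_def)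
  show "sets (bivariate_std_normal (C / (sqrt V * sqrt W))) = sets borel"
    by (rule sets_bivariate_std_normal)
  show "prob_space (standardized_joint_law (p (Suc n)) X Y)"
    "sets (standardized_joint_law (p (Suc n)) X Y) = sets borel" for n
    by (rule standardized_joint_law_basic)+
  show "measure (standardized_joint_law (p (Suc n)) X Y) {z. \<bar>fst z\<bar> > A \<or> \<bar>snd z\<bar> > A} \<le> 2 / A\<^sup>2"
    if "A > 0" for A n
    using that by (intro standardized_tail fin) auto
  fix s t
  define f where "f n = plane_char (standardized_joint_law (p n) X Y) s t" for n
  define s' t' where "s' = s / sqrt V" and "t' = t / sqrt W"
  define g where "g n = (\<integral>\<omega>. cis (s' / sqrt (real n) * (X \<omega> - \<mu> n) + t' / sqrt (real n) * (Y \<omega> - \<nu> n)) \<partial>measure_pmf (p n))" for n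
  define err where "err n = \<bar>s - s' * sqrt (measure_pmf.variance (p n) X / real n)\<bar>
      + \<bar>s' * ((measure_pmf.expectation (p n) X - \<mu> n) / sqrt (real n))\<bar>
      + (\<bar>t - t' * sqrt (measure_pmf.variance (p n) Y / real n)\<bar>
      + \<bar>t' * ((measure_pmf.expectation (p n) Y - \<nu> n) / sqrt (real n))\<bar>)" for n
  have g: "g \<longlonglongrightarrow> of_real (exp (- (V * s'\<^sup>2 + 2 * C * s' * t' + W * t'\<^sup>2) / 2))"
    unfolding g_def[abs_def] by (rule char)
  have "err \<longlonglongrightarrow> \<bar>s - s' * sqrt V\<bar> + \<bar>s' * 0\<bar> + (\<bar>t - t' * sqrt W\<bar> + \<bar>t' * 0\<bar>)"
    unfolding err_def[abs_def] by (intro tendsto_intros centre var)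
  then have err: "err \<longlonglongrightarrow> 0" using pos by (simp add: s'_def t'_def)
  have posX: "eventually (\<lambda>n. measure_pmf.variance (p n) X / real n > 0) sequentially"
    using var(1) pos(1) by (rule order_tendstoD(1))
  have posY: "eventually (\<lambda>n. measure_pmf.variance (p n) Y / real n > 0) sequentially"
    using var(2) pos(2) by (rule order_tendstoD(1))
  have "(\<lambda>n. f n - g n) \<longlonglongrightarrow> 0"
  proof (rule Lim_null_comparison[OF _ err])
    show "\<forall>\<^sub>F n in sequentially. norm (f n - g n) \<le> err n"
      using posX posY eventually_gt_at_top[of 0]
    proof eventually_elim
      case (elim n)
      then have "measure_pmf.variance (p n) X > 0" "measure_pmf.variance (p n) Y > 0"
        by (simp_all add: zero_less_divide_iff)
      from char_standardized_close[OF fin[OF elim(3)] this, of s t "s' / sqrt (real n)" "\<mu> n" "t' / sqrt (real n)" "\<nu> n"]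
      show ?case
        unfolding f_def g_def err_def plane_char_standardized real_sqrt_divide by (simp only: times_divide_eq_left times_divide_eq_right)
    qed
  qed
  then have "(\<lambda>n. (f n - g n) + g n) \<longlonglongrightarrow> 0 + of_real (exp (- (V * s'\<^sup>2 + 2 * C * s' * t' + W * t'\<^sup>2) / 2))"
    by (intro tendsto_add g)
  moreover have "V * s'\<^sup>2 + 2 * C * s' * t' + W * t'\<^sup>2 = s\<^sup>2 + 2 * \<rho> * s * t + t\<^sup>2"
    using pos by (simp add: s'_def t'_def \<rho>_def power_divide)
  ultimately have "f \<longlonglongrightarrow> plane_char (bivariate_std_normal \<rho>) s t"
    by (simp add: plane_char_bivariate_std_normal[OF rho])
  then show "(\<lambda>n. plane_char (standardized_joint_law (p (Suc n)) X Y) s t)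
      \<longlonglongrightarrow> plane_char (bivariate_std_normal (C / (sqrt V * sqrt W))) s t"
    unfolding f_def \<rho>_def by (rule LIMSEQ_Suc)
qed

section \<open>The limit laws\<close>

lemma finite_set_unif: "n > 0 \<Longrightarrow> finite (set_pmf (unif n))"
  by (simp add: unif_block set_pmf_of_set[OF block_nonempty finite_block])

lemma num_pos_terms: "num_pos = (\<lambda>x. (num_terms x + num_excess x) / 2)"
  and num_neg_terms: "num_neg = (\<lambda>x. (num_terms x - num_excess x) / 2)"
  by (simp_all add: num_terms_def num_excess_def fun_eq_iff)

text \<open>The characteristic function is a normalized \<open>char_sum\<close>, whose drift factor is the centering at \<open>n / 5\<close>.\<close>

lemma terms_excess_central_limit:
  "(\<lambda>n. \<integral>x. cis (a / sqrt (real n) * (num_terms x - real n / 5) + d / sqrt (real n) * num_excess x) \<partial>measure_pmf (unif n))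
     \<longlonglongrightarrow> of_real (exp (- limit_variance a d / 2))"
proof (rule Lim_transform_eventually[OF char_sum_central_limit[of a d]])
  show "\<forall>\<^sub>F n in sequentially.
      cis (- (a * sqrt (real n) / 5)) * char_sum (a / sqrt (real n)) (d / sqrt (real n)) n / of_real (block_count n)
    = (\<integral>x. cis (a / sqrt (real n) * (num_terms x - real n / 5) + d / sqrt (real n) * num_excess x) \<partial>measure_pmf (unif n))"
  proof (rule eventually_sequentiallyI[of 1])
    fix n :: nat assume n: "n \<ge> 1"
    have "a / sqrt (real n) * (p - real n / 5) + d / sqrt (real n) * m
        = - (a * sqrt (real n) / 5) + (a / sqrt (real n) * p + d / sqrt (real n) * m)" for p m
    proof -
      have "a / sqrt (real n) * (real n / 5) = a * (real n / sqrt (real n)) / 5" by simp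
      also have "real n / sqrt (real n) = sqrt (real n)" by (rule real_div_sqrt) simp
      finally show ?thesis by (simp add: right_diff_distrib)
    qed
    then have eq: "(\<lambda>p m. cis (a / sqrt (real n) * (p - real n / 5) + d / sqrt (real n) * m))
        = (\<lambda>p m. cis (- (a * sqrt (real n) / 5)) * cis (a / sqrt (real n) * p + d / sqrt (real n) * m))"
      by (simp only: cis_mult)
    have "(\<integral>x. cis (a / sqrt (real n) * (num_terms x - real n / 5) + d / sqrt (real n) * num_excess x) \<partial>measure_pmf (unif n))
      = (1 / block_count n) *\<^sub>R block_sum n (\<lambda>p m. cis (- (a * sqrt (real n) / 5)) * cis (a / sqrt (real n) * p + d / sqrt (real n) * m))"
      using n expectation_unif[of n "\<lambda>p m. cis (a / sqrt (real n) * (p - real n / 5) + d / sqrt (real n) * m)"]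
      unfolding eq by simp
    then show "cis (- (a * sqrt (real n) / 5)) * char_sum (a / sqrt (real n)) (d / sqrt (real n)) n / of_real (block_count n)
      = (\<integral>x. cis (a / sqrt (real n) * (num_terms x - real n / 5) + d / sqrt (real n) * num_excess x) \<partial>measure_pmf (unif n))"
      by (simp add: block_sum_cmult char_sum_def scaleR_conv_of_real)
  qed
qed

lemma covariance_pos_neg:
  assumes "n > 0"
  shows "covariance n num_pos num_pos = (covariance n num_terms num_terms
      + 2 * covariance n num_terms num_excess + covariance n num_excess num_excess) / 4"
    and "covariance n num_neg num_neg = (covariance n num_terms num_terms
      - 2 * covariance n num_terms num_excess + covariance n num_excess num_excess) / 4"
proof -
  note int = integrable_unif[OF assms]
  have sq: "(x + y) / 2 * ((x + y) / 2) = (x * x + 2 * (x * y) + y * y) / 4"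
    "(x - y) / 2 * ((x - y) / 2) = (x * x - 2 * (x * y) + y * y) / 4" for x y :: real
    by (simp_all add: field_simps)
  show "covariance n num_pos num_pos = (covariance n num_terms num_terms
      + 2 * covariance n num_terms num_excess + covariance n num_excess num_excess) / 4"
    unfolding covariance_def num_pos_terms sq by (simp add: int) (simp add: field_simps)
  show "covariance n num_neg num_neg = (covariance n num_terms num_terms
      - 2 * covariance n num_terms num_excess + covariance n num_excess num_excess) / 4"
    unfolding covariance_def num_neg_terms sq by (simp add: int) (simp add: field_simps)
qed

lemma variance_limit:
  assumes "(\<lambda>n. covariance n X X / real n) \<longlonglongrightarrow> V"
  shows "(\<lambda>n. measure_pmf.variance (unif n) X / real n) \<longlonglongrightarrow> V"
  using assms
  by (rule Lim_transform_eventually) (auto intro!: eventually_sequentiallyI[of 1] simp: variance_covariance)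

text \<open>Both variances have the same leading term because the covariance is of lower order than \<open>n\<close>.\<close>

lemma variance_pos_neg:
  "(\<lambda>n. measure_pmf.variance (unif n) num_pos / real n) \<longlonglongrightarrow> (29 * sqrt 5 - 25) / 1000"
  "(\<lambda>n. measure_pmf.variance (unif n) num_neg / real n) \<longlonglongrightarrow> (29 * sqrt 5 - 25) / 1000"
proof -
  have eq: "(2 * sqrt 5 / 125 + 2 * 0 + (sqrt 5 - 1) / 10) / 4 = (29 * sqrt 5 - 25) / 1000"
    "(2 * sqrt 5 / 125 - 2 * 0 + (sqrt 5 - 1) / 10) / 4 = (29 * sqrt 5 - 25) / 1000"
    by (simp_all add: field_simps)
  have "(\<lambda>n. (covariance n num_terms num_terms / real n + 2 * (covariance n num_terms num_excess / real n)
      + covariance n num_excess num_excess / real n) / 4)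
      \<longlonglongrightarrow> (2 * sqrt 5 / 125 + 2 * 0 + (sqrt 5 - 1) / 10) / 4"
    by (intro tendsto_intros variance_terms variance_excess covariance_terms_excess) simp
  then have "(\<lambda>n. covariance n num_pos num_pos / real n) \<longlonglongrightarrow> (2 * sqrt 5 / 125 + 2 * 0 + (sqrt 5 - 1) / 10) / 4"
    by (rule Lim_transform_eventually)
      (auto intro!: eventually_sequentiallyI[of 1] simp: covariance_pos_neg field_simps)
  from variance_limit[OF this]
  show "(\<lambda>n. measure_pmf.variance (unif n) num_pos / real n) \<longlonglongrightarrow> (29 * sqrt 5 - 25) / 1000"
    unfolding eq .
  have "(\<lambda>n. (covariance n num_terms num_terms / real n - 2 * (covariance n num_terms num_excess / real n)
      + covariance n num_excess num_excess / real n) / 4)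
      \<longlonglongrightarrow> (2 * sqrt 5 / 125 - 2 * 0 + (sqrt 5 - 1) / 10) / 4"
    by (intro tendsto_intros variance_terms variance_excess covariance_terms_excess) simp
  then have "(\<lambda>n. covariance n num_neg num_neg / real n) \<longlonglongrightarrow> (2 * sqrt 5 / 125 - 2 * 0 + (sqrt 5 - 1) / 10) / 4"
    by (rule Lim_transform_eventually)
      (auto intro!: eventually_sequentiallyI[of 1] simp: covariance_pos_neg field_simps)
  from variance_limit[OF this]
  show "(\<lambda>n. measure_pmf.variance (unif n) num_neg / real n) \<longlonglongrightarrow> (29 * sqrt 5 - 25) / 1000"
    unfolding eq .
qed

lemma rate_imp_limit:
  fixes u :: "nat \<Rightarrow> real"
  assumes "(\<lambda>n. real n * u n) \<longlonglongrightarrow> 0"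
  shows "u \<longlonglongrightarrow> 0"
proof (rule Lim_null_comparison[OF _ tendsto_rabs_zero[OF assms]])
  show "\<forall>\<^sub>F n in sequentially. norm (u n) \<le> \<bar>real n * u n\<bar>"
    by (rule eventually_sequentiallyI[of 1]) (simp add: abs_mult mult_le_cancel_right1)
qed

lemma expectation_terms_limit: "(\<lambda>n. E_unif n num_terms - real n / 5) \<longlonglongrightarrow> (35 - sqrt 5) / 50"
  using tendsto_add[OF rate_imp_limit[OF expectation_terms] tendsto_const[of "(35 - sqrt 5) / 50"]] by simp



lemma expectation_excess_limit: "(\<lambda>n. E_unif n num_excess) \<longlonglongrightarrow> golden_ratio / 2"
  using tendsto_add[OF rate_imp_limit[OF expectation_excess] tendsto_const[of "golden_ratio / 2"]] by simp

lemma expectation_pos_neg: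
  assumes "n > 0"
  shows "E_unif n num_pos = (E_unif n num_terms + E_unif n num_excess) / 2"
    and "E_unif n num_neg = (E_unif n num_terms - E_unif n num_excess) / 2"
  unfolding num_pos_terms num_neg_terms by (simp_all add: integrable_unif[OF assms])

lemma expectation_pos_neg_limit:
  "(\<lambda>n. E_unif n num_pos - real n / 10) \<longlonglongrightarrow> (95 + 23 * sqrt 5) / 200"
  "(\<lambda>n. E_unif n num_neg - real n / 10) \<longlonglongrightarrow> (45 - 27 * sqrt 5) / 200"
proof -
  have eq: "((35 - sqrt 5) / 50 + golden_ratio / 2) / 2 = (95 + 23 * sqrt 5) / 200"
    "((35 - sqrt 5) / 50 - golden_ratio / 2) / 2 = (45 - 27 * sqrt 5) / 200"
    by (simp_all add: golden_ratio_def field_simps)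
  have "(\<lambda>n. (E_unif n num_terms - real n / 5 + E_unif n num_excess) / 2)
      \<longlonglongrightarrow> ((35 - sqrt 5) / 50 + golden_ratio / 2) / 2"
    by (intro tendsto_intros expectation_terms_limit expectation_excess_limit) simp
  then show "(\<lambda>n. E_unif n num_pos - real n / 10) \<longlonglongrightarrow> (95 + 23 * sqrt 5) / 200"
    unfolding eq by (rule Lim_transform_eventually)
      (auto intro!: eventually_sequentiallyI[of 1] simp: expectation_pos_neg field_simps)
  have "(\<lambda>n. (E_unif n num_terms - real n / 5 - E_unif n num_excess) / 2)
      \<longlonglongrightarrow> ((35 - sqrt 5) / 50 - golden_ratio / 2) / 2"
    by (intro tendsto_intros expectation_terms_limit expectation_excess_limit) simp
  then show "(\<lambda>n. E_unif n num_neg - real n / 10) \<longlonglongrightarrow> (45 - 27 * sqrt 5) / 200"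
    unfolding eq by (rule Lim_transform_eventually)
      (auto intro!: eventually_sequentiallyI[of 1] simp: expectation_pos_neg field_simps)
qed

lemma centre_negligible:
  fixes u :: "nat \<Rightarrow> real"
  assumes "u \<longlonglongrightarrow> L"
  shows "(\<lambda>n. u n / sqrt (real n)) \<longlonglongrightarrow> 0"
proof -
  have "(\<lambda>n. 1 / sqrt (real n)) \<longlonglongrightarrow> 0" by real_asymp
  from tendsto_mult[OF assms this] show ?thesis by simp
qed

lemma sqrt5_bounds: "2.236 < sqrt 5" "sqrt 5 < 2.2361"
  by (rule real_less_rsqrt, simp add: power2_eq_square)
    (rule real_less_lsqrt, simp_all add: power2_eq_square)

text \<open>The linear change from \<open>(num_terms, num_excess)\<close> to the two summand counts turns the diagonal form
  \<open>limit_variance\<close> into one with equal diagonal entries and a negative mixed coefficient.\<close>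

lemma joint_limit_pos_neg:
  "weakly_converges (\<lambda>n. standardized_joint_law (unif n) num_pos num_neg)
     (bivariate_std_normal ((10 * sqrt 5 - 121) / 179))"
proof -
  define V C where "V = (29 * sqrt 5 - 25) / 1000" and "C = (25 - 21 * sqrt 5) / 1000"
  have V: "V > 0" and C: "\<bar>C\<bar> < V" using sqrt5_bounds by (auto simp: V_def C_def abs_less_iff)
  have VV: "sqrt V * sqrt V = V" using V by simp
  have rho: "C / V = (10 * sqrt 5 - 121) / 179"
    using sqrt5_bounds by (simp add: V_def C_def divide_simps) (simp add: algebra_simps)
  have "weakly_converges (\<lambda>n. standardized_joint_law (unif n) num_pos num_neg)
      (bivariate_std_normal (C / (sqrt V * sqrt V)))"
  proof (rule standardized_joint_law_limit[where \<mu> = "\<lambda>n. real n / 10" and \<nu> = "\<lambda>n. real n / 10"])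
    show "finite (set_pmf (unif n))" if "n > 0" for n using that by (rule finite_set_unif)
    show "(\<lambda>n. measure_pmf.variance (unif n) num_pos / real n) \<longlonglongrightarrow> V"
      "(\<lambda>n. measure_pmf.variance (unif n) num_neg / real n) \<longlonglongrightarrow> V"
      unfolding V_def by (rule variance_pos_neg)+
    show "(\<lambda>n. (E_unif n num_pos - real n / 10) / sqrt (real n)) \<longlonglongrightarrow> 0"
      "(\<lambda>n. (E_unif n num_neg - real n / 10) / sqrt (real n)) \<longlonglongrightarrow> 0"
      by (rule centre_negligible, rule expectation_pos_neg_limit)+
    show "\<bar>C\<bar> < sqrt V * sqrt V" using C VV by simp
    fix s t
    have "limit_variance ((s + t) / 2) ((s - t) / 2) = V * s\<^sup>2 + 2 * C * s * t + V * t\<^sup>2"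
      by (simp add: limit_variance_def V_def C_def power2_eq_square field_simps)
    moreover have "s / sqrt (real n) * (num_pos x - real n / 10) + t / sqrt (real n) * (num_neg x - real n / 10)
        = (s + t) / 2 / sqrt (real n) * (num_terms x - real n / 5) + (s - t) / 2 / sqrt (real n) * num_excess x" for n x
    proof -
      define r where "r = 1 / sqrt (real n)"
      have "s * r * (num_pos x - real n / 10) + t * r * (num_neg x - real n / 10)
        = (s + t) / 2 * r * (num_terms x - real n / 5) + (s - t) / 2 * r * num_excess x"
        unfolding num_pos_terms num_neg_terms by (simp add: field_simps)
      then show ?thesis by (simp add: r_def)
    qed
    ultimately show "(\<lambda>n. \<integral>x. cis (s / sqrt (real n) * (num_pos x - real n / 10)
          + t / sqrt (real n) * (num_neg x - real n / 10)) \<partial>measure_pmf (unif n))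
        \<longlonglongrightarrow> of_real (exp (- (V * s\<^sup>2 + 2 * C * s * t + V * t\<^sup>2) / 2))"
      using terms_excess_central_limit[of "(s + t) / 2" "(s - t) / 2"] by (simp only:)
  qed (use V in auto)
  then show ?thesis unfolding VV rho .
qed

lemma joint_limit_sum_difference:
  "weakly_converges (\<lambda>n. standardized_joint_law (unif n) (\<lambda>x. num_pos x + num_neg x) (\<lambda>x. num_pos x - num_neg x))
     (std_normal \<Otimes>\<^sub>M std_normal)"
proof -
  define V W where "V = 2 * sqrt 5 / 125" and "W = (sqrt 5 - 1) / 10"
  have V: "V > 0" and W: "W > 0" using sqrt5_bounds by (auto simp: V_def W_def)
  have terms: "(\<lambda>x. num_pos x + num_neg x) = num_terms" and excess: "(\<lambda>x. num_pos x - num_neg x) = num_excess"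
    by (simp_all add: num_terms_def num_excess_def fun_eq_iff)
  have "weakly_converges (\<lambda>n. standardized_joint_law (unif n) num_terms num_excess)
      (bivariate_std_normal (0 / (sqrt V * sqrt W)))"
  proof (rule standardized_joint_law_limit[where \<mu> = "\<lambda>n. real n / 5" and \<nu> = "\<lambda>n. 0"])
    show "finite (set_pmf (unif n))" if "n > 0" for n using that by (rule finite_set_unif)
    show "(\<lambda>n. measure_pmf.variance (unif n) num_terms / real n) \<longlonglongrightarrow> V"
      unfolding V_def by (rule variance_limit[OF variance_terms])
    show "(\<lambda>n. measure_pmf.variance (unif n) num_excess / real n) \<longlonglongrightarrow> W"
      unfolding W_def by (rule variance_limit[OF variance_excess])
    show "(\<lambda>n. (E_unif n num_terms - real n / 5) / sqrt (real n)) \<longlonglongrightarrow> 0"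
      by (rule centre_negligible[OF expectation_terms_limit])
    show "(\<lambda>n. (E_unif n num_excess - 0) / sqrt (real n)) \<longlonglongrightarrow> 0"
      using centre_negligible[OF expectation_excess_limit] by simp
    fix s t
    have "limit_variance s t = V * s\<^sup>2 + 2 * 0 * s * t + W * t\<^sup>2"
      by (simp add: limit_variance_def V_def W_def)
    then show "(\<lambda>n. \<integral>x. cis (s / sqrt (real n) * (num_terms x - real n / 5)
          + t / sqrt (real n) * (num_excess x - 0)) \<partial>measure_pmf (unif n))
        \<longlonglongrightarrow> of_real (exp (- (V * s\<^sup>2 + 2 * 0 * s * t + W * t\<^sup>2) / 2))"
      using terms_excess_central_limit[of s t] by (simp only: diff_zero)
  qed (use V W in auto)
  then show ?thesis unfolding terms excess std_normal_pair by simp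
qed

lemma asymp_linear:
  fixes u :: "nat \<Rightarrow> real"
  assumes "(\<lambda>n. u n / real n) \<longlonglongrightarrow> c" "c \<noteq> 0"
  shows "u \<sim>[at_top] (\<lambda>n. c * real n)"
proof (rule asymp_equivI')
  have "(\<lambda>n. u n / real n / c) \<longlonglongrightarrow> c / c" using assms by (intro tendsto_intros)
  then show "(\<lambda>n. u n / (c * real n)) \<longlonglongrightarrow> 1" using assms(2) by (simp add: mult.commute)
qed

theorem theorem1p6:
  shows
    "((\<lambda>n. measure_pmf.expectation (unif n) num_pos
             - (1 / 10 * real n + (95 + 23 * sqrt 5) / 200)) \<in> o(\<lambda>_. 1) \<and>
      (\<lambda>n. measure_pmf.expectation (unif n) num_pos - measure_pmf.expectation (unif n) num_neg
             - (sqrt 5 + 1) / 4) \<in> o(\<lambda>_. 1) \<and>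
      (sqrt 5 + 1) / 4 = golden_ratio / 2)
   \<and>
     ((\<lambda>n. measure_pmf.variance (unif n) num_pos)
        \<sim>[at_top] (\<lambda>n. (29 * sqrt 5 - 25) / 1000 * real n) \<and>
      (\<lambda>n. measure_pmf.variance (unif n) num_neg)
        \<sim>[at_top] (\<lambda>n. (29 * sqrt 5 - 25) / 1000 * real n))
   \<and>
     (weakly_converges (\<lambda>n. standardized_joint_law (unif n) num_pos num_neg)
        (bivariate_std_normal ((10 * sqrt 5 - 121) / 179)) \<and>
      (10 * sqrt 5 - 121) / 179 < (0::real) \<and>
      (10 * sqrt 5 - 121) / 179 = - (21 - 2 * golden_ratio) / (29 + 2 * golden_ratio) \<and>
      \<bar>(10 * sqrt 5 - 121) / 179 - (- 0.551)\<bar> < (0.0005::real))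
   \<and>
     weakly_converges
       (\<lambda>n. standardized_joint_law (unif n)
              (\<lambda>x. num_pos x + num_neg x) (\<lambda>x. num_pos x - num_neg x))
       (std_normal \<Otimes>\<^sub>M std_normal)"
proof (intro conjI)
  show "(\<lambda>n. E_unif n num_pos - (1 / 10 * real n + (95 + 23 * sqrt 5) / 200)) \<in> o(\<lambda>_. 1)"
  proof (rule smalloI_tendsto)
    show "(\<lambda>n. (E_unif n num_pos - (1 / 10 * real n + (95 + 23 * sqrt 5) / 200)) / 1) \<longlonglongrightarrow> 0"
      using tendsto_diff[OF expectation_pos_neg_limit(1) tendsto_const[of "(95 + 23 * sqrt 5) / 200"]]
      by (simp add: diff_diff_eq)
  qed simp
  show "(\<lambda>n. E_unif n num_pos - E_unif n num_neg - (sqrt 5 + 1) / 4) \<in> o(\<lambda>_. 1)"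
  proof (rule smalloI_tendsto)
    have "(\<lambda>n. (E_unif n num_pos - real n / 10) - (E_unif n num_neg - real n / 10) - (sqrt 5 + 1) / 4)
        \<longlonglongrightarrow> (95 + 23 * sqrt 5) / 200 - (45 - 27 * sqrt 5) / 200 - (sqrt 5 + 1) / 4"
      by (intro tendsto_diff expectation_pos_neg_limit tendsto_const)
    also have "(95 + 23 * sqrt 5) / 200 - (45 - 27 * sqrt 5) / 200 - (sqrt 5 + 1) / 4 = 0"
      by (simp add: field_simps)
    finally show "(\<lambda>n. (E_unif n num_pos - E_unif n num_neg - (sqrt 5 + 1) / 4) / 1) \<longlonglongrightarrow> 0"
      by simp
  qed simp
  show "(sqrt 5 + 1) / 4 = golden_ratio / 2" by (simp add: golden_ratio_def)
  have c: "(29 * sqrt 5 - 25) / 1000 \<noteq> 0" using sqrt5_bounds by simp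
  show "(\<lambda>n. measure_pmf.variance (unif n) num_pos) \<sim>[at_top] (\<lambda>n. (29 * sqrt 5 - 25) / 1000 * real n)"
    by (rule asymp_linear[OF variance_pos_neg(1) c])
  show "(\<lambda>n. measure_pmf.variance (unif n) num_neg) \<sim>[at_top] (\<lambda>n. (29 * sqrt 5 - 25) / 1000 * real n)"
    by (rule asymp_linear[OF variance_pos_neg(2) c])
  show "(10 * sqrt 5 - 121) / 179 < (0::real)" using sqrt5_bounds by simp
  show "(10 * sqrt 5 - 121) / 179 = - (21 - 2 * golden_ratio) / (29 + 2 * golden_ratio)"
  proof -
    have "29 + 2 * golden_ratio = 30 + sqrt 5" "21 - 2 * golden_ratio = 20 - sqrt 5"
      by (simp_all add: golden_ratio_def field_simps)
    moreover have "(10 * sqrt 5 - 121) / 179 = - (20 - sqrt 5) / (30 + sqrt 5)"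
      using sqrt5_bounds by (simp add: divide_simps) (simp add: algebra_simps)
    ultimately show ?thesis by (simp only:)
  qed
  show "\<bar>(10 * sqrt 5 - 121) / 179 - (- 0.551)\<bar> < (0.0005::real)"
    using sqrt5_bounds by (auto simp: abs_less_iff field_simps)
qed (rule joint_limit_pos_neg joint_limit_sum_difference)+

end
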